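(* Let $X_1,\ldots,X_k$ be locally Lipschitz vector fields on an open set $\Omega\subset\mathbb{R}^n$. Assume that the function $h\in L^1_{\rm loc}(\Omega)$ is an upper gradient of the function $f\in L^1_{\rm loc}(\Omega)$ along the vector field $\sum_{j=1}^kc_jX_j$ for all real constants $c_1,\dots,c_k$ with $\sum_{j=1}^kc_j^2\le1$. Then the distributional derivatives $X_1f,\ldots,X_kf$ are locally integrable (i.e. they exist in $L^1_{\rm loc}(\Omega)$) and satisfy $$\sum_{j=1}^k(X_jf)^2\le h^2$$ almost everywhere on $\Omega$.
   Context: A vector field on $\Omega$ is a map $X=(a_1,\dots,a_n):\Omega\to\mathbb{R}^n$. If $X$ is locally Lipschitz, for $x\in\Omega$ let $t\mapsto\gamma^X_t(x)\in\Omega$, $t\in\Gamma^X_x$ (an open interval containing $0$), be the unique maximal solution of $\dot\gamma(t)=X(\gamma(t))$, $\gamma(0)=x$. Put $\Gamma^X=\bigcup_{x\in\Omega}\Gamma^X_x\times\{x\}$, an open subset of $\mathbb{R}\times\Omega$, and $\Gamma^X_+=\{(t,x)\in\Gamma^X: t>0\}$. "Almost all $(t,x)\in\Gamma^X_+$" refers to Lebesgue measure in $\mathbb{R}^{n+1}$. Upper gradient: a nonnegative function $h\in L^1_{\rm loc}(\Omega)$ is an upper gradient for $f\in L^1_{\rm loc}(\Omega)$ along $X$ if $|f(\gamma^X_t(x))-f(x)|\le\int_0^th(\gamma^X_s(x))\,ds$ for almost all $(t,x)\in\Gamma^X_+$. Distributional derivative: $g\in L^1_{\rm loc}(\Omega)$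 is the distributional derivative of $f\in L^1_{\rm loc}(\Omega)$ with respect to $X$, written $g=Xf$, if for each $u\in C_0^\infty(\Omega)$ $$\int_\Omega g\,u\,dx=-\int_\Omega f\,Xu\,dx-\int_\Omega f\,u\,\operatorname{div}X\,dx,$$ where $Xu=\sum_i a_i\,\partial u/\partial x_i$ and $\operatorname{div}X=\sum_i\partial a_i/\partial x_i$ (defined a.e. and locally bounded by Rademacher's theorem). *)

theory Defs
  imports "HOL-Analysis.Analysis"
begin

text \<open>
  Functions and vector fields on an open set \<open>\<Omega>\<close> are total functions of which only the
  values on \<open>\<Omega>\<close> matter. An element of \<open>L\<^sup>1\<^sub>l\<^sub>o\<^sub>c(\<Omega>)\<close> is given by a
  real-valued representative, and all conditions on it are imposed almost everywhere.
\<close>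

definition L1_loc :: "(real^'n) set \<Rightarrow> (real^'n \<Rightarrow> real) set" where
  "L1_loc \<Omega> = {f. \<forall>K. compact K \<and> K \<subseteq> \<Omega> \<longrightarrow> set_integrable lebesgue K f}"

text \<open>The library notion is for time-dependent fields; here the time argument is a dummy.\<close>

definition locally_Lipschitz_on :: "(real^'n) set \<Rightarrow> (real^'n \<Rightarrow> real^'n) \<Rightarrow> bool" where
  "locally_Lipschitz_on \<Omega> X \<longleftrightarrow> local_lipschitz (UNIV :: real set) \<Omega> (\<lambda>_. X)"


section \<open>The flow of a vector field\<close>

definition integral_curve ::
  "(real^'n) set \<Rightarrow> (real^'n \<Rightarrow> real^'n) \<Rightarrow> real^'n \<Rightarrow> real set \<Rightarrow> (real \<Rightarrow> real^'n) \<Rightarrow> bool" where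
  "integral_curve \<Omega> X x I \<gamma> \<longleftrightarrow>
     open I \<and> is_interval I \<and> 0 \<in> I \<and> \<gamma> 0 = x \<and>
     (\<forall>t\<in>I. \<gamma> t \<in> \<Omega> \<and> (\<gamma> has_vector_derivative X (\<gamma> t)) (at t))"

definition maximal_integral_curve ::
  "(real^'n) set \<Rightarrow> (real^'n \<Rightarrow> real^'n) \<Rightarrow> real^'n \<Rightarrow> real set \<Rightarrow> (real \<Rightarrow> real^'n) \<Rightarrow> bool" where
  "maximal_integral_curve \<Omega> X x I \<gamma> \<longleftrightarrow>
     integral_curve \<Omega> X x I \<gamma> \<and>
     (\<forall>J \<eta>. integral_curve \<Omega> X x J \<eta> \<and> I \<subseteq> J \<and> (\<forall>t\<in>I. \<eta> t = \<gamma> t) \<longrightarrow> J = I)"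

text \<open>
  For \<open>\<Omega>\<close> open, \<open>X\<close> locally Lipschitz on \<open>\<Omega>\<close> and \<open>x \<in> \<Omega>\<close>, the maximal integral curve
  exists and is unique on its interval, so both descriptions below are proper;
  \<open>flow \<Omega> X t x\<close> is meaningful for \<open>t \<in> flow_interval \<Omega> X x\<close>.
\<close>

definition flow_interval :: "(real^'n) set \<Rightarrow> (real^'n \<Rightarrow> real^'n) \<Rightarrow> real^'n \<Rightarrow> real set" where
  "flow_interval \<Omega> X x = (THE I. \<exists>\<gamma>. maximal_integral_curve \<Omega> X x I \<gamma>)"

definition flow :: "(real^'n) set \<Rightarrow> (real^'n \<Rightarrow> real^'n) \<Rightarrow> real \<Rightarrow> real^'n \<Rightarrow> real^'n" where
  "flow \<Omega> X t x = (THE y. \<exists>I \<gamma>. maximal_integral_curve \<Omega> X x I \<gamma> \<and> t \<in> I \<and> y = \<gamma> t)"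

definition flow_domain_pos :: "(real^'n) set \<Rightarrow> (real^'n \<Rightarrow> real^'n) \<Rightarrow> (real \<times> (real^'n)) set" where
  "flow_domain_pos \<Omega> X = {(t, x). x \<in> \<Omega> \<and> t \<in> flow_interval \<Omega> X x \<and> 0 < t}"


section \<open>Upper gradients\<close>

text \<open>
  The integral of the nonnegative function \<open>h\<close> along a curve takes values in \<open>[0,\<infinity>]\<close>.
\<close>

definition upper_gradient ::
  "(real^'n) set \<Rightarrow> (real^'n \<Rightarrow> real^'n) \<Rightarrow> (real^'n \<Rightarrow> real) \<Rightarrow> (real^'n \<Rightarrow> real) \<Rightarrow> bool" where
  "upper_gradient \<Omega> X h f \<longleftrightarrow>
     h \<in> L1_loc \<Omega> \<and> f \<in> L1_loc \<Omega> \<and>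
     (AE x in lebesgue. x \<in> \<Omega> \<longrightarrow> 0 \<le> h x) \<and>
     (AE (t, x) in lebesgue. (t, x) \<in> flow_domain_pos \<Omega> X \<longrightarrow>
        ennreal \<bar>f (flow \<Omega> X t x) - f x\<bar>
          \<le> (\<integral>\<^sup>+ s\<in>{0..t}. ennreal (h (flow \<Omega> X s x)) \<partial>lebesgue))"


section \<open>Distributional derivatives along a vector field\<close>

definition partial_deriv :: "'n \<Rightarrow> (real^'n \<Rightarrow> real) \<Rightarrow> real^'n \<Rightarrow> real" where
  "partial_deriv i u x = deriv (\<lambda>t. u (x + t *\<^sub>R axis i 1)) 0"

primrec iterated_partial :: "'n list \<Rightarrow> (real^'n \<Rightarrow> real) \<Rightarrow> real^'n \<Rightarrow> real" where
  "iterated_partial [] u = u"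
| "iterated_partial (i # is) u = partial_deriv i (iterated_partial is u)"

text \<open>
  \<open>C\<^sub>0\<^sup>\<infinity>(\<Omega>)\<close>, its elements being extended by zero to the whole space. That all iterated
  partial derivatives are differentiable says that they all exist and are continuous.
\<close>

definition test_functions :: "(real^'n) set \<Rightarrow> (real^'n \<Rightarrow> real) set" where
  "test_functions \<Omega> =
     {u. (\<forall>is x. iterated_partial is u differentiable (at x)) \<and>
         compact (closure {x. u x \<noteq> 0}) \<and> closure {x. u x \<noteq> 0} \<subseteq> \<Omega>}"

definition field_deriv :: "(real^'n \<Rightarrow> real^'n) \<Rightarrow> (real^'n \<Rightarrow> real) \<Rightarrow> real^'n \<Rightarrow> real" where
  "field_deriv X u x = (\<Sum>i\<in>UNIV. X x $ i * partial_deriv i u x)"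

text \<open>
  For locally Lipschitz \<open>X\<close> the partial derivatives exist almost everywhere; the arbitrary
  value elsewhere does not affect the integrals below.
\<close>

definition divergence :: "(real^'n \<Rightarrow> real^'n) \<Rightarrow> real^'n \<Rightarrow> real" where
  "divergence X x = (\<Sum>i\<in>UNIV. partial_deriv i (\<lambda>y. X y $ i) x)"

definition distributional_deriv ::
  "(real^'n) set \<Rightarrow> (real^'n \<Rightarrow> real^'n) \<Rightarrow> (real^'n \<Rightarrow> real) \<Rightarrow> (real^'n \<Rightarrow> real) \<Rightarrow> bool" where
  "distributional_deriv \<Omega> X f g \<longleftrightarrow>
     f \<in> L1_loc \<Omega> \<and> g \<in> L1_loc \<Omega> \<and>
     (\<forall>u\<in>test_functions \<Omega>.
        (LINT x:\<Omega>|lebesgue. g x * u x) =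
          - (LINT x:\<Omega>|lebesgue. f x * field_deriv X u x)
          - (LINT x:\<Omega>|lebesgue. f x * u x * divergence X x))"

end

theory Submission
  imports Defs
begin

text \<open>
  Fix \<open>X = \<Sum>\<^sub>j c\<^sub>j X\<^sub>j\<close> with \<open>|c| \<le> 1\<close>, a test function \<open>u\<close>, and let \<open>\<phi>\<^sub>t\<close> be the flow of \<open>X\<close>, cut off
  near the support of \<open>u\<close>. Integrating the upper gradient inequality against \<open>|u|\<close> bounds
  \<open>\<integral>(f \<circ> \<phi>\<^sub>t - f) u dx\<close> by \<open>\<integral>\<^sub>0\<^sup>t \<integral>(h \<circ> \<phi>\<^sub>s) |u| dx ds\<close>. After division by \<open>t\<close>, as \<open>t \<rightarrow> 0\<close>, the left side
  converges to the functional \<open>T\<^sub>c u = - \<integral>f (Xu + u div X) dx\<close> and the right side to \<open>\<integral>h |u| dx\<close>. No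
  Jacobian of \<open>\<phi>\<^sub>t\<close> is needed: \<open>\<phi>\<^sub>t\<close> and its inverse are Lipschitz with constant \<open>1 + O(t)\<close>, so \<open>\<phi>\<^sub>t\<close>
  distorts Lebesgue measure by a factor \<open>1 + O(t)\<close> (Vitali covering), which makes the difference
  quotients uniformly \<open>L\<^sup>1\<close>-bounded in \<open>f\<close> and reduces their limit to smooth \<open>f\<close>, where it is an
  integration by parts.

  Hence \<open>|T\<^sub>c u| \<le> \<integral>h |u| dx\<close>. By duality each \<open>T\<^sub>j\<close> has a density \<open>g\<^sub>j\<close> with respect to \<open>dx\<close>, and linearity in
  \<open>c\<close> gives \<open>\<Sum>\<^sub>j c\<^sub>j g\<^sub>j \<le> h\<close> almost everywhere for each unit vector \<open>c\<close>; countably many \<open>c\<close> suffice for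
  \<open>\<Sum>\<^sub>j g\<^sub>j\<^sup>2 \<le> h\<^sup>2\<close>.
\<close>

text \<open>The hypothesis is awkward in two ways: it concerns the flow of \<open>X\<close> inside
  \<open>\<Omega>\<close>, which may leave \<open>\<Omega>\<close> in finite time, and it holds only
  for almost all \<open>(t, x)\<close>. The first is met by a bounded, globally Lipschitz field
  \<open>Y\<close> whose orbits from the support of \<open>u\<close> coincide with those of
  \<open>X\<close> for short times. The second is met by Fubini's theorem: almost every
  \<open>t\<close> is admissible, so admissible times can be picked tending to 0. As
  \<open>f\<close> and \<open>h\<close> are given almost everywhere, composing them with the flow
  makes sense only because the flow pulls null sets back to null sets, which is the distortion
  estimate again. That estimate must have the form \<open>1 + O(t)\<close>, with no dimensional
  factor in front, to survive the division by \<open>t\<close>. The divergence is a pointwise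
  derivative that exists almost everywhere, so the integration by parts rests on the existence of
  partial derivatives of Lipschitz functions. The duality is carried out in
  \<open>L^1(h dx)\<close>, where every \<open>T_c\<close> with \<open>|c| \<le> 1\<close> is a
  contraction: its density there is bounded by 1, and multiplication by \<open>h\<close> turns it
  into a density for \<open>dx\<close>.\<close>

section \<open>Comparison of measures on small balls\<close>

text \<open>Vitali's theorem picks countably many disjoint balls that satisfy the inequality and
  cover \<open>E\<close> up to a Lebesgue null set, which \<open>M1\<close> ignores. The balls lie
  in an open \<open>U\<close> barely larger than \<open>E\<close>, and \<open>bd\<close> makes the
  excess small for \<open>M2\<close>.\<close>

lemma vitali_compare:
  fixes E :: "'a::euclidean_space set"
  assumes sets1 [measurable_cong]: "sets M1 = sets borel" and sets2 [measurable_cong]: "sets M2 = sets borel"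
    and null: "\<And>N. N \<in> null_sets lborel \<Longrightarrow> emeasure M1 N = 0"
    and bd: "\<And>A. A \<in> sets borel \<Longrightarrow> emeasure M2 A \<le> ennreal C * emeasure lborel A"
    and E [measurable]: "E \<in> sets borel"
    and fine: "\<And>x d. \<lbrakk>x \<in> E; 0 < d\<rbrakk> \<Longrightarrow>
       \<exists>a r. x \<in> ball a r \<and> r < d \<and> emeasure M1 (ball a r) \<le> emeasure M2 (ball a r)"
  shows "emeasure M1 E \<le> emeasure M2 E"
proof (rule ennreal_le_epsilon)
  fix e :: real assume "0 < e"
  \<comment> \<open>The bound \<open>C\<close> may be zero or negative; \<open>C'\<close> can be
    divided by.\<close>
  define C' where "C' = max C 1"
  have "C' > 0" by (simp add: C'_def)
  obtain U where U: "open U" "E \<subseteq> U" "emeasure lborel (U - E) < ennreal (e / C')"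
    using outer_regular_lborel[OF E, of "e / C'"] \<open>0 < e\<close> \<open>C' > 0\<close> by auto
  have [measurable]: "U \<in> sets borel" using U(1) by auto
  define K where "K = {p :: 'a \<times> real. ball (fst p) (snd p) \<subseteq> U \<and>
      emeasure M1 (ball (fst p) (snd p)) \<le> emeasure M2 (ball (fst p) (snd p))}"
  have "\<exists>i. i \<in> K \<and> x \<in> ball (fst i) (snd i) \<and> snd i < d" if xE: "x \<in> E" and d0: "0 < d" for x d
  proof -
    obtain \<epsilon> where \<epsilon>: "\<epsilon> > 0" "ball x \<epsilon> \<subseteq> U" using openE[OF U(1), of x] U(2) xE by blast
    \<comment> \<open>\<open>x\<close> lies in the ball but need not be its centre, hence half of
      \<open>\<epsilon>\<close>.\<close>
    obtain a r where ar: "x \<in> ball a r" "r < min d (\<epsilon>/2)" "emeasure M1 (ball a r) \<le> emeasure M2 (ball a r)"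
      using fine[OF xE, of "min d (\<epsilon>/2)"] d0 \<epsilon> by auto
    have rd: "r < d" using ar(2) by simp
    have "ball a r \<subseteq> ball x \<epsilon>"
    proof
      fix y assume y: "y \<in> ball a r"
      have "dist x y \<le> dist a x + dist a y" by (metis dist_commute dist_triangle)
      then show "y \<in> ball x \<epsilon>" using ar y by auto
    qed
    with \<epsilon>(2) have "ball a r \<subseteq> U" by blast
    then show ?thesis
      using ar(1,3) rd
      by (intro exI[of _ "(a, r)"]) (simp add: K_def)
  qed
  note vit = this
  obtain D where D: "countable D" "D \<subseteq> K"
      "pairwise (\<lambda>i j. disjnt (ball (fst i) (snd i)) (ball (fst j) (snd j))) D"
      "negligible (E - (\<Union>i\<in>D. ball (fst i) (snd i)))"
    by (rule Vitali_covering_theorem_balls[of E K fst snd, OF vit]) auto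
  define W where "W = (\<Union>i\<in>D. ball (fst i) (snd i))"
  have W_meas [measurable]: "W \<in> sets borel" unfolding W_def by (intro borel_open open_UN) auto
  have disj: "disjoint_family_on (\<lambda>i. ball (fst i) (snd i)) D"
    using D(3) by (auto simp: disjoint_family_on_def pairwise_def disjnt_def)
  have "E - W \<in> null_sets lborel"
    using D(4) unfolding W_def[symmetric] negligible_iff_null_sets
    by (auto simp: null_sets_completion_iff)
  then have 0: "emeasure M1 (E - W) = 0" by (rule null)
  have "emeasure M2 (U - E) \<le> ennreal C * emeasure lborel (U - E)" by (rule bd) auto
  also have "\<dots> \<le> ennreal C' * emeasure lborel (U - E)"
    by (intro mult_right_mono ennreal_leI) (auto simp: C'_def)
  also have "\<dots> \<le> ennreal C' * ennreal (e / C')"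
    using U(3) by (intro mult_left_mono) auto
  also have "\<dots> = ennreal e" using \<open>C' > 0\<close> \<open>0 < e\<close> by (simp add: ennreal_mult[symmetric])
  finally have UE: "emeasure M2 (U - E) \<le> ennreal e" .
  have "emeasure M1 E \<le> emeasure M1 ((E - W) \<union> W)" by (rule emeasure_mono) auto
  also have "\<dots> \<le> emeasure M1 (E - W) + emeasure M1 W" by (rule emeasure_subadditive) auto
  also have "\<dots> = emeasure M1 W" by (simp add: 0)
  also have "\<dots> = (\<integral>\<^sup>+i. emeasure M1 (ball (fst i) (snd i)) \<partial>count_space D)"
    unfolding W_def by (rule emeasure_UN_countable) (use D disj in \<open>auto simp: sets1\<close>)
  also have "\<dots> \<le> (\<integral>\<^sup>+i. emeasure M2 (ball (fst i) (snd i)) \<partial>count_space D)"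
    by (rule nn_integral_mono) (use D(2) in \<open>auto simp: K_def\<close>)
  also have "\<dots> = emeasure M2 W"
    unfolding W_def by (rule emeasure_UN_countable[symmetric]) (use D disj in \<open>auto simp: sets2\<close>)
  also have "\<dots> \<le> emeasure M2 (E \<union> (U - E))"
    using D(2) by (intro emeasure_mono) (auto simp: W_def K_def)
  also have "\<dots> \<le> emeasure M2 E + emeasure M2 (U - E)" by (rule emeasure_subadditive) auto
  also have "\<dots> \<le> emeasure M2 E + ennreal e" using UE by (rule add_left_mono)
  finally show "emeasure M1 E \<le> emeasure M2 E + ennreal e" .
qed

text \<open>The preimage under \<open>\<psi>\<close> is the image under \<open>\<phi>\<close>, and
  \<open>\<phi>\<close> maps a ball of radius \<open>r\<close> into one of radius
  \<open>l * r\<close>. So the comparison holds on every ball with exactly this constant, and the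
  Vitali argument carries it over to Borel sets without losing a dimensional factor.\<close>

lemma emeasure_vimage_lipschitz_homeo:
  fixes \<phi> \<psi> :: "'a::euclidean_space \<Rightarrow> 'a"
  assumes lip: "l-lipschitz_on UNIV \<phi>" and "0 < l"
    and inv: "\<And>x. \<psi> (\<phi> x) = x" "\<And>y. \<phi> (\<psi> y) = y"
    and \<psi> [measurable]: "\<psi> \<in> borel_measurable borel"
    and A [measurable]: "A \<in> sets borel"
  shows "emeasure lborel (\<psi> -` A) \<le> ennreal (l ^ DIM('a)) * emeasure lborel A"
proof -
  define M1 where "M1 = distr lborel borel \<psi>"
  define M2 where "M2 = scale_measure (ennreal (l ^ DIM('a))) (lborel :: 'a measure)"
  have vim: "\<psi> -` B = \<phi> ` B" for B
    using inv by (auto simp: image_iff) metis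
  have M1: "emeasure M1 B = emeasure lborel (\<psi> -` B)" if "B \<in> sets borel" for B
    using that unfolding M1_def by (subst emeasure_distr) auto
  have M2: "emeasure M2 B = ennreal (l ^ DIM('a)) * emeasure lborel B" for B
    by (simp add: M2_def)
  have "emeasure M1 A \<le> emeasure M2 A"
  proof (rule vitali_compare[where C = "l ^ DIM('a)"])
    fix N :: "'a set" assume N: "N \<in> null_sets lborel"
    then have "negligible N" by (simp add: negligible_iff_null_sets null_sets_completionI)
    then have "negligible (\<phi> ` N)"
    proof (rule negligible_locally_Lipschitz_image[rotated])
      show "\<exists>T B. open T \<and> x \<in> T \<and> (\<forall>y\<in>N \<inter> T. norm (\<phi> y - \<phi> x) \<le> B * norm (y - x))" for x
        by (rule exI[of _ UNIV], rule exI[of _ l])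
           (auto intro: lipschitz_on_normD[OF lip])
    qed simp
    moreover have "\<psi> -` N \<in> sets borel" using N by (intro measurable_sets_borel[OF \<psi>]) auto
    ultimately have "\<psi> -` N \<in> null_sets lborel"
      unfolding vim negligible_iff_null_sets by (simp add: null_sets_completion_iff)
    then show "emeasure M1 N = 0" using N by (subst M1) auto
  next
    fix x :: 'a and d :: real assume "0 < d"
    have "emeasure M1 (ball x (d/2)) \<le> emeasure M2 (ball x (d/2))"
    proof -
      have "emeasure M1 (ball x (d/2)) = emeasure lborel (\<phi> ` ball x (d/2))"
        by (simp add: M1 vim)
      also have "\<dots> \<le> emeasure lborel (ball (\<phi> x) (l * (d/2)))"
      proof (rule emeasure_mono)
        show "\<phi> ` ball x (d/2) \<subseteq> ball (\<phi> x) (l * (d/2))"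
        proof safe
          fix y assume "y \<in> ball x (d/2)"
          then have "l * dist x y < l * (d/2)" using \<open>0 < l\<close> by (intro mult_strict_left_mono) auto
          then show "\<phi> y \<in> ball (\<phi> x) (l * (d/2))"
            using lipschitz_onD[OF lip, of x y] by auto
        qed
      qed auto
      also have "\<dots> = emeasure M2 (ball x (d/2))"
        using \<open>0 < d\<close> \<open>0 < l\<close> unfolding M2
        by (simp add: emeasure_ball ennreal_mult[symmetric] power_mult_distrib unit_ball_vol_nonneg power_divide mult_ac)
      finally show ?thesis .
    qed
    then show "\<exists>a r. x \<in> ball a r \<and> r < d \<and> emeasure M1 (ball a r) \<le> emeasure M2 (ball a r)"
      using \<open>0 < d\<close> by (intro exI[of _ x] exI[of _ "d/2"]) auto
  qed (auto simp: M1_def M2_def)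
  then show ?thesis by (simp add: M1 M2)
qed

section \<open>Rademacher's theorem in one direction\<close>

text \<open>Where a Lipschitz function of one variable is not differentiable, the slopes over
  intervals shrinking to the point oscillate across some rational gap \<open>(p, q)\<close>.\<close>

definition slope_below :: "real \<Rightarrow> (real \<Rightarrow> real) \<Rightarrow> real \<Rightarrow> bool" where
  "slope_below p \<psi> x \<longleftrightarrow> (\<forall>d>0. \<exists>a b. x - d < a \<and> a < x \<and> x < b \<and> b < x + d \<and> \<psi> b - \<psi> a < p * (b - a))"

lemma slope_below_iff_nat:
  "slope_below p \<psi> x \<longleftrightarrow> (\<forall>n::nat. \<exists>a b. x - inverse (real (Suc n)) < a \<and> a < x \<and> x < b \<and>
     b < x + inverse (real (Suc n)) \<and> \<psi> b - \<psi> a < p * (b - a))" (is "_ \<longleftrightarrow> (\<forall>n. ?P n)")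
proof
  assume *: "\<forall>n. ?P n"
  show "slope_below p \<psi> x"
    unfolding slope_below_def
  proof safe
    fix d :: real assume "d > 0"
    then obtain n where "inverse (real (Suc n)) < d" using reals_Archimedean by auto
    moreover obtain a b where "x - inverse (real (Suc n)) < a \<and> a < x \<and> x < b \<and>
     b < x + inverse (real (Suc n)) \<and> \<psi> b - \<psi> a < p * (b - a)"
      using * by blast
    ultimately show "\<exists>a b. x - d < a \<and> a < x \<and> x < b \<and> b < x + d \<and> \<psi> b - \<psi> a < p * (b - a)"
      by (intro exI[of _ a] exI[of _ b]) linarith
  qed
next
  assume "slope_below p \<psi> x"
  then show "\<forall>n. ?P n" unfolding slope_below_def by (meson inverse_positive_iff_positive of_nat_0_less_iff zero_less_Suc)
qed

text \<open>At a fixed scale the set is open, a union of open sets over the admissible pairs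
  \<open>(a, b)\<close>; the scales \<open>1 / (n + 1)\<close> make it a countable intersection of
  these.\<close>

lemma borel_slope_below [measurable]: "{x. slope_below p \<psi> x} \<in> sets borel"
proof -
  have "open {x. \<exists>a b. x - e < a \<and> a < x \<and> x < b \<and> b < x + e \<and> \<psi> b - \<psi> a < p * (b - a)}" for e
  proof -
    have "{x. \<exists>a b. x - e < a \<and> a < x \<and> x < b \<and> b < x + e \<and> \<psi> b - \<psi> a < p * (b - a)}
      = (\<Union>(a, b)\<in>{(a, b). \<psi> b - \<psi> a < p * (b - a)}. {a<..<b} \<inter> {b - e<..<a + e})"
      by (auto simp: less_diff_eq diff_less_eq add.commute) fastforce
    then show ?thesis by auto
  qed
  moreover have "{x. slope_below p \<psi> x} = (\<Inter>n. {x. \<exists>a b. x - inverse (real (Suc n)) < a \<and> a < x \<and> x < b \<and>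
     b < x + inverse (real (Suc n)) \<and> \<psi> b - \<psi> a < p * (b - a)})"
    by (auto simp: slope_below_iff_nat)
  ultimately show ?thesis by (auto intro!: sets.countable_INT)
qed


text \<open>Intervals of slope below \<open>p\<close> and intervals of slope above \<open>q\<close>
  shrink to every point of this set. For the Stieltjes measure \<open>M\<close> of an increasing
  modification of \<open>\<psi>\<close>, two Vitali comparisons give
  \<open>(q + c) |F| \<le> M F \<le> (p + c) |F|\<close> on bounded parts \<open>F\<close>, which
  forces \<open>|F| = 0\<close>.\<close>

lemma null_slope_gap:
  fixes \<psi> :: "real \<Rightarrow> real"
  assumes lip: "L-lipschitz_on UNIV \<psi>" and pq: "p < q"
  shows "{x. slope_below p \<psi> x \<and> slope_below (- q) (\<lambda>t. - \<psi> t) x} \<in> null_sets lborel"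
proof -
  let ?E = "{x. slope_below p \<psi> x \<and> slope_below (- q) (\<lambda>t. - \<psi> t) x}"
  have [measurable]: "?E \<in> sets borel"
    using sets.Int[OF borel_slope_below[of p \<psi>] borel_slope_below[of "-q" "\<lambda>t. - \<psi> t"]] by (simp add: Int_def)
  have L: "L \<ge> 0" using lip by (rule lipschitz_on_nonneg)
  have lipD: "\<bar>\<psi> s - \<psi> t\<bar> \<le> L * \<bar>s - t\<bar>" for s t
    using lipschitz_onD[OF lip, of s t] by (simp add: dist_real_def)
  \<comment> \<open>The linear term raises all slopes to at least 1. So \<open>\<Psi>\<close> is an
    increasing bijection with a 1-Lipschitz inverse \<open>G\<close>, and the image of Lebesgue
    measure under \<open>G\<close> gives \<open>{a<..<b}\<close> the mass
    \<open>\<Psi> b - \<Psi> a\<close>.\<close>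
  define c where "c = L + 1"
  define \<Psi> where "\<Psi> = (\<lambda>t. \<psi> t + c * t)"
  \<comment> \<open>A Lipschitz constant of \<open>\<Psi>\<close>: \<open>L\<close> from
    \<open>\<psi>\<close> plus \<open>c = L + 1\<close> from the linear term.\<close>
  define l where "l = 2 * L + 1"
  have l: "l > 0" using L by (simp add: l_def)
  have incr: "s - t \<le> \<Psi> s - \<Psi> t" if "t \<le> s" for s t
    using lipD[of s t] that unfolding \<Psi>_def c_def by (simp add: algebra_simps abs_if split: if_splits)
  have lip\<Psi>: "l-lipschitz_on UNIV \<Psi>"
  proof (rule lipschitz_onI)
    fix s t :: real
    have "\<Psi> s - \<Psi> t = (\<psi> s - \<psi> t) + c * (s - t)" by (simp add: \<Psi>_def algebra_simps)
    then have "\<bar>\<Psi> s - \<Psi> t\<bar> \<le> \<bar>\<psi> s - \<psi> t\<bar> + \<bar>c * (s - t)\<bar>" by linarith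
    also have "\<dots> \<le> L * \<bar>s - t\<bar> + c * \<bar>s - t\<bar>" using lipD[of s t] L by (simp add: abs_mult c_def)
    finally show "dist (\<Psi> s) (\<Psi> t) \<le> l * dist s t" by (simp add: dist_real_def l_def c_def algebra_simps)
  qed (use l in auto)
  have cont: "continuous_on UNIV \<Psi>" using lip\<Psi> by (rule lipschitz_on_continuous_on)
  have inj: "inj \<Psi>"
  proof (rule linorder_injI)
    fix x y :: real assume "x < y"
    then show "\<Psi> x \<noteq> \<Psi> y" using incr[of x y] by auto
  qed
  have surj: "surj \<Psi>"
  proof
    show "UNIV \<subseteq> range \<Psi>"
    proof
      fix y
      let ?b = "\<bar>y - \<Psi> 0\<bar>"
      have "\<Psi> (- ?b) \<le> y" "y \<le> \<Psi> ?b" using incr[of 0 ?b] incr[of "- ?b" 0] by auto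
      then show "y \<in> range \<Psi>"
        using IVT'[of \<Psi> "- ?b" y ?b] continuous_on_subset[OF cont] by force
    qed
  qed simp
  define G where "G = inv \<Psi>"
  have G: "G (\<Psi> x) = x" "\<Psi> (G y) = y" for x y
    using inj surj by (auto simp: G_def surj_f_inv_f)
  have "1-lipschitz_on UNIV G"
  proof (rule lipschitz_onI)
    fix x y :: real
    show "dist (G x) (G y) \<le> 1 * dist x y"
      using incr[of "G x" "G y"] incr[of "G y" "G x"] G(2)[of x] G(2)[of y] by (auto simp: dist_real_def abs_if)
  qed auto
  then have [measurable]: "G \<in> borel_measurable borel"
    by (intro borel_measurable_continuous_onI lipschitz_on_continuous_on)
  define M where "M = distr lborel borel G"
  have Mem: "emeasure M A = emeasure lborel (G -` A)" if "A \<in> sets borel" for A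
    using that unfolding M_def by (subst emeasure_distr) auto
  have Mle: "emeasure M A \<le> ennreal l * emeasure lborel A" if "A \<in> sets borel" for A
    using emeasure_vimage_lipschitz_homeo[OF lip\<Psi> l G \<open>G \<in> _\<close> that] that by (simp add: Mem)
  have mono: "\<Psi> s < \<Psi> t \<longleftrightarrow> s < t" for s t
    using incr[of s t] incr[of t s] by (cases "s < t") auto
  have vimG: "G -` {a<..<b} = {\<Psi> a<..<\<Psi> b}" for a b
  proof -
    have "a < G y \<longleftrightarrow> \<Psi> a < y" "G y < b \<longleftrightarrow> y < \<Psi> b" for y
      using mono[of a "G y"] mono[of "G y" b] G(2)[of y] by auto
    then show ?thesis by auto
  qed
  have Mbox: "emeasure M {a<..<b} = ennreal (\<Psi> b - \<Psi> a)" if "a \<le> b" for a b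
    using incr[OF that] that by (subst Mem) (auto simp: vimG)
  have ivl: "ball ((a + b)/2) ((b - a)/2) = {a<..<b}" if "a < b" for a b :: real
    by (simp add: ball_eq_greaterThanLessThan field_simps)
  \<comment> \<open>Intersecting with a ball makes the measure finite, so that it can be cancelled.
    If the set is nonempty, some slope of \<open>\<Psi>\<close> is below \<open>p + c\<close> while
    all are at least 1; hence \<open>p + c > 0\<close> and \<open>ennreal\<close> truncates
    nothing.\<close>
  have bound: "emeasure lborel (?E \<inter> ball 0 (real n)) = 0" for n
  proof (cases "?E = {}")
    case True
    then show ?thesis by (metis Int_empty_left emeasure_empty)
  next
    case False
    then obtain x a b where "a < x" "x < b" "\<psi> b - \<psi> a < p * (b - a)"
      unfolding slope_below_def using zero_less_one by blast
    then have "0 < (p + c) * (b - a)" "a < b"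
      using incr[of a b] by (auto simp: \<Psi>_def algebra_simps)
    then have p': "p + c > 0" by (simp add: zero_less_mult_iff)
    let ?F = "?E \<inter> ball 0 (real n)"
    have F [measurable]: "?F \<in> sets borel" by (intro sets.Int) auto
    have "emeasure M ?F \<le> emeasure (scale_measure (ennreal (p + c)) lborel) ?F"
    proof (rule vitali_compare[where C = "p + c"])
      fix N :: "real set" assume N: "N \<in> null_sets lborel"
      then have "emeasure M N \<le> ennreal l * emeasure lborel N" by (intro Mle) auto
      then show "emeasure M N = 0" using N by auto
    next
      fix x d :: real assume "x \<in> ?F" "0 < d"
      then obtain a b where ab: "x - d < a" "a < x" "x < b" "b < x + d" "\<psi> b - \<psi> a < p * (b - a)"
        unfolding slope_below_def by blast
      then have "emeasure M {a<..<b} = ennreal (\<Psi> b - \<Psi> a)" by (intro Mbox) auto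
      also have "\<dots> \<le> ennreal ((p + c) * (b - a))"
        using ab by (intro ennreal_leI) (simp add: \<Psi>_def algebra_simps)
      finally have "emeasure M {a<..<b} \<le> emeasure (scale_measure (ennreal (p + c)) lborel) {a<..<b}"
        using ab p' by (simp add: ennreal_mult)
      then show "\<exists>a r. x \<in> ball a r \<and> r < d \<and> emeasure M (ball a r) \<le> emeasure (scale_measure (ennreal (p + c)) lborel) (ball a r)"
        using ab ivl[of a b] by (intro exI[of _ "(a + b)/2"] exI[of _ "(b - a)/2"]) auto
    qed (auto simp: M_def)
    moreover have "emeasure (scale_measure (ennreal (q + c)) lborel) ?F \<le> emeasure M ?F"
    proof (rule vitali_compare[where C = l])
      fix x d :: real assume "x \<in> ?F" "0 < d"
      then obtain a b where ab: "x - d < a" "a < x" "x < b" "b < x + d" "- \<psi> b - - \<psi> a < - q * (b - a)"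
        unfolding slope_below_def by blast
      have "emeasure (scale_measure (ennreal (q + c)) lborel) {a<..<b} = ennreal ((q + c) * (b - a))"
        using ab p' pq by (simp add: ennreal_mult)
      also have "\<dots> \<le> ennreal (\<Psi> b - \<Psi> a)"
        using ab by (intro ennreal_leI) (simp add: \<Psi>_def algebra_simps)
      also have "\<dots> = emeasure M {a<..<b}" using ab by (intro Mbox[symmetric]) auto
      finally show "\<exists>a r. x \<in> ball a r \<and> r < d \<and> emeasure (scale_measure (ennreal (q + c)) lborel) (ball a r) \<le> emeasure M (ball a r)"
        using ab ivl[of a b] by (intro exI[of _ "(a + b)/2"] exI[of _ "(b - a)/2"]) auto
    qed (auto simp: M_def[symmetric] Mle, auto simp: M_def)
    ultimately have *: "ennreal (q + c) * emeasure lborel ?F \<le> ennreal (p + c) * emeasure lborel ?F"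
      by simp
    have "bounded ?F" by (rule bounded_subset[OF bounded_ball]) auto
    then have "emeasure lborel ?F < \<infinity>" by (rule emeasure_bounded_finite)
    then obtain m where m: "emeasure lborel ?F = ennreal m" "m \<ge> 0"
      by (metis ennreal_cases infinity_ennreal_def less_irrefl)
    then have "(q + c) * m \<le> (p + c) * m"
      using * p' pq by (simp add: ennreal_mult[symmetric])
    then have "(q - p) * m \<le> 0" by (simp add: algebra_simps)
    then have "m = 0" using pq m(2) by (simp add: mult_le_0_iff)
    then show ?thesis using m by simp
  qed
  have "(\<Union>n. ?E \<inter> ball 0 (real n)) \<in> null_sets lborel"
    using bound by (intro null_sets_UN) (auto simp: null_sets_def)
  moreover have "(\<Union>n. ?E \<inter> ball 0 (real n)) = ?E"
    using reals_Archimedean2 by (auto simp: dist_real_def)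
  ultimately show ?thesis by simp
qed

text \<open>\<open>slope_below\<close> tests intervals with \<open>x\<close> strictly inside;
  letting one endpoint tend to \<open>x\<close> turns its negation into a bound for the difference
  quotients at \<open>x\<close>.\<close>

lemma not_slope_below_imp:
  assumes "\<not> slope_below p \<psi> x" and cont: "continuous_on UNIV \<psi>"
  shows "\<exists>d>0. \<forall>y. y \<noteq> x \<and> \<bar>y - x\<bar> < d \<longrightarrow> p \<le> (\<psi> y - \<psi> x) / (y - x)"
proof -
  obtain d where d: "d > 0"
      "\<And>a b. \<lbrakk>x - d < a; a < x; x < b; b < x + d\<rbrakk> \<Longrightarrow> p * (b - a) \<le> \<psi> b - \<psi> a"
    using assms(1) unfolding slope_below_def by (meson not_less)
  have lim: "(\<psi> \<longlongrightarrow> \<psi> x) (at x within S)" for S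
    using cont by (meson continuous_on_def UNIV_I subset_UNIV tendsto_within_subset)
  have "p \<le> (\<psi> y - \<psi> x) / (y - x)" if y: "y \<noteq> x" "\<bar>y - x\<bar> < d" for y
  proof (cases "x < y")
    case True
    have "0 \<le> \<psi> y - \<psi> x - p * (y - x)"
    proof (rule tendsto_lowerbound)
      show "((\<lambda>a. \<psi> y - \<psi> a - p * (y - a)) \<longlongrightarrow> \<psi> y - \<psi> x - p * (y - x)) (at_left x)"
        by (intro tendsto_intros lim)
      show "\<forall>\<^sub>F a in at_left x. 0 \<le> \<psi> y - \<psi> a - p * (y - a)"
        unfolding eventually_at_left_field using d(2)[of _ y] y d(1) True
        by (intro exI[of _ "x - d"]) auto
    qed simp
    then show ?thesis using True by (simp add: field_simps)
  next
    case False
    then have "y < x" using y by simp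
    have "0 \<le> \<psi> x - \<psi> y - p * (x - y)"
    proof (rule tendsto_lowerbound)
      show "((\<lambda>b. \<psi> b - \<psi> y - p * (b - y)) \<longlongrightarrow> \<psi> x - \<psi> y - p * (x - y)) (at_right x)"
        by (intro tendsto_intros lim)
      show "\<forall>\<^sub>F b in at_right x. 0 \<le> \<psi> b - \<psi> y - p * (b - y)"
        unfolding eventually_at_right_field using d(2)[of y] y d(1) \<open>y < x\<close>
        by (intro exI[of _ "x + d"]) auto
    qed simp
    then show ?thesis using \<open>y < x\<close> by (simp add: divide_simps algebra_simps)
  qed
  then show ?thesis using d(1) by blast
qed

text \<open>The derivative is the infimum \<open>c\<close> of all \<open>p\<close> with
  \<open>slope_below p \<psi> x\<close>. For \<open>p\<close> below \<open>c\<close> the quotients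
  are eventually at least \<open>p\<close>; for rational \<open>q\<close> above \<open>c\<close> the
  absence of a gap makes them eventually at most \<open>q\<close>.\<close>

lemma differentiable_or_slope_gap:
  fixes \<psi> :: "real \<Rightarrow> real"
  assumes lip: "L-lipschitz_on UNIV \<psi>"
  shows "(\<exists>D. (\<psi> has_real_derivative D) (at x)) \<or>
    (\<exists>p\<in>\<rat>. \<exists>q\<in>\<rat>. p < q \<and> slope_below p \<psi> x \<and> slope_below (- q) (\<lambda>t. - \<psi> t) x)"
proof (rule disjCI)
  assume nogap: "\<not> (\<exists>p\<in>\<rat>. \<exists>q\<in>\<rat>. p < q \<and> slope_below p \<psi> x \<and> slope_below (- q) (\<lambda>t. - \<psi> t) x)"
  have cont: "continuous_on UNIV \<psi>" "continuous_on UNIV (\<lambda>t. - \<psi> t)"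
    using lipschitz_on_continuous_on[OF lip] by (auto intro: continuous_intros)
  have lipD: "\<bar>\<psi> s - \<psi> t\<bar> \<le> L * \<bar>s - t\<bar>" for s t
    using lipschitz_onD[OF lip, of s t] by (simp add: dist_real_def)
  define A where "A = {p. slope_below p \<psi> x}"
  \<comment> \<open>All slopes lie between \<open>- L\<close> and \<open>L\<close>, so
    \<open>A\<close> contains \<open>L + 1\<close> and is bounded below by \<open>- L\<close>; its
    infimum is a genuine real number.\<close>
  have "L + 1 \<in> A"
    unfolding A_def slope_below_def
  proof safe
    fix d :: real assume "d > 0"
    moreover have "\<psi> (x + d/2) - \<psi> (x - d/2) < (L + 1) * ((x + d/2) - (x - d/2))"
      using lipD[of "x + d/2" "x - d/2"] \<open>d > 0\<close> by (simp add: algebra_simps abs_if split: if_splits)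
    ultimately show "\<exists>a b. x - d < a \<and> a < x \<and> x < b \<and> b < x + d \<and> \<psi> b - \<psi> a < (L + 1) * (b - a)"
      by (intro exI[of _ "x - d/2"] exI[of _ "x + d/2"]) auto
  qed
  have low: "- L \<le> p" if "p \<in> A" for p
  proof -
    note pA = that
    obtain a b where "a < x" "x < b" "\<psi> b - \<psi> a < p * (b - a)"
      using pA[unfolded A_def mem_Collect_eq slope_below_def, rule_format, OF zero_less_one] by blast
    then have "0 < (p + L) * (b - a)" "a < b"
      using lipD[of b a] by (auto simp: algebra_simps abs_if split: if_splits)
    then show ?thesis by (simp add: zero_less_mult_iff)
  qed
  have bdd: "bdd_below A" using low by (meson bdd_belowI)
  have up: "p' \<in> A" if "p \<in> A" "p \<le> p'" for p p'
    unfolding A_def slope_below_def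
  proof safe
    fix d :: real assume "d > 0"
    then obtain a b where ab: "x - d < a \<and> a < x \<and> x < b \<and> b < x + d \<and> \<psi> b - \<psi> a < p * (b - a)"
      using \<open>p \<in> A\<close> unfolding A_def slope_below_def by blast
    have "p * (b - a) \<le> p' * (b - a)" using ab \<open>p \<le> p'\<close> by (intro mult_right_mono) linarith+
    then have "\<psi> b - \<psi> a < p' * (b - a)" using ab by linarith
    then show "\<exists>a b. x - d < a \<and> a < x \<and> x < b \<and> b < x + d \<and> \<psi> b - \<psi> a < p' * (b - a)"
      using ab by blast
  qed
  define c where "c = Inf A"
  have "((\<lambda>y. (\<psi> y - \<psi> x) / (y - x)) \<longlongrightarrow> c) (at x)"
  proof (rule LIM_I)
    fix e :: real assume "e > 0"
    obtain p1 where p1: "c - e < p1" "p1 < c" using dense[of "c - e" c] \<open>e > 0\<close> by auto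
    then have "\<not> slope_below p1 \<psi> x"
      using cInf_lower[OF _ bdd, of p1] unfolding c_def A_def by force
    from not_slope_below_imp[OF this cont(1)] obtain d1 where d1: "d1 > 0"
        "\<And>y. y \<noteq> x \<Longrightarrow> \<bar>y - x\<bar> < d1 \<Longrightarrow> p1 \<le> (\<psi> y - \<psi> x) / (y - x)" by auto
    \<comment> \<open>Two rationals above \<open>c\<close> are required: \<open>p2\<close> belongs
      to the upward closed set \<open>A\<close>, and since there is no gap between \<open>p2\<close>
      and \<open>q\<close>, slopes above \<open>q\<close> are excluded at small scales.\<close>
    obtain p2 where p2: "p2 \<in> \<rat>" "c < p2" "p2 < c + e" using Rats_dense_in_real[of c "c + e"] \<open>e > 0\<close> by auto
    obtain q where q: "q \<in> \<rat>" "p2 < q" "q < c + e" using Rats_dense_in_real[OF p2(3)] by auto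
    obtain p3 where "p3 \<in> A" "p3 < p2"
      using cInf_lessD[of A p2] p2(2) \<open>L + 1 \<in> A\<close> unfolding c_def by auto
    then have "slope_below p2 \<psi> x" using up[of p3 p2] by (auto simp: A_def)
    then have "\<not> slope_below (- q) (\<lambda>t. - \<psi> t) x" using nogap p2 q by blast
    from not_slope_below_imp[OF this cont(2)] obtain d2 where d2: "d2 > 0"
        "\<And>y. y \<noteq> x \<Longrightarrow> \<bar>y - x\<bar> < d2 \<Longrightarrow> - q \<le> (- \<psi> y - - \<psi> x) / (y - x)" by auto
    have "norm ((\<psi> y - \<psi> x) / (y - x) - c) < e" if "y \<noteq> x" "norm (y - x) < min d1 d2" for y
    proof -
      have "(- \<psi> y - - \<psi> x) / (y - x) = - ((\<psi> y - \<psi> x) / (y - x))"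
        by (metis minus_diff_minus minus_divide_left)
      then show ?thesis using d1(2)[of y] d2(2)[of y] that p1 q by (auto simp: abs_less_iff)
    qed
    then show "\<exists>s>0. \<forall>y. y \<noteq> x \<and> norm (y - x) < s \<longrightarrow> norm ((\<psi> y - \<psi> x) / (y - x) - c) < e"
      using d1(1) d2(1) by (intro exI[of _ "min d1 d2"]) auto
  qed
  then show "\<exists>D. (\<psi> has_real_derivative D) (at x)"
    by (auto simp: has_field_derivative_iff)
qed

section \<open>From one variable to directional derivatives in space\<close>

lemma slope_below_shift: "slope_below p (\<lambda>s. \<psi> (t + s)) 0 \<longleftrightarrow> slope_below p \<psi> t"
proof
  assume *: "slope_below p (\<lambda>s. \<psi> (t + s)) 0"
  show "slope_below p \<psi> t" unfolding slope_below_def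
  proof safe
    fix d :: real assume "d > 0"
    then obtain a b where "0 - d < a \<and> a < 0 \<and> 0 < b \<and> b < 0 + d \<and> \<psi> (t + b) - \<psi> (t + a) < p * (b - a)"
      using * unfolding slope_below_def by blast
    then show "\<exists>a b. t - d < a \<and> a < t \<and> t < b \<and> b < t + d \<and> \<psi> b - \<psi> a < p * (b - a)"
      by (intro exI[of _ "t + a"] exI[of _ "t + b"]) auto
  qed
next
  assume *: "slope_below p \<psi> t"
  show "slope_below p (\<lambda>s. \<psi> (t + s)) 0" unfolding slope_below_def
  proof safe
    fix d :: real assume "d > 0"
    then obtain a b where "t - d < a \<and> a < t \<and> t < b \<and> b < t + d \<and> \<psi> b - \<psi> a < p * (b - a)"
      using * unfolding slope_below_def by blast
    then show "\<exists>a b. 0 - d < a \<and> a < 0 \<and> 0 < b \<and> b < 0 + d \<and> \<psi> (t + b) - \<psi> (t + a) < p * (b - a)"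
      by (intro exI[of _ "a - t"] exI[of _ "b - t"]) auto
  qed
qed

lemma borel_slope_below_line:
  fixes Z :: "'a::euclidean_space \<Rightarrow> real"
  assumes cont: "continuous_on UNIV Z"
  shows "{x. slope_below p (\<lambda>t. Z (x + t *\<^sub>R v)) 0} \<in> sets borel"
proof -
  have op: "open {x. \<exists>a b. 0 - e < a \<and> a < 0 \<and> 0 < b \<and> b < 0 + e \<and> Z (x + b *\<^sub>R v) - Z (x + a *\<^sub>R v) < p * (b - a)}" for e :: real
  proof -
    have "open {x. Z (x + b *\<^sub>R v) - Z (x + a *\<^sub>R v) < p * (b - a)}" for a b
      by (intro open_Collect_less continuous_intros continuous_on_compose2[OF cont]) auto
    then have "open (\<Union>(a, b)\<in>{(a, b). 0 - e < a \<and> a < 0 \<and> 0 < b \<and> b < 0 + e}.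
        {x. Z (x + b *\<^sub>R v) - Z (x + a *\<^sub>R v) < p * (b - a)})"
      by auto
    moreover have "(\<Union>(a, b)\<in>{(a, b). 0 - e < a \<and> a < 0 \<and> 0 < b \<and> b < 0 + e}.
        {x. Z (x + b *\<^sub>R v) - Z (x + a *\<^sub>R v) < p * (b - a)}) =
        {x. \<exists>a b. 0 - e < a \<and> a < 0 \<and> 0 < b \<and> b < 0 + e \<and> Z (x + b *\<^sub>R v) - Z (x + a *\<^sub>R v) < p * (b - a)}"
      by auto
    ultimately show ?thesis by simp
  qed
  have "{x. slope_below p (\<lambda>t. Z (x + t *\<^sub>R v)) 0} =
    (\<Inter>n. {x. \<exists>a b. 0 - inverse (real (Suc n)) < a \<and> a < 0 \<and> 0 < b \<and>
      b < 0 + inverse (real (Suc n)) \<and> Z (x + b *\<^sub>R v) - Z (x + a *\<^sub>R v) < p * (b - a)})"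
    unfolding slope_below_iff_nat by auto
  then show ?thesis using op by (auto intro!: sets.countable_INT)
qed

lemma nn_integral_lborel_translate:
  fixes g :: "'a::euclidean_space \<Rightarrow> ennreal"
  assumes [measurable]: "g \<in> borel_measurable borel"
  shows "(\<integral>\<^sup>+x. g (x + c) \<partial>lborel) = (\<integral>\<^sup>+x. g x \<partial>lborel)"
proof -
  have "(\<integral>\<^sup>+x. g x \<partial>lborel) = (\<integral>\<^sup>+x. g x \<partial>distr lborel borel ((+) c))"
    by (simp only: lborel_distr_plus)
  also have "\<dots> = (\<integral>\<^sup>+x. g (x + c) \<partial>lborel)"
    by (subst nn_integral_distr) (auto simp: add.commute)
  finally show ?thesis by simp
qed

text \<open>Translation invariance replaces Fubini's theorem along the lines of direction \<open>v\<close>.\<close>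

lemma null_set_if_null_on_lines:
  fixes N :: "'a::euclidean_space set"
  assumes [measurable]: "N \<in> sets borel"
    and line: "\<And>x. {t::real. x + t *\<^sub>R v \<in> N} \<in> null_sets lborel"
  shows "N \<in> null_sets lborel"
proof -
  have "emeasure lborel N = (\<integral>\<^sup>+t. indicator {0..1::real} t * emeasure lborel N \<partial>lborel)"
    by (subst nn_integral_multc) auto
  also have "\<dots> = (\<integral>\<^sup>+t. indicator {0..1::real} t * (\<integral>\<^sup>+x. indicator N (x + t *\<^sub>R v) \<partial>lborel) \<partial>lborel)"
    by (subst nn_integral_lborel_translate) auto
  also have "\<dots> = (\<integral>\<^sup>+t. (\<integral>\<^sup>+x. indicator {0..1::real} t * indicator N (x + t *\<^sub>R v) \<partial>lborel) \<partial>lborel)"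
    by (subst nn_integral_cmult) auto
  also have "\<dots> = (\<integral>\<^sup>+x. (\<integral>\<^sup>+t. indicator {0..1::real} t * indicator N (x + t *\<^sub>R v) \<partial>lborel) \<partial>lborel)"
    by (rule lborel_pair.Fubini') measurable
  also have "\<dots> = (\<integral>\<^sup>+x. 0 \<partial>(lborel :: 'a measure))"
  proof (rule nn_integral_cong)
    fix x :: 'a
    have "AE t in lborel. t \<notin> {t::real. x + t *\<^sub>R v \<in> N}" using line by (rule AE_not_in)
    then show "(\<integral>\<^sup>+t. indicator {0..1::real} t * indicator N (x + t *\<^sub>R v) \<partial>lborel) = 0"
      by (subst nn_integral_0_iff_AE) (auto elim!: eventually_mono split: split_indicator)
  qed
  finally show ?thesis by (auto simp: null_sets_def)
qed

lemma lipschitz_along_line: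
  fixes Z :: "'a::real_normed_vector \<Rightarrow> real"
  assumes "L-lipschitz_on UNIV Z"
  shows "(L * norm v)-lipschitz_on UNIV (\<lambda>t. Z (x + t *\<^sub>R v))"
proof (rule lipschitz_onI)
  fix s t :: real
  have "dist (Z (x + s *\<^sub>R v)) (Z (x + t *\<^sub>R v)) \<le> L * dist (x + s *\<^sub>R v) (x + t *\<^sub>R v)"
    by (rule lipschitz_onD[OF assms]) auto
  also have "dist (x + s *\<^sub>R v) (x + t *\<^sub>R v) = norm v * dist s t"
    by (simp add: dist_norm dist_real_def scaleR_left_diff_distrib[symmetric])
  finally show "dist (Z (x + s *\<^sub>R v)) (Z (x + t *\<^sub>R v)) \<le> L * norm v * dist s t" by (simp add: mult_ac)
qed (use lipschitz_on_nonneg[OF assms] in auto)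

text \<open>The bad points lie in the countable union of the \<open>B p q\<close> over rational
  \<open>p < q\<close>. Each \<open>B p q\<close> meets every line of direction \<open>v\<close> in
  a null set, by the one-variable result, and is therefore null.\<close>

lemma AE_lipschitz_directional_derivative:
  fixes Z :: "'a::euclidean_space \<Rightarrow> real"
  assumes lip: "L-lipschitz_on UNIV Z"
  shows "AE x in lborel. \<exists>D. ((\<lambda>t. Z (x + t *\<^sub>R v)) has_real_derivative D) (at 0)"
proof -
  define B where "B = (\<lambda>p q. {x. slope_below p (\<lambda>t. Z (x + t *\<^sub>R v)) 0 \<and>
      slope_below (- q) (\<lambda>t. - Z (x + t *\<^sub>R v)) 0})"
  have contZ: "continuous_on UNIV Z" using lip by (rule lipschitz_on_continuous_on)
  have contmZ: "continuous_on UNIV (\<lambda>x. - Z x)" using contZ by (intro continuous_intros)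
  have B_null: "B p q \<in> null_sets lborel" if "p < q" for p q
  proof (rule null_set_if_null_on_lines[where v = v])
    show "B p q \<in> sets borel" unfolding B_def
      using sets.Int[OF borel_slope_below_line[OF contZ, of p v] borel_slope_below_line[OF contmZ, of "-q" v]]
      by (simp add: Int_def)
    fix x
    have "{t. x + t *\<^sub>R v \<in> B p q} = {t. slope_below p (\<lambda>t. Z (x + t *\<^sub>R v)) t \<and>
        slope_below (- q) (\<lambda>t. - Z (x + t *\<^sub>R v)) t}"
      using slope_below_shift[of p "\<lambda>t. Z (x + t *\<^sub>R v)"] slope_below_shift[of "-q" "\<lambda>t. - Z (x + t *\<^sub>R v)"]
      unfolding B_def by (simp add: scaleR_add_left add.assoc)
    also have "\<dots> \<in> null_sets lborel"
      by (rule null_slope_gap[OF lipschitz_along_line[OF lip] that])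
    finally show "{t. x + t *\<^sub>R v \<in> B p q} \<in> null_sets lborel" .
  qed
  have "(\<Union>(p, q)\<in>{(p, q). p \<in> \<rat> \<and> q \<in> \<rat> \<and> p < q}. B p q) \<in> null_sets lborel"
  proof (rule null_sets_UN')
    show "countable {(p, q). p \<in> \<rat> \<and> q \<in> \<rat> \<and> p < (q::real)}"
      by (rule countable_subset[of _ "\<rat> \<times> \<rat>"]) (auto intro: countable_rat)
  qed (use B_null in auto)
  then have "AE x in lborel. x \<notin> (\<Union>(p, q)\<in>{(p, q). p \<in> \<rat> \<and> q \<in> \<rat> \<and> p < q}. B p q)"
    by (rule AE_not_in)
  then show ?thesis
  proof (rule eventually_mono)
    fix x assume "x \<notin> (\<Union>(p, q)\<in>{(p, q). p \<in> \<rat> \<and> q \<in> \<rat> \<and> p < q}. B p q)"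
    then show "\<exists>D. ((\<lambda>t. Z (x + t *\<^sub>R v)) has_real_derivative D) (at 0)"
      using differentiable_or_slope_gap[OF lipschitz_along_line[OF lip], of x v 0] unfolding B_def by blast
  qed
qed

lemma difference_quotient_tendsto:
  fixes g :: "real \<Rightarrow> real"
  assumes "(g has_real_derivative D) (at 0)"
  shows "(\<lambda>m. real (Suc m) * (g (1 / real (Suc m)) - g 0)) \<longlonglongrightarrow> D"
proof -
  have "((\<lambda>h. (g (0 + h) - g 0) / h) \<longlongrightarrow> D) (at 0)" using assms by (simp add: DERIV_def)
  then have "(\<lambda>m. (g (0 + 1 / real (Suc m)) - g 0) / (1 / real (Suc m))) \<longlonglongrightarrow> D"
    by (rule filterlim_compose)
       (use LIMSEQ_Suc[OF lim_1_over_n, where ?'a1 = real] in \<open>auto simp: filterlim_at simp del: of_nat_Suc\<close>)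
  then show ?thesis by (simp add: mult.commute)
qed

text \<open>The integrals to come require an everywhere defined Borel function with an everywhere
  valid bound, which represents the derivative almost everywhere.\<close>

lemma lipschitz_directional_derivative:
  fixes Z :: "'a::euclidean_space \<Rightarrow> real"
  assumes lip: "L-lipschitz_on UNIV Z"
  obtains D where "D \<in> borel_measurable borel" "\<And>x. \<bar>D x\<bar> \<le> L * norm v"
    "AE x in lborel. ((\<lambda>t. Z (x + t *\<^sub>R v)) has_real_derivative D x) (at 0)"
proof -
  define Q where "Q = (\<lambda>m x. real (Suc m) * (Z (x + (1 / real (Suc m)) *\<^sub>R v) - Z x))"
  \<comment> \<open>\<open>lim\<close> is arbitrary where the quotients diverge; clipping bounds the
    value there and changes nothing where the derivative exists.\<close>
  define D where "D = (\<lambda>x. max (- (L * norm v)) (min (L * norm v) (lim (\<lambda>m. Q m x))))"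
  have L: "L \<ge> 0" using lip by (rule lipschitz_on_nonneg)
  have contZ: "continuous_on UNIV Z" using lip by (rule lipschitz_on_continuous_on)
  have [measurable]: "Z \<in> borel_measurable borel" using contZ by (rule borel_measurable_continuous_onI)
  have [measurable]: "Q m \<in> borel_measurable borel" for m unfolding Q_def by measurable
  have "D \<in> borel_measurable borel" unfolding D_def by measurable
  moreover have "\<bar>D x\<bar> \<le> L * norm v" for x
    using mult_nonneg_nonneg[OF L norm_ge_zero[of v]] unfolding D_def by (auto simp: abs_le_iff)
  moreover have "AE x in lborel. ((\<lambda>t. Z (x + t *\<^sub>R v)) has_real_derivative D x) (at 0)"
    using AE_lipschitz_directional_derivative[OF lip, of v]
  proof (rule eventually_mono)
    fix x assume "\<exists>D. ((\<lambda>t. Z (x + t *\<^sub>R v)) has_real_derivative D) (at 0)"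
    then obtain d where d: "((\<lambda>t. Z (x + t *\<^sub>R v)) has_real_derivative d) (at 0)" by blast
    have lim: "(\<lambda>m. Q m x) \<longlonglongrightarrow> d" using difference_quotient_tendsto[OF d] by (simp add: Q_def)
    have "\<bar>Q m x\<bar> \<le> L * norm v" for m
    proof -
      have "\<bar>Z (x + (1 / real (Suc m)) *\<^sub>R v) - Z x\<bar> \<le> L * norm ((1 / real (Suc m)) *\<^sub>R v)"
        using lipschitz_on_normD[OF lip, of "x + (1 / real (Suc m)) *\<^sub>R v" x] by simp
      then show ?thesis unfolding Q_def by (simp add: abs_mult pos_le_divide_eq mult.commute del: of_nat_Suc)
    qed
    then have "\<bar>d\<bar> \<le> L * norm v"
      using tendsto_upperbound[OF tendsto_rabs[OF lim]] by auto
    then have "D x = d" using limI[OF lim] by (auto simp: D_def)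
    then show "((\<lambda>t. Z (x + t *\<^sub>R v)) has_real_derivative D x) (at 0)" using d by simp
  qed
  ultimately show ?thesis using that by blast
qed

text \<open>Every difference quotient of \<open>G\<close> integrates to 0 by translation invariance,
  and the Lipschitz bound dominates the passage to the limit.\<close>

lemma integral_directional_derivative_eq_0:
  fixes G :: "'a::euclidean_space \<Rightarrow> real"
  assumes lip: "L-lipschitz_on UNIV G" and supp: "\<And>x. norm x > R \<Longrightarrow> G x = 0"
    and [measurable]: "D \<in> borel_measurable borel"
    and D: "AE x in lborel. ((\<lambda>t. G (x + t *\<^sub>R v)) has_real_derivative D x) (at 0)"
  shows "integral\<^sup>L lborel D = 0"
proof -
  define Q where "Q = (\<lambda>m x. real (Suc m) * (G (x + (1 / real (Suc m)) *\<^sub>R v) - G x))"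
  have L: "L \<ge> 0" using lip by (rule lipschitz_on_nonneg)
  have contG: "continuous_on UNIV G" using lip by (rule lipschitz_on_continuous_on)
  have [measurable]: "G \<in> borel_measurable borel" using contG by (rule borel_measurable_continuous_onI)
  have [measurable]: "Q m \<in> borel_measurable borel" for m unfolding Q_def by measurable
  have intG: "integrable lborel G"
  proof -
    have "integrable lborel (\<lambda>x. indicator (cball 0 R) x *\<^sub>R G x)"
      using borel_integrable_compact[of "cball (0::'a) R" G] continuous_on_subset[OF contG] by auto
    moreover have "(\<lambda>x. indicator (cball 0 R) x *\<^sub>R G x) = G"
      using supp by (force simp: indicator_def fun_eq_iff)
    ultimately show ?thesis by simp
  qed
  have transl: "integrable lborel (\<lambda>x. G (x + c)) \<and> (\<integral>x. G (x + c) \<partial>lborel) = integral\<^sup>L lborel G" for c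
  proof -
    have "integrable (distr lborel borel ((+) c)) G" using intG by (simp only: lborel_distr_plus)
    then have 1: "integrable lborel (\<lambda>x. G (c + x))" by (subst (asm) integrable_distr_eq) auto
    have "integral\<^sup>L lborel G = integral\<^sup>L (distr lborel borel ((+) c)) G" by (simp only: lborel_distr_plus)
    also have "\<dots> = (\<integral>x. G (c + x) \<partial>lborel)" by (subst integral_distr) auto
    finally show ?thesis using 1 by (simp add: add.commute)
  qed
  have Q0: "integral\<^sup>L lborel (Q m) = 0" for m
    using transl intG unfolding Q_def by simp
  have "(\<lambda>m. integral\<^sup>L lborel (Q m)) \<longlonglongrightarrow> integral\<^sup>L lborel D"
  proof (rule integral_dominated_convergence)
    \<comment> \<open>The increments have length at most \<open>norm v\<close>, so all quotients
      vanish outside the ball of radius \<open>R + norm v\<close>.\<close>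
    let ?w = "\<lambda>x. L * norm v * indicator (cball 0 (R + norm v)) x"
    show "integrable lborel ?w"
      by (intro integrable_mult_right integrable_real_indicator) (use emeasure_bounded_finite[OF bounded_cball] in \<open>auto simp: less_top[symmetric]\<close>)
    show "AE x in lborel. (\<lambda>m. Q m x) \<longlonglongrightarrow> D x"
      using D
    proof (rule eventually_mono)
      fix x assume "((\<lambda>t. G (x + t *\<^sub>R v)) has_real_derivative D x) (at 0)"
      from difference_quotient_tendsto[OF this] show "(\<lambda>m. Q m x) \<longlonglongrightarrow> D x" by (simp add: Q_def)
    qed
    show "AE x in lborel. norm (Q m x) \<le> ?w x" for m
    proof (rule AE_I2)
      fix x
      show "norm (Q m x) \<le> ?w x"
      proof (cases "x \<in> cball 0 (R + norm v)")
        case True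
        have "\<bar>G (x + (1 / real (Suc m)) *\<^sub>R v) - G x\<bar> \<le> L * norm ((1 / real (Suc m)) *\<^sub>R v)"
          using lipschitz_on_normD[OF lip, of "x + (1 / real (Suc m)) *\<^sub>R v" x] by simp
        then show ?thesis unfolding Q_def using True
          by (simp add: abs_mult pos_le_divide_eq mult.commute del: of_nat_Suc)
      next
        case False
        then have n: "norm x > R + norm v" by simp
        have "norm ((1 / real (Suc m)) *\<^sub>R v) \<le> norm v" by (simp add: divide_le_eq mult_le_cancel_left1)
        moreover have "norm x \<le> norm (x + (1 / real (Suc m)) *\<^sub>R v) + norm ((1 / real (Suc m)) *\<^sub>R v)"
          using norm_triangle_ineq4[of "x + (1 / real (Suc m)) *\<^sub>R v" "(1 / real (Suc m)) *\<^sub>R v"] by simp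
        ultimately have "norm (x + (1 / real (Suc m)) *\<^sub>R v) > R" using n by linarith
        moreover have "norm x > R" using n norm_ge_zero[of v] by linarith
        ultimately have "G (x + (1 / real (Suc m)) *\<^sub>R v) = 0" "G x = 0" by (auto intro: supp)
        then show ?thesis using False by (simp add: Q_def)
      qed
    qed
  qed auto
  then show ?thesis by (simp add: Q0 LIMSEQ_const_iff)
qed

section \<open>Test functions\<close>

lemma compact_closed_subset: "compact K \<Longrightarrow> closed S \<Longrightarrow> S \<subseteq> K \<Longrightarrow> compact S"
  using compact_Int_closed[of K S] by (simp add: Int_absorb1)

lemma has_real_derivative_partial_deriv:
  fixes u :: "real^'n \<Rightarrow> real"
  assumes "u differentiable (at x)"
  shows "((\<lambda>t. u (x + t *\<^sub>R axis i 1)) has_real_derivative partial_deriv i u x) (at 0)"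
    and "(u has_derivative (\<lambda>h. \<Sum>j\<in>UNIV. h $ j * partial_deriv j u x)) (at x)"
proof -
  obtain u' where u': "(u has_derivative u') (at x)" using assms by (auto simp: differentiable_def)
  have lin: "linear u'" using u' by (simp add: has_derivative_linear)
  have D: "((\<lambda>t. u (x + t *\<^sub>R axis j 1)) has_real_derivative u' (axis j 1)) (at 0)" for j
  proof -
    have "((\<lambda>t. x + t *\<^sub>R axis j 1) has_derivative (\<lambda>h. h *\<^sub>R axis j 1)) (at (0::real))"
      by (auto intro!: derivative_eq_intros)
    then have "((\<lambda>t. u (x + t *\<^sub>R axis j 1)) has_derivative (\<lambda>h. u' (h *\<^sub>R axis j 1))) (at (0::real))"
      by (rule has_derivative_compose) (use u' in simp)
    then show ?thesis
      by (simp add: has_field_derivative_def linear_scale[OF lin] mult.commute[of _ "u' (axis j 1)"])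
  qed
  then have pd: "partial_deriv j u x = u' (axis j 1)" for j
    unfolding partial_deriv_def by (intro DERIV_imp_deriv)
  show "((\<lambda>t. u (x + t *\<^sub>R axis i 1)) has_real_derivative partial_deriv i u x) (at 0)"
    using D pd by simp
  have "u' = (\<lambda>h. \<Sum>j\<in>UNIV. h $ j * partial_deriv j u x)"
  proof
    fix h :: "real^'n"
    have "u' h = u' (\<Sum>j\<in>UNIV. h $ j *\<^sub>R axis j 1)"
      using basis_expansion[of h] by (simp add: scalar_mult_eq_scaleR)
    then show "u' h = (\<Sum>j\<in>UNIV. h $ j * partial_deriv j u x)"
      by (simp add: linear_sum[OF lin] linear_scale[OF lin] pd)
  qed
  then show "(u has_derivative (\<lambda>h. \<Sum>j\<in>UNIV. h $ j * partial_deriv j u x)) (at x)" using u' by simp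
qed

lemma test_functionsD:
  assumes "u \<in> test_functions \<Omega>"
  shows test_functions_differentiable: "u differentiable (at x)"
    and test_functions_continuous: "continuous_on S u"
    and test_functions_continuous_partial: "continuous_on S (partial_deriv i u)"
    and test_functions_compact: "compact (closure {x. u x \<noteq> 0})"
    and test_functions_subset: "closure {x. u x \<noteq> 0} \<subseteq> \<Omega>"
proof -
  have *: "iterated_partial is u differentiable (at x)" for "is" x
    using assms by (simp add: test_functions_def)
  show d: "u differentiable (at x)" for x using *[of "[]"] by simp
  show "continuous_on S u"
    by (meson d continuous_at_imp_continuous_on differentiable_imp_continuous_within)
  have "partial_deriv i u differentiable (at x)" for x using *[of "[i]"] by simp
  then show "continuous_on S (partial_deriv i u)"
    by (meson continuous_at_imp_continuous_on differentiable_imp_continuous_within)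
qed (use assms in \<open>auto simp: test_functions_def\<close>)

lemma test_functions_mono: "\<Omega> \<subseteq> \<Omega>' \<Longrightarrow> test_functions \<Omega> \<subseteq> test_functions \<Omega>'"
  by (auto simp: test_functions_def)

lemma test_functions_eq_0: "u x = 0" if "x \<notin> closure {x. u x \<noteq> 0}"
  using that subsetD[OF closure_subset, of x "{x. u x \<noteq> 0}"] by auto

lemma partial_deriv_eq_0_outside_support:
  assumes "x \<notin> closure {x. u x \<noteq> 0}"
  shows "partial_deriv i u x = 0"
proof -
  have "open (- closure {x. u x \<noteq> 0})" by auto
  moreover have "((\<lambda>t::real. x + t *\<^sub>R axis i 1) \<longlongrightarrow> x + 0 *\<^sub>R axis i 1) (nhds 0)"
    by (intro tendsto_intros filterlim_ident)
  ultimately have "\<forall>\<^sub>F t in nhds 0. x + t *\<^sub>R axis i 1 \<in> - closure {x. u x \<noteq> 0}"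
    using assms by (intro topological_tendstoD) auto
  then have "\<forall>\<^sub>F t in nhds 0. u (x + t *\<^sub>R axis i 1) = (\<lambda>_. 0) t"
    by (rule eventually_mono) (auto intro: test_functions_eq_0)
  then have "((\<lambda>t. u (x + t *\<^sub>R axis i 1)) has_real_derivative 0) (at 0) \<longleftrightarrow>
      ((\<lambda>_. 0) has_real_derivative 0) (at (0::real))"
    by (intro DERIV_cong_ev) auto
  then show ?thesis unfolding partial_deriv_def by (intro DERIV_imp_deriv) auto
qed

lemma continuous_compact_support_bounded:
  fixes u :: "'a::metric_space \<Rightarrow> 'b::real_normed_vector"
  assumes "continuous_on UNIV u" "compact K" "\<And>x. x \<notin> K \<Longrightarrow> u x = 0"
  obtains B where "B > 0" "\<And>x. norm (u x) \<le> B"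
proof -
  have "compact (u ` K)" using assms by (meson compact_continuous_image continuous_on_subset subset_UNIV)
  then obtain B where B: "B > 0" "\<And>x. x \<in> K \<Longrightarrow> norm (u x) \<le> B"
    using compact_imp_bounded bounded_pos by (metis imageI)
  then have "norm (u x) \<le> B" for x using assms(3)[of x] by (cases "x \<in> K") auto
  then show ?thesis using B that by blast
qed

lemma test_functions_bounded:
  assumes "u \<in> test_functions \<Omega>"
  shows "\<exists>B>0. (\<forall>x. \<bar>u x\<bar> \<le> B) \<and> (\<forall>i x. \<bar>partial_deriv i u x\<bar> \<le> B)"
proof -
  obtain B where B: "B > 0" "\<And>x. norm (u x) \<le> B"
    by (rule continuous_compact_support_bounded[OF test_functions_continuous test_functions_compact, OF assms assms])
       (auto intro: test_functions_eq_0)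
  have "\<exists>C>0. \<forall>x. \<bar>partial_deriv i u x\<bar> \<le> C" for i
    by (rule continuous_compact_support_bounded[OF test_functions_continuous_partial test_functions_compact, OF assms assms])
       (auto intro: partial_deriv_eq_0_outside_support)
  then obtain C where C: "\<And>i. C i > 0" "\<And>i x. \<bar>partial_deriv i u x\<bar> \<le> C i" by metis
  define B' where "B' = B + (\<Sum>i\<in>UNIV. C i)"
  have s: "C i \<le> (\<Sum>i\<in>UNIV. C i)" for i by (rule member_le_sum) (use C(1) less_imp_le in auto)
  have "0 \<le> (\<Sum>i\<in>UNIV. C i)" using C(1) by (intro sum_nonneg) (auto intro: less_imp_le)
  then show ?thesis
  proof (intro exI[of _ B'] conjI allI)
    show "\<bar>u x\<bar> \<le> B'" for x using B(2)[of x] \<open>0 \<le> (\<Sum>i\<in>UNIV. C i)\<close> by (simp add: B'_def)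
    show "\<bar>partial_deriv i u x\<bar> \<le> B'" for x i
      using C(2)[of i x] s[of i] B(1) by (simp add: B'_def)
  qed (use B(1) in \<open>simp add: B'_def\<close>)
qed

lemma test_functions_lipschitz:
  assumes "u \<in> test_functions \<Omega>"
  obtains L where "L-lipschitz_on UNIV u"
proof -
  obtain B where B: "B > 0" "\<And>x. \<bar>u x\<bar> \<le> B" "\<And>x i. \<bar>partial_deriv i u x\<bar> \<le> B"
    using test_functions_bounded[OF assms] by blast
  have "(real CARD('a) * B)-lipschitz_on UNIV u"
  proof (rule bounded_derivative_imp_lipschitz)
    show "(u has_derivative (\<lambda>h. \<Sum>j\<in>UNIV. h $ j * partial_deriv j u x)) (at x within UNIV)" for x
      using has_real_derivative_partial_deriv(2)[OF test_functions_differentiable[OF assms]] by simp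
    show "onorm (\<lambda>h. \<Sum>j\<in>UNIV. h $ j * partial_deriv j u x) \<le> real CARD('a) * B" for x
    proof (rule onorm_bound)
      fix h :: "real^'a"
      have "\<bar>\<Sum>j\<in>UNIV. h $ j * partial_deriv j u x\<bar> \<le> (\<Sum>j\<in>(UNIV::'a set). norm h * B)"
        by (rule order_trans[OF sum_abs], rule sum_mono)
           (unfold abs_mult, intro mult_mono B(3) component_le_norm_cart abs_ge_zero norm_ge_zero)
      then show "norm (\<Sum>j\<in>UNIV. h $ j * partial_deriv j u x) \<le> real CARD('a) * B * norm h"
        by (simp add: mult_ac)
    qed (use B(1) in auto)
  qed (use B(1) in auto)
  then show ?thesis by (rule that)
qed

lemma partial_deriv_linear:
  fixes u v :: "real^'n \<Rightarrow> real"
  assumes "u differentiable (at x)" "v differentiable (at x)"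
  shows "partial_deriv i (\<lambda>x. u x + v x) x = partial_deriv i u x + partial_deriv i v x"
    and "partial_deriv i (\<lambda>x. c * u x) x = c * partial_deriv i u x"
proof -
  note D = has_real_derivative_partial_deriv(1)[OF assms(1), of i] has_real_derivative_partial_deriv(1)[OF assms(2), of i]
  show "partial_deriv i (\<lambda>x. u x + v x) x = partial_deriv i u x + partial_deriv i v x"
    by (subst partial_deriv_def) (rule DERIV_imp_deriv[OF DERIV_add[OF D]])
  show "partial_deriv i (\<lambda>x. c * u x) x = c * partial_deriv i u x"
    by (subst partial_deriv_def) (rule DERIV_imp_deriv[OF DERIV_cmult[OF D(1)]])
qed

lemma test_functions_add:
  assumes u: "u \<in> test_functions \<Omega>" and v: "v \<in> test_functions \<Omega>"
  shows "(\<lambda>x. u x + v x) \<in> test_functions \<Omega>"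
proof -
  have du: "iterated_partial is u differentiable (at x)" "iterated_partial is v differentiable (at x)" for "is" x
    using assms by (auto simp: test_functions_def)
  have "iterated_partial is (\<lambda>x. u x + v x) = (\<lambda>x. iterated_partial is u x + iterated_partial is v x)" for "is"
    by (induction "is") (auto simp: partial_deriv_linear(1)[OF du])
  then have "iterated_partial is (\<lambda>x. u x + v x) differentiable (at x)" for "is" x
    using du by (auto intro: differentiable_add)
  moreover have "closure {x. u x + v x \<noteq> 0} \<subseteq> closure {x. u x \<noteq> 0} \<union> closure {x. v x \<noteq> 0}"
    unfolding closure_Un[symmetric] by (rule closure_mono) auto
  moreover from this have "compact (closure {x. u x + v x \<noteq> 0})"
    using assms by (intro compact_closed_subset[OF compact_Un[OF test_functions_compact test_functions_compact]])
      (auto intro: u v)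
  ultimately show ?thesis using test_functions_subset[OF u] test_functions_subset[OF v]
    by (auto simp: test_functions_def)
qed

lemma test_functions_cmult:
  assumes u: "u \<in> test_functions \<Omega>"
  shows "(\<lambda>x. c * u x) \<in> test_functions \<Omega>"
proof -
  have du: "iterated_partial is u differentiable (at x)" for "is" x
    using assms by (auto simp: test_functions_def)
  have "iterated_partial is (\<lambda>x. c * u x) = (\<lambda>x. c * iterated_partial is u x)" for "is"
    by (induction "is") (auto simp: partial_deriv_linear(2)[OF du du])
  then have "iterated_partial is (\<lambda>x. c * u x) differentiable (at x)" for "is" x
    using du by (auto intro: differentiable_mult)
  moreover have sub: "closure {x. c * u x \<noteq> 0} \<subseteq> closure {x. u x \<noteq> 0}"
    by (rule closure_mono) auto
  moreover have "compact (closure {x. c * u x \<noteq> 0})"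
    using sub by (intro compact_closed_subset[OF test_functions_compact[OF u]]) auto
  ultimately show ?thesis using test_functions_subset[OF u] by (auto simp: test_functions_def)
qed

lemma test_functions_0: "(\<lambda>x. 0) \<in> test_functions \<Omega>"
proof -
  have "iterated_partial is (\<lambda>x. 0) = (\<lambda>x. 0)" for "is" :: "'a list"
    by (induction "is") (auto simp: partial_deriv_def fun_eq_iff)
  then show ?thesis by (auto simp: test_functions_def)
qed

lemma test_functions_diff:
  assumes "u \<in> test_functions \<Omega>" "v \<in> test_functions \<Omega>"
  shows "(\<lambda>x. u x - v x) \<in> test_functions \<Omega>"
  using test_functions_add[OF assms(1) test_functions_cmult[OF assms(2), of "-1"]] by simp

section \<open>Smooth bumps\<close>

text \<open>The standard function flat at 0, divided by powers of \<open>y\<close>. Differentiating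
  \<open>exp (- 1 / y)\<close> produces such powers, so the family over all \<open>k\<close> is
  closed under differentiation up to linear combinations.\<close>

definition flat_exp :: "nat \<Rightarrow> real \<Rightarrow> real" where
  "flat_exp k y = (if 0 < y then exp (- 1 / y) / y ^ k else 0)"

lemma flat_exp_tendsto_0: "(flat_exp k \<longlongrightarrow> 0) (at 0)"
proof (rule filterlim_split_at)
  have "\<forall>\<^sub>F y in at_left 0. flat_exp k y = 0"
    unfolding eventually_at_left_field by (intro exI[of _ "-1"]) (auto simp: flat_exp_def)
  then show "(flat_exp k \<longlongrightarrow> 0) (at_left 0)" by (rule tendsto_eventually)
  have "((\<lambda>y::real. (inverse y) ^ k / exp (inverse y)) \<longlongrightarrow> 0) (at_right 0)"
    by (rule filterlim_compose[OF tendsto_power_div_exp_0 filterlim_inverse_at_top_right])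
  moreover have "\<forall>\<^sub>F y in at_right 0. (inverse y) ^ k / exp (inverse y) = flat_exp k y"
    unfolding eventually_at_right_field
    by (intro exI[of _ "1"]) (auto simp: flat_exp_def exp_minus field_simps)
  ultimately show "(flat_exp k \<longlongrightarrow> 0) (at_right 0)" by (rule Lim_transform_eventually)
qed

lemma DERIV_flat_exp:
  "(flat_exp k has_real_derivative flat_exp (k + 2) y - real k * flat_exp (k + 1) y) (at y)"
proof -
  consider "y > 0" | "y < 0" | "y = 0" by linarith
  then show ?thesis
  proof cases
    case 1
    have "((\<lambda>y. exp (- 1 / y) / y ^ k) has_real_derivative flat_exp (k + 2) y - real k * flat_exp (k + 1) y) (at y)"
    \<comment> \<open>\<open>k = 0\<close> is treated apart because the derivative of
      \<open>y ^ k\<close> has the exponent \<open>k - 1\<close>.\<close>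
    proof (cases k)
      case 0
      then show ?thesis using 1 by (auto intro!: derivative_eq_intros simp: flat_exp_def power2_eq_square)
    next
      case (Suc j)
      have "((\<lambda>y. exp (- 1 / y) / y ^ k) has_real_derivative
          (exp (- 1 / y) * (1 / y\<^sup>2) * y ^ k - exp (- 1 / y) * (real k * y ^ j)) / (y ^ k * y ^ k)) (at y)"
      proof (rule DERIV_divide)
        show "((\<lambda>y. exp (- 1 / y)) has_real_derivative exp (- 1 / y) * (1 / y\<^sup>2)) (at y)"
          using 1 by (auto intro!: derivative_eq_intros simp: power2_eq_square)
        show "((\<lambda>y. y ^ k) has_real_derivative real k * y ^ j) (at y)"
          using DERIV_pow[of k y] Suc by simp
      qed (use 1 in auto)
      moreover have "(exp (- 1 / y) * (1 / y\<^sup>2) * y ^ k - exp (- 1 / y) * (real k * y ^ j)) / (y ^ k * y ^ k) =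
          flat_exp (k + 2) y - real k * flat_exp (k + 1) y"
        using 1 Suc by (simp add: flat_exp_def field_simps power2_eq_square)
      ultimately show ?thesis by simp
    qed
    then show ?thesis
      by (rule has_field_derivative_transform_within_open[of _ _ _ "{0<..}"]) (use 1 in \<open>auto simp: flat_exp_def\<close>)
  next
    case 2
    have "((\<lambda>y::real. 0) has_real_derivative 0) (at y)" by simp
    then have "(flat_exp k has_real_derivative 0) (at y)"
      by (rule has_field_derivative_transform_within_open[of _ _ _ "{..<0}"]) (use 2 in \<open>auto simp: flat_exp_def\<close>)
    then show ?thesis using 2 by (simp add: flat_exp_def)
  next
    case 3
    \<comment> \<open>At 0 the difference quotient of \<open>flat_exp k\<close> is
      \<open>flat_exp (k + 1)\<close> itself, whose limit there is 0.\<close>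
    have "(\<lambda>h. (flat_exp k (0 + h) - flat_exp k 0) / h) = flat_exp (k + 1)"
      by (auto simp: flat_exp_def fun_eq_iff)
    then show ?thesis using flat_exp_tendsto_0[of "k + 1"] 3 by (simp add: DERIV_def flat_exp_def)
  qed
qed

text \<open>This class is closed under differentiation, so its members are smooth.\<close>

inductive_set flat_class :: "real poly \<Rightarrow> (real \<Rightarrow> real) set" for q where
  base: "(\<lambda>x. poly r x * flat_exp k (poly q x)) \<in> flat_class q"
| add: "\<lbrakk>F \<in> flat_class q; G \<in> flat_class q\<rbrakk> \<Longrightarrow> (\<lambda>x. F x + G x) \<in> flat_class q"

text \<open>The chain rule contributes the polynomial factor \<open>pderiv q\<close> and raises
  \<open>k\<close> by one or two, so the derivative of a generator is a sum of three
  generators.\<close>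

lemma flat_class_derivative:
  assumes "F \<in> flat_class q"
  shows "\<exists>F'\<in>flat_class q. \<forall>x. (F has_real_derivative F' x) (at x)"
  using assms
proof induction
  case (base r k)
  let ?F1 = "\<lambda>x. poly (pderiv r) x * flat_exp k (poly q x)"
  let ?F2 = "\<lambda>x. poly (r * pderiv q) x * flat_exp (k + 2) (poly q x)"
  let ?F3 = "\<lambda>x. poly (smult (- real k) (r * pderiv q)) x * flat_exp (k + 1) (poly q x)"
  have "((\<lambda>x. poly r x * flat_exp k (poly q x)) has_real_derivative (?F1 x + (?F2 x + ?F3 x))) (at x)" for x
  proof -
    have "((\<lambda>x. flat_exp k (poly q x)) has_real_derivative
       (flat_exp (k + 2) (poly q x) - real k * flat_exp (k + 1) (poly q x)) * poly (pderiv q) x) (at x)"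
      by (rule DERIV_chain2[OF DERIV_flat_exp poly_DERIV])
    from DERIV_mult[OF poly_DERIV this] show ?thesis
      by (rule DERIV_cong) (simp add: algebra_simps)
  qed
  moreover have "(\<lambda>x. ?F1 x + (?F2 x + ?F3 x)) \<in> flat_class q"
    by (intro flat_class.add flat_class.base)
  ultimately show ?case by (intro bexI[of _ "\<lambda>x. ?F1 x + (?F2 x + ?F3 x)"]) simp_all
next
  case (add F G)
  then obtain F' G' where "F' \<in> flat_class q" "\<forall>x. (F has_real_derivative F' x) (at x)"
     "G' \<in> flat_class q" "\<forall>x. (G has_real_derivative G' x) (at x)" by blast
  then show ?case
    by (intro bexI[of _ "\<lambda>x. F' x + G' x"] allI DERIV_add flat_class.add) auto
qed

lemma partial_deriv_prod:
  fixes F :: "'n::finite \<Rightarrow> real \<Rightarrow> real"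
  assumes "(F j has_real_derivative d) (at (x $ j))"
  shows "partial_deriv j (\<lambda>x. \<Prod>i\<in>UNIV. F i (x $ i)) x = d * (\<Prod>i\<in>UNIV - {j}. F i (x $ i))"
proof -
  have "(\<lambda>t. \<Prod>i\<in>UNIV. F i ((x + t *\<^sub>R axis j 1) $ i)) = (\<lambda>t. F j (x $ j + t) * (\<Prod>i\<in>UNIV - {j}. F i (x $ i)))"
    by (auto simp: fun_eq_iff prod.remove[of UNIV j] axis_def intro!: prod.cong)
  moreover have "((\<lambda>t. F j (x $ j + t)) has_real_derivative d) (at 0)"
    using assms by (subst DERIV_at_within_shift[symmetric, where z = "x $ j", simplified]) simp
  ultimately show ?thesis
    unfolding partial_deriv_def by (auto intro!: DERIV_imp_deriv DERIV_cmult_right)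
qed

lemma differentiable_prod_components:
  fixes F :: "'n::finite \<Rightarrow> real \<Rightarrow> real"
  assumes "\<And>i x. \<exists>d. (F i has_real_derivative d) (at x)"
  shows "(\<lambda>x::real^'n. \<Prod>i\<in>UNIV. F i (x $ i)) differentiable (at x)"
proof -
  obtain F' where F': "\<And>i x. (F i has_real_derivative F' i x) (at x)" using assms by metis
  have "((\<lambda>x::real^'n. F i (x $ i)) has_derivative (\<lambda>h. h $ i * F' i (x $ i))) (at x)" for i
  proof -
    have "((\<lambda>x::real^'n. x $ i) has_derivative (\<lambda>h. h $ i)) (at x)"
      by (rule bounded_linear_imp_has_derivative[OF bounded_linear_vec_nth])
    from has_derivative_compose[OF this F'[of i "x $ i", unfolded has_field_derivative_def]]
    show ?thesis by (simp add: mult.commute)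
  qed
  from has_derivative_prod[of UNIV "\<lambda>i x. F i (x $ i)", OF this] show ?thesis unfolding differentiable_def by blast
qed

text \<open>A partial derivative acts on a single factor of the product and replaces it by its
  derivative, which lies in the same class.\<close>

lemma iterated_partial_flat_prod:
  fixes F :: "'n::finite \<Rightarrow> real \<Rightarrow> real"
  assumes "\<And>i. F i \<in> flat_class (q i)"
  shows "\<exists>G. (\<forall>i. G i \<in> flat_class (q i)) \<and>
    iterated_partial is (\<lambda>x. \<Prod>i\<in>UNIV. F i (x $ i)) = (\<lambda>x. \<Prod>i\<in>UNIV. G i (x $ i))"
proof (induction "is")
  case Nil
  then show ?case using assms by auto
next
  case (Cons j "is")
  then obtain G where G: "\<And>i. G i \<in> flat_class (q i)"
    "iterated_partial is (\<lambda>x. \<Prod>i\<in>UNIV. F i (x $ i)) = (\<lambda>x. \<Prod>i\<in>UNIV. G i (x $ i))" by blast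
  obtain g where g: "g \<in> flat_class (q j)" "\<And>x. (G j has_real_derivative g x) (at x)"
    using flat_class_derivative[OF G(1)] by blast
  have "partial_deriv j (\<lambda>x. \<Prod>i\<in>UNIV. G i (x $ i)) x = (\<Prod>i\<in>UNIV. (G(j := g)) i (x $ i))" for x
    by (subst partial_deriv_prod[of G j "g (x $ j)" x, OF g(2)])
       (auto simp: prod.remove[of UNIV j] intro!: prod.cong)
  then have "iterated_partial (j # is) (\<lambda>x. \<Prod>i\<in>UNIV. F i (x $ i)) = (\<lambda>x. \<Prod>i\<in>UNIV. (G(j := g)) i (x $ i))"
    by (intro ext) (simp only: iterated_partial.simps G(2))
  then show ?case using G(1) g(1) by (intro exI[of _ "G(j := g)"]) auto
qed

text \<open>For \<open>a $ i < b $ i\<close> each quadratic is positive exactly between these two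
  numbers. The factor \<open>c\<close> is a sharpness parameter: as it tends to infinity, the bump
  tends to the indicator of \<open>box a b\<close>.\<close>

definition box_bump :: "real \<Rightarrow> real^'n \<Rightarrow> real^'n \<Rightarrow> real^'n \<Rightarrow> real" where
  "box_bump c a b x = (\<Prod>i\<in>UNIV. flat_exp 0 (c * ((x $ i - a $ i) * (b $ i - x $ i))))"

lemma box_bump_bounds: "0 \<le> box_bump c a b x" "box_bump c a b x \<le> 1"
proof -
  have "0 \<le> flat_exp 0 y \<and> flat_exp 0 y \<le> 1" for y by (auto simp: flat_exp_def)
  then show "0 \<le> box_bump c a b x" "box_bump c a b x \<le> 1"
    unfolding box_bump_def by (auto intro: prod_nonneg prod_le_1)
qed

lemma box_bump_outside:
  assumes "c \<ge> 0" "\<And>i. a $ i < b $ i" "x \<notin> box a b"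
  shows "box_bump c a b x = 0"
proof -
  obtain i where "x $ i \<le> a $ i \<or> b $ i \<le> x $ i"
    using assms(3) by (auto simp: mem_box_cart not_less)
  then have "(x $ i - a $ i) * (b $ i - x $ i) \<le> 0"
    using assms(2)[of i] by (auto simp: mult_le_0_iff)
  then have "c * ((x $ i - a $ i) * (b $ i - x $ i)) \<le> 0" using assms(1) by (simp add: mult_nonneg_nonpos)
  then have "flat_exp 0 (c * ((x $ i - a $ i) * (b $ i - x $ i))) = 0" by (simp add: flat_exp_def)
  then show ?thesis unfolding box_bump_def by (intro prod_zero) auto
qed

lemma box_bump_tendsto:
  assumes "\<And>i. a $ i < b $ i"
  shows "(\<lambda>m. box_bump (real m) a b x) \<longlonglongrightarrow> indicator (box a b) x"
proof (cases "x \<in> box a b")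
  case True
  have "(\<lambda>m. flat_exp 0 (real m * ((x $ i - a $ i) * (b $ i - x $ i)))) \<longlonglongrightarrow> 1" for i
  proof -
    let ?d = "(x $ i - a $ i) * (b $ i - x $ i)"
    have d: "?d > 0" using True by (auto simp: mem_box_cart)
    have "(\<lambda>m. exp (- ((1 / real m) / ?d))) \<longlonglongrightarrow> exp (- (0 / ?d))"
      using d by (intro tendsto_intros lim_1_over_n) auto
    moreover have "\<forall>\<^sub>F m in sequentially. exp (- ((1 / real m) / ?d)) = flat_exp 0 (real m * ?d)"
      using eventually_gt_at_top[of 0] by eventually_elim (use d in \<open>auto simp: flat_exp_def\<close>)
    ultimately show ?thesis by (simp add: Lim_transform_eventually)
  qed
  then have "(\<lambda>m. box_bump (real m) a b x) \<longlonglongrightarrow> (\<Prod>i\<in>(UNIV::'a set). 1)"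
    unfolding box_bump_def by (intro tendsto_prod)
  then show ?thesis using True by simp
next
  case False
  then show ?thesis using box_bump_outside[OF _ assms] by simp
qed

text \<open>The support is a closure, hence the inclusion of \<open>cbox a b\<close> and not only of
  \<open>box a b\<close>.\<close>

lemma box_bump_test_function:
  assumes "c \<ge> 0" "\<And>i. a $ i < b $ i" "cbox a b \<subseteq> \<Omega>"
  shows "box_bump c a b \<in> test_functions \<Omega>"
proof -
  define q where "q = (\<lambda>i. [:c:] * ([:- (a $ i), 1:] * [:b $ i, - 1:]))"
  define F where "F = (\<lambda>i x. poly 1 x * flat_exp 0 (poly (q i) x))"
  have F: "F i \<in> flat_class (q i)" for i unfolding F_def by (rule flat_class.base)
  have eq: "box_bump c a b = (\<lambda>x. \<Prod>i\<in>UNIV. F i (x $ i))"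
    by (auto simp: fun_eq_iff box_bump_def F_def q_def intro!: prod.cong) (simp add: algebra_simps)
  have "iterated_partial is (box_bump c a b) differentiable (at x)" for "is" x
  proof -
    obtain G where "\<And>i. G i \<in> flat_class (q i)"
       "iterated_partial is (box_bump c a b) = (\<lambda>x. \<Prod>i\<in>UNIV. G i (x $ i))"
      using iterated_partial_flat_prod[of F q, OF F] unfolding eq by blast
    then show ?thesis using flat_class_derivative
      by (metis differentiable_prod_components)
  qed
  moreover have sub: "closure {x. box_bump c a b x \<noteq> 0} \<subseteq> cbox a b"
    by (rule closure_minimal) (use box_bump_outside[OF assms(1,2)] box_subset_cbox[of a b] closed_cbox in \<open>force+\<close>)
  moreover have "compact (closure {x. box_bump c a b x \<noteq> 0})"
    using sub by (intro compact_closed_subset[OF compact_cbox]) auto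
  ultimately show ?thesis using assms(3) by (auto simp: test_functions_def)
qed

section \<open>Density of test functions\<close>

lemma L1_triangle:
  fixes F G H :: "'a \<Rightarrow> real"
  assumes "integrable M F" "integrable M G" "integrable M H"
  shows "(\<integral>x. \<bar>F x - H x\<bar> \<partial>M) \<le> (\<integral>x. \<bar>F x - G x\<bar> \<partial>M) + (\<integral>x. \<bar>G x - H x\<bar> \<partial>M)"
proof -
  have "(\<integral>x. \<bar>F x - H x\<bar> \<partial>M) \<le> (\<integral>x. \<bar>F x - G x\<bar> + \<bar>G x - H x\<bar> \<partial>M)"
    using assms by (intro integral_mono) auto
  then show ?thesis using assms by simp
qed

lemma L1_dominated_convergence:
  fixes F :: "'a \<Rightarrow> real"
  assumes [measurable]: "F \<in> borel_measurable M" "\<And>n. s n \<in> borel_measurable M"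
    and w: "integrable M w" and lim: "AE x in M. (\<lambda>n. s n x) \<longlonglongrightarrow> F x"
    and bd: "\<And>n. AE x in M. \<bar>s n x\<bar> \<le> w x"
  shows "integrable M F" "\<And>n. integrable M (s n)" "(\<lambda>n. \<integral>x. \<bar>s n x - F x\<bar> \<partial>M) \<longlonglongrightarrow> 0"
proof -
  show F: "integrable M F"
    by (rule integrable_dominated_convergence[OF _ _ w lim]) (use bd in auto)
  show s: "integrable M (s n)" for n
    by (rule Bochner_Integration.integrable_bound[OF w]) (use bd[of n] in auto)
  have "AE x in M. \<forall>n. \<bar>s n x\<bar> \<le> w x" using bd by (simp add: AE_all_countable)
  then have bF: "AE x in M. \<bar>F x\<bar> \<le> w x"
    using lim
  proof eventually_elim
    case (elim x)
    then show ?case by (intro tendsto_upperbound[OF tendsto_rabs[of "\<lambda>n. s n x"]]) auto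
  qed
  have "(\<lambda>n. \<integral>x. \<bar>s n x - F x\<bar> \<partial>M) \<longlonglongrightarrow> (\<integral>x. 0 \<partial>M)"
  proof (rule integral_dominated_convergence)
    show "integrable M (\<lambda>x. 2 * w x)" using w by simp
    show "AE x in M. (\<lambda>n. \<bar>s n x - F x\<bar>) \<longlonglongrightarrow> 0"
      using lim by eventually_elim (auto intro!: tendsto_rabs_zero simp: LIM_zero)
    show "AE x in M. norm \<bar>s n x - F x\<bar> \<le> 2 * w x" for n
      using bd[of n] bF by eventually_elim auto
  qed auto
  then show "(\<lambda>n. \<integral>x. \<bar>s n x - F x\<bar> \<partial>M) \<longlonglongrightarrow> 0" by simp
qed

text \<open>There are two instances: Lebesgue measure on the whole space, for approximating
  integrable functions in the flow estimates, and the weighted measure \<open>h dx\<close> on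
  \<open>\<Omega>\<close>, for the duality. The measure lives on the whole space and is null off
  \<open>\<Omega>\<close>, so functions are never restricted.\<close>

locale locally_finite_measure_on =
  fixes \<Omega> :: "(real^'n) set" and \<mu> :: "(real^'n) measure"
  assumes open_domain: "open \<Omega>"
    and sets_eq_borel [measurable_cong]: "sets \<mu> = sets borel"
    and finite_compact: "\<And>K. compact K \<Longrightarrow> K \<subseteq> \<Omega> \<Longrightarrow> emeasure \<mu> K < \<infinity>"
    and null_outside: "emeasure \<mu> (- \<Omega>) = 0"
begin

lemma space_eq_UNIV [simp]: "space \<mu> = UNIV"
  using sets_eq_imp_space_eq[OF sets_eq_borel] by simp

lemma AE_in_domain: "AE x in \<mu>. x \<in> \<Omega>"
proof (rule AE_I')
  show "- \<Omega> \<in> null_sets \<mu>" using null_outside open_domain by (auto simp: null_sets_def sets_eq_borel)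
qed auto

lemma integrable_test_function:
  assumes u: "u \<in> test_functions \<Omega>"
  shows "integrable \<mu> u"
proof -
  obtain B where B: "\<And>x. \<bar>u x\<bar> \<le> B" using test_functions_bounded[OF u] by blast
  let ?K = "closure {x. u x \<noteq> 0}"
  have [measurable]: "u \<in> borel_measurable borel"
    by (rule borel_measurable_continuous_onI[OF test_functions_continuous[OF u]])
  have K: "emeasure \<mu> ?K < \<infinity>"
    by (rule finite_compact[OF test_functions_compact[OF u] test_functions_subset[OF u]])
  show ?thesis
  proof (rule Bochner_Integration.integrable_bound)
    show "integrable \<mu> (\<lambda>x. B * indicator ?K x)"
      using K by (intro integrable_mult_right integrable_real_indicator) (auto simp: sets_eq_borel)
    show "AE x in \<mu>. norm (u x) \<le> norm (B * indicator ?K x)"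
    proof (rule AE_I2)
      fix x
      show "norm (u x) \<le> norm (B * indicator ?K x)"
        using B[of x] test_functions_eq_0[of x u] by (cases "x \<in> ?K") auto
    qed
  qed auto
qed

definition L1_approximable :: "(real^'n \<Rightarrow> real) \<Rightarrow> bool" where
  "L1_approximable F \<longleftrightarrow> integrable \<mu> F \<and> (\<forall>e>0. \<exists>u\<in>test_functions \<Omega>. (\<integral>x. \<bar>F x - u x\<bar> \<partial>\<mu>) < e)"

lemma L1_approximableD:
  assumes "L1_approximable F" "e > 0"
  obtains u where "u \<in> test_functions \<Omega>" "(\<integral>x. \<bar>F x - u x\<bar> \<partial>\<mu>) < e"
  using assms by (auto simp: L1_approximable_def)

lemma L1_approximable_lim:
  assumes F: "integrable \<mu> F" and s: "\<And>n. L1_approximable (s n)"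
    and lim: "(\<lambda>n. \<integral>x. \<bar>s n x - F x\<bar> \<partial>\<mu>) \<longlonglongrightarrow> 0"
  shows "L1_approximable F"
  unfolding L1_approximable_def
proof (intro conjI allI impI F)
  fix e :: real assume "e > 0"
  then have "\<forall>\<^sub>F n in sequentially. (\<integral>x. \<bar>s n x - F x\<bar> \<partial>\<mu>) < e / 2"
    using lim by (intro order_tendstoD) auto
  then obtain n where n: "(\<integral>x. \<bar>s n x - F x\<bar> \<partial>\<mu>) < e / 2"
    using eventually_happens by force
  obtain u where u: "u \<in> test_functions \<Omega>" "(\<integral>x. \<bar>s n x - u x\<bar> \<partial>\<mu>) < e / 2"
    using L1_approximableD[OF s[of n], of "e / 2"] \<open>e > 0\<close> by auto
  have "(\<integral>x. \<bar>F x - u x\<bar> \<partial>\<mu>) \<le> (\<integral>x. \<bar>F x - s n x\<bar> \<partial>\<mu>) + (\<integral>x. \<bar>s n x - u x\<bar> \<partial>\<mu>)"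
    using F s[of n] integrable_test_function[OF u(1)] by (intro L1_triangle) (auto simp: L1_approximable_def)
  also have "\<dots> < e" using n u by (simp add: abs_minus_commute)
  finally show "\<exists>u\<in>test_functions \<Omega>. (\<integral>x. \<bar>F x - u x\<bar> \<partial>\<mu>) < e" using u(1) by blast
qed

lemma L1_approximable_dominated:
  assumes "F \<in> borel_measurable \<mu>" "\<And>n. L1_approximable (s n)"
    and "integrable \<mu> w" "AE x in \<mu>. (\<lambda>n. s n x) \<longlonglongrightarrow> F x" "\<And>n x. \<bar>s n x\<bar> \<le> w x"
  shows "L1_approximable F"
proof -
  have [measurable]: "s n \<in> borel_measurable \<mu>" for n using assms(2)[of n] by (auto simp: L1_approximable_def)
  have bd: "AE x in \<mu>. \<bar>s n x\<bar> \<le> w x" for n using assms(5) by auto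
  note * = L1_dominated_convergence[OF assms(1) _ assms(3,4) bd]
  show ?thesis by (rule L1_approximable_lim[OF *(1) assms(2) *(3)]) auto
qed

lemma L1_approximable_add:
  assumes "L1_approximable F" "L1_approximable G"
  shows "L1_approximable (\<lambda>x. F x + G x)"
  unfolding L1_approximable_def
proof (intro conjI allI impI)
  have int: "integrable \<mu> F" "integrable \<mu> G" using assms by (auto simp: L1_approximable_def)
  then show "integrable \<mu> (\<lambda>x. F x + G x)" by simp
  fix e :: real assume "e > 0"
  then have e2: "e / 2 > 0" by simp
  obtain u where u: "u \<in> test_functions \<Omega>" "(\<integral>x. \<bar>F x - u x\<bar> \<partial>\<mu>) < e / 2"
    by (rule L1_approximableD[OF assms(1) e2])
  obtain v where v: "v \<in> test_functions \<Omega>" "(\<integral>x. \<bar>G x - v x\<bar> \<partial>\<mu>) < e / 2"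
    by (rule L1_approximableD[OF assms(2) e2])
  note iu = integrable_test_function[OF u(1)] integrable_test_function[OF v(1)]
  have "(\<integral>x. \<bar>F x + G x - (u x + v x)\<bar> \<partial>\<mu>) \<le> (\<integral>x. \<bar>F x - u x\<bar> + \<bar>G x - v x\<bar> \<partial>\<mu>)"
    using int iu by (intro integral_mono) auto
  also have "\<dots> < e" using int iu u v by simp
  finally show "\<exists>u\<in>test_functions \<Omega>. (\<integral>x. \<bar>F x + G x - u x\<bar> \<partial>\<mu>) < e"
    by (rule bexI[OF _ test_functions_add[OF u(1) v(1)]])
qed

lemma L1_approximable_cmult:
  assumes "L1_approximable F"
  shows "L1_approximable (\<lambda>x. c * F x)"
  unfolding L1_approximable_def
proof (intro conjI allI impI)
  have int: "integrable \<mu> F" using assms by (auto simp: L1_approximable_def)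
  then show "integrable \<mu> (\<lambda>x. c * F x)" by simp
  fix e :: real assume "e > 0"
  then have e2: "e / (\<bar>c\<bar> + 1) > 0" by simp
  obtain u where u: "u \<in> test_functions \<Omega>" "(\<integral>x. \<bar>F x - u x\<bar> \<partial>\<mu>) < e / (\<bar>c\<bar> + 1)"
    by (rule L1_approximableD[OF assms e2])
  have "(\<integral>x. \<bar>c * F x - c * u x\<bar> \<partial>\<mu>) = \<bar>c\<bar> * (\<integral>x. \<bar>F x - u x\<bar> \<partial>\<mu>)"
    by (simp add: right_diff_distrib[symmetric] abs_mult)
  also have "\<dots> \<le> \<bar>c\<bar> * (e / (\<bar>c\<bar> + 1))" using u(2) by (intro mult_left_mono) auto
  also have "\<dots> < e" using \<open>e > 0\<close> by (simp add: field_simps)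
  finally show "\<exists>u\<in>test_functions \<Omega>. (\<integral>x. \<bar>c * F x - u x\<bar> \<partial>\<mu>) < e"
    by (rule bexI[OF _ test_functions_cmult[OF u(1)]])
qed

lemma L1_approximable_test: "u \<in> test_functions \<Omega> \<Longrightarrow> L1_approximable u"
  by (auto simp: L1_approximable_def integrable_test_function intro!: bexI[of _ u])

lemma L1_approximable_empty: "L1_approximable (indicator {})"
proof -
  have "(indicator {} :: real^'n \<Rightarrow> real) = (\<lambda>x. 0)" by (simp add: fun_eq_iff)
  then show ?thesis using L1_approximable_test[OF test_functions_0] by simp
qed

lemma integrable_indicator_box:
  assumes "cbox a b \<subseteq> \<Omega>" "A \<in> sets borel" "A \<subseteq> box a b"
  shows "integrable \<mu> (indicator A :: _ \<Rightarrow> real)"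
proof -
  have "emeasure \<mu> A \<le> emeasure \<mu> (cbox a b)"
    using assms box_subset_cbox[of a b] by (intro emeasure_mono) (auto simp: sets_eq_borel)
  also have "\<dots> < \<infinity>" using assms by (intro finite_compact) auto
  finally show ?thesis using assms by (intro integrable_real_indicator) (auto simp: sets_eq_borel)
qed

lemma L1_approximable_box:
  assumes sub: "cbox a b \<subseteq> \<Omega>"
  shows "L1_approximable (indicator (box a b))"
proof (cases "\<forall>i. a $ i < b $ i")
  case True
  have meas: "indicator (box a b) \<in> borel_measurable \<mu>"
    by (rule borel_measurable_indicator) (simp add: sets_eq_borel)
  show ?thesis
  proof (rule L1_approximable_dominated[OF meas])
    show "integrable \<mu> (indicator (box a b) :: _ \<Rightarrow> real)" by (rule integrable_indicator_box[OF sub]) auto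
    show "L1_approximable (box_bump (real m) a b)" for m
      using True sub by (intro L1_approximable_test box_bump_test_function) auto
    show "AE x in \<mu>. (\<lambda>m. box_bump (real m) a b x) \<longlonglongrightarrow> indicator (box a b) x"
      using True box_bump_tendsto[of a b] by auto
    show "\<bar>box_bump (real m) a b x\<bar> \<le> indicator (box a b) x" for m x
      using box_bump_bounds[of "real m" a b x] box_bump_outside[of "real m" a b x] True
      by (cases "x \<in> box a b") auto
  qed
next
  case False
  then have "box a b = {}" by (auto simp: set_eq_iff mem_box_cart not_less) (meson less_trans not_less)
  then show ?thesis using L1_approximable_empty L1_approximable_test[OF test_functions_0] by simp
qed

text \<open>A Dynkin argument: boxes are closed under intersection and generate the Borel sets.
  Inside a fixed box of finite measure, complements are formed by subtraction and countable unions
  by dominated convergence.\<close>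

lemma L1_approximable_Int_box:
  assumes sub: "cbox a b \<subseteq> \<Omega>" and A: "A \<in> sets borel"
  shows "L1_approximable (indicator (A \<inter> box a b))"
proof -
  let ?G = "range (\<lambda>(a, b). box a b :: (real^'n) set)"
  have sb: "sigma_sets UNIV ?G = sets borel" by (subst borel_eq_box) (simp add: sets_measure_of)
  have Pow: "?G \<subseteq> Pow UNIV" by simp
  have stable: "Int_stable ?G"
    by (auto simp: Int_stable_def box_Int_box)
  have "A \<in> sigma_sets UNIV ?G" using A sb by simp
  then show ?thesis
  proof (induction A rule: sigma_sets_induct_disjoint[OF stable Pow, consumes 1, case_names basic empty compl union])
    case (basic A)
    then obtain c d where A: "A = box c d" by auto
    obtain p q where pq: "box c d \<inter> box a b = box p q" using box_Int_box by blast
    show ?case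
    \<comment> \<open>When \<open>box p q\<close> is empty, \<open>cbox p q\<close> can still be
      nonempty and stick out of \<open>\<Omega>\<close>, hence the separate case.\<close>
    proof (cases "box p q = {}")
      case True
      then show ?thesis using A pq L1_approximable_test[OF test_functions_0] by (simp add: indicator_def)
    next
      case False
      have "cbox p q = closure (box p q)" using False by (simp add: closure_box)
      also have "\<dots> \<subseteq> cbox a b"
        using pq box_subset_cbox[of a b] by (intro closure_minimal) (auto simp: closed_cbox)
      finally show ?thesis using A pq sub by (auto intro!: L1_approximable_box)
    qed
  next
    case empty
    then show ?case using L1_approximable_empty L1_approximable_test[OF test_functions_0] by simp
  next
    case (compl A)
    have "L1_approximable (\<lambda>x. indicator (box a b) x + (- 1) * indicator (A \<inter> box a b) x)"
      by (intro L1_approximable_add L1_approximable_cmult L1_approximable_box sub compl)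
    moreover have "(\<lambda>x. indicator (box a b) x + (- 1) * indicator (A \<inter> box a b) x) =
        (indicator ((UNIV - A) \<inter> box a b) :: _ \<Rightarrow> real)"
      by (auto simp: indicator_def fun_eq_iff)
    ultimately show ?case by simp
  next
    case (union A)
    then have [measurable]: "A i \<in> sets borel" for i using sb by auto
    have ap: "L1_approximable (\<lambda>x. \<Sum>i<n. indicator (A i \<inter> box a b) x)" for n :: nat
      by (induction n) (use union L1_approximable_test[OF test_functions_0] in \<open>auto intro: L1_approximable_add\<close>)
    have eq: "(\<Sum>i<n. indicator (A i \<inter> box a b) x) = (indicator ((\<Union>i<n. A i) \<inter> box a b) x :: real)" for n x
    proof -
      have "disjoint_family_on (\<lambda>i. A i \<inter> box a b) {..<n}"
        using union(1) by (auto simp: disjoint_family_on_def)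
      from indicator_UN_disjoint[OF _ this, of x]
      have "indicator (\<Union>i<n. A i \<inter> box a b) x = (\<Sum>i<n. indicator (A i \<inter> box a b) x :: real)" by simp
      moreover have "(\<Union>i<n. A i) \<inter> box a b = (\<Union>i<n. A i \<inter> box a b)" by blast
      ultimately show ?thesis by (simp only:)
    qed
    have meas: "indicator ((\<Union>i. A i) \<inter> box a b) \<in> borel_measurable \<mu>" by measurable
    show ?case
    proof (rule L1_approximable_dominated[OF meas ap])
      show "integrable \<mu> (indicator (box a b) :: _ \<Rightarrow> real)" by (rule integrable_indicator_box[OF sub]) auto
      have "(\<lambda>n. indicator ((\<Union>i<n. A i) \<inter> box a b) x :: real) \<longlonglongrightarrow> indicator ((\<Union>i. A i) \<inter> box a b) x" for x
      proof (cases "x \<in> (\<Union>i. A i) \<inter> box a b")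
        case True
        then obtain i where i: "x \<in> A i" "x \<in> box a b" by auto
        have "\<forall>\<^sub>F n in sequentially. indicator ((\<Union>i<n. A i) \<inter> box a b) x = (1::real)"
          using eventually_gt_at_top[of i] by eventually_elim (use i in \<open>auto simp: indicator_def\<close>)
        then show ?thesis using True by (simp add: tendsto_eventually)
      next
        case False
        then show ?thesis by (auto simp: indicator_def)
      qed
      then show "AE x in \<mu>. (\<lambda>n. \<Sum>i<n. indicator (A i \<inter> box a b) x :: real) \<longlonglongrightarrow> indicator ((\<Union>i. A i) \<inter> box a b) x"
        by (simp add: eq)
      show "\<bar>\<Sum>i<n. indicator (A i \<inter> box a b) x :: real\<bar> \<le> indicator (box a b) x" for n x
        unfolding eq by (auto simp: indicator_def)
    qed
  qed
qed

text \<open>\<open>\<Omega>\<close> is a countable union of boxes whose closures it contains. Inside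
  each box the Dynkin argument applies, and the finite mass of \<open>A\<close> dominates the
  limit.\<close>

lemma L1_approximable_indicator:
  assumes A: "A \<in> sets borel" "emeasure \<mu> A < \<infinity>"
  shows "L1_approximable (indicator A)"
proof -
  define \<F> where "\<F> = {S. \<exists>a b. S = box a b \<and> cbox a b \<subseteq> \<Omega>}"
  obtain \<F>' where \<F>': "\<F>' \<subseteq> \<F>" "countable \<F>'" "\<Union>\<F>' = \<Union>\<F>"
    using Lindelof[of \<F>] by (auto simp: \<F>_def)
  have cover: "\<Union>\<F> = \<Omega>"
  proof
    show "\<Union>\<F> \<subseteq> \<Omega>" using box_subset_cbox by (fastforce simp: \<F>_def)
    show "\<Omega> \<subseteq> \<Union>\<F>"
    proof
      fix x assume "x \<in> \<Omega>"
      then obtain a b where "cbox a b \<subseteq> \<Omega>" "x \<in> box a b"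
        using open_contains_cbox[OF open_domain] by metis
      then show "x \<in> \<Union>\<F>" by (auto simp: \<F>_def)
    qed
  qed
  show ?thesis
  \<comment> \<open>For empty \<open>\<Omega>\<close> the measure is zero; otherwise the family of
    boxes is nonempty and can be enumerated.\<close>
  proof (cases "\<Omega> = {}")
    case True
    then have "AE x in \<mu>. False" using AE_in_domain by simp
    then have "(\<integral>x. \<bar>indicator A x - (0::real)\<bar> \<partial>\<mu>) = 0"
      by (intro integral_eq_zero_AE) (auto elim: eventually_mono)
    moreover have "integrable \<mu> (indicator A :: _ \<Rightarrow> real)" using A by (intro integrable_real_indicator) (auto simp: sets_eq_borel)
    ultimately show ?thesis unfolding L1_approximable_def
      by (auto intro!: bexI[OF _ test_functions_0])
  next
    case False
    have "\<F>' \<noteq> {}" using \<F>'(3) cover False by (metis Union_empty)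
    have "countable \<F>'" by fact
    define Q where "Q = from_nat_into \<F>'"
    have Q: "range Q = \<F>'" unfolding Q_def by (rule range_from_nat_into) fact+
    have Qbox: "\<exists>a b. Q n = box a b \<and> cbox a b \<subseteq> \<Omega>" for n :: nat
    proof -
      have "Q n \<in> \<F>" using Q \<F>'(1) by (metis rangeI subsetD)
      then show ?thesis by (simp add: \<F>_def)
    qed
    have [measurable]: "Q n \<in> sets borel" for n using Qbox[of n] by auto
    have UQ: "(\<Union>n. Q n) = \<Omega>" using \<F>'(3) cover unfolding Q by simp
    have ap: "L1_approximable (indicator (A \<inter> (\<Union>i<n. Q i)))" for n
    proof (induction n)
      case 0
      then show ?case using L1_approximable_empty L1_approximable_test[OF test_functions_0] by simp
    next
      case (Suc n)
      obtain a b where ab: "Q n = box a b" "cbox a b \<subseteq> \<Omega>" using Qbox by blast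
      \<comment> \<open>Removing the earlier boxes makes the new piece disjoint from them, so that
        the indicators add.\<close>
      have "L1_approximable (indicator ((A - (\<Union>i<n. Q i)) \<inter> box a b))"
        by (rule L1_approximable_Int_box[OF ab(2)]) (use A in auto)
      then have "L1_approximable (\<lambda>x. indicator (A \<inter> (\<Union>i<n. Q i)) x + indicator ((A - (\<Union>i<n. Q i)) \<inter> box a b) x)"
        by (intro L1_approximable_add Suc)
      moreover have "(\<lambda>x. indicator (A \<inter> (\<Union>i<n. Q i)) x + indicator ((A - (\<Union>i<n. Q i)) \<inter> box a b) x) =
         (indicator (A \<inter> (\<Union>i<Suc n. Q i)) :: _ \<Rightarrow> real)"
        by (auto simp: indicator_def fun_eq_iff ab lessThan_Suc)
      ultimately show ?case by simp
    qed
    have meas: "indicator A \<in> borel_measurable \<mu>" using A by simp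
    show ?thesis
    proof (rule L1_approximable_dominated[OF meas ap])
      show "integrable \<mu> (indicator A :: _ \<Rightarrow> real)" using A by (intro integrable_real_indicator) (auto simp: sets_eq_borel)
      show "AE x in \<mu>. (\<lambda>n. indicator (A \<inter> (\<Union>i<n. Q i)) x :: real) \<longlonglongrightarrow> indicator A x"
        using AE_in_domain
      proof eventually_elim
        case (elim x)
        then obtain i where i: "x \<in> Q i" using UQ by auto
        have "\<forall>\<^sub>F n in sequentially. indicator (A \<inter> (\<Union>i<n. Q i)) x = (indicator A x :: real)"
          using eventually_gt_at_top[of i] by eventually_elim (use i in \<open>auto simp: indicator_def\<close>)
        then show ?case by (rule tendsto_eventually)
      qed
      show "\<bar>indicator (A \<inter> (\<Union>i<n. Q i)) x :: real\<bar> \<le> indicator A x" for n x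
        by (auto simp: indicator_def)
    qed
  qed
qed

theorem test_functions_dense_L1:
  assumes "integrable \<mu> F"
  shows "L1_approximable F"
  using assms
proof (induction rule: integrable_induct)
  case (base A c)
  then have "L1_approximable (\<lambda>x. c * indicator A x)"
    by (intro L1_approximable_cmult L1_approximable_indicator) (auto simp: sets_eq_borel)
  then show ?case by (simp add: mult.commute)
next
  case (add f g)
  then show ?case by (intro L1_approximable_add)
next
  case (lim f s)
  then have f: "f \<in> borel_measurable \<mu>" by auto
  show ?case
  proof (rule L1_approximable_dominated[OF f])
    show "integrable \<mu> (\<lambda>x. 2 * \<bar>f x\<bar>)" using lim by simp
    show "L1_approximable (s n)" for n using lim by simp
    show "AE x in \<mu>. (\<lambda>n. s n x) \<longlonglongrightarrow> f x" by (rule AE_I2) (use lim in auto)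
    show "\<bar>s n x\<bar> \<le> 2 * \<bar>f x\<bar>" for n x using lim by auto
  qed
qed

lemma test_function_approximation:
  assumes "integrable \<mu> F" "e > 0"
  obtains u where "u \<in> test_functions \<Omega>" "(\<integral>x. \<bar>F x - u x\<bar> \<partial>\<mu>) < e"
  using L1_approximableD[OF test_functions_dense_L1[OF assms(1)] assms(2)] by blast

end

section \<open>Functionals dominated by an \<open>L\<^sup>1\<close> norm\<close>

text \<open>Such a weight replaces a sigma-finite measure by a finite one with the same null
  sets.\<close>

lemma (in sigma_finite_measure) exists_positive_integrable:
  "\<exists>p::'a \<Rightarrow> real. p \<in> borel_measurable M \<and> integrable M p \<and> (\<forall>x\<in>space M. 0 < p x)"
proof -
  obtain p0 where p0: "p0 \<in> borel_measurable M" "integral\<^sup>N M p0 \<noteq> \<infinity>" "\<And>x. x \<in> space M \<Longrightarrow> 0 < p0 x \<and> p0 x < \<infinity>"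
    using Ex_finite_integrable_function by auto
  define p where "p = (\<lambda>x. enn2real (p0 x))"
  have pp: "p x > 0" if "x \<in> space M" for x using p0(3)[OF that] by (simp add: p_def enn2real_positive_iff)
  have pm: "p \<in> borel_measurable M" unfolding p_def using p0(1) by measurable
  have "integrable M p"
  proof (rule integrableI_nonneg[OF pm])
    have "(\<integral>\<^sup>+x. ennreal (p x) \<partial>M) = integral\<^sup>N M p0"
      by (intro nn_integral_cong) (use p0(3) in \<open>simp add: p_def ennreal_enn2real\<close>)
    then show "(\<integral>\<^sup>+x. ennreal (p x) \<partial>M) < \<infinity>" using p0(2) by (simp add: less_top)
  qed (simp add: p_def)
  then show ?thesis using pm pp by blast
qed

lemma eq_if_abs_diff_le_epsilon: "(\<And>e. e > 0 \<Longrightarrow> \<bar>a - b\<bar> \<le> 0 + e) \<Longrightarrow> a = (b::real)"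
  using field_le_epsilon[of "\<bar>a - b\<bar>" 0] by simp

context locally_finite_measure_on
begin

text \<open>\<open>T\<close> is 1-Lipschitz for the \<open>L^1\<close> distance, and McShane's
  formula extends it without a choice of approximating sequences. Density of the test functions then
  forces the extension to be additive and homogeneous.\<close>

lemma bounded_functional_extension:
  assumes add: "\<And>u v. \<lbrakk>u \<in> test_functions \<Omega>; v \<in> test_functions \<Omega>\<rbrakk> \<Longrightarrow> T (\<lambda>x. u x + v x) = T u + (T v :: real)"
    and cmult: "\<And>c u. u \<in> test_functions \<Omega> \<Longrightarrow> T (\<lambda>x. c * u x) = c * T u"
    and bound: "\<And>u. u \<in> test_functions \<Omega> \<Longrightarrow> \<bar>T u\<bar> \<le> (\<integral>x. \<bar>u x\<bar> \<partial>\<mu>)"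
  obtains S :: "(real^'n \<Rightarrow> real) \<Rightarrow> real" where
    "\<And>F G. \<lbrakk>integrable \<mu> F; integrable \<mu> G\<rbrakk> \<Longrightarrow> S (\<lambda>x. F x + G x) = S F + S G"
    "\<And>c F. integrable \<mu> F \<Longrightarrow> S (\<lambda>x. c * F x) = c * S F"
    "\<And>F. integrable \<mu> F \<Longrightarrow> \<bar>S F\<bar> \<le> (\<integral>x. \<bar>F x\<bar> \<partial>\<mu>)"
    "\<And>u. u \<in> test_functions \<Omega> \<Longrightarrow> S u = T u"
proof -
  have diff: "T u - T v \<le> (\<integral>x. \<bar>u x - v x\<bar> \<partial>\<mu>)" if "u \<in> test_functions \<Omega>" "v \<in> test_functions \<Omega>" for u v
  proof -
    have "T (\<lambda>x. u x + (-1) * v x) = T u + (-1) * T v"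
      using that by (simp only: add cmult test_functions_cmult)
    then show ?thesis using bound[OF test_functions_diff[OF that]] by simp
  qed
  define S where "S = (\<lambda>F. SUP w\<in>test_functions \<Omega>. T w - (\<integral>x. \<bar>F x - w x\<bar> \<partial>\<mu>))"
  have S: "\<bar>S F - T w\<bar> \<le> (\<integral>x. \<bar>F x - w x\<bar> \<partial>\<mu>)" if F: "integrable \<mu> F" and w: "w \<in> test_functions \<Omega>" for F w
  proof -
    have le: "T v - (\<integral>x. \<bar>F x - v x\<bar> \<partial>\<mu>) \<le> T w + (\<integral>x. \<bar>F x - w x\<bar> \<partial>\<mu>)" if v: "v \<in> test_functions \<Omega>" for v
    proof -
      have "(\<integral>x. \<bar>v x - w x\<bar> \<partial>\<mu>) \<le> (\<integral>x. \<bar>v x - F x\<bar> \<partial>\<mu>) + (\<integral>x. \<bar>F x - w x\<bar> \<partial>\<mu>)"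
        using F integrable_test_function[OF v] integrable_test_function[OF w] by (intro L1_triangle)
      then show ?thesis using diff[OF v w] by (simp add: abs_minus_commute)
    qed
    have "bdd_above ((\<lambda>v. T v - (\<integral>x. \<bar>F x - v x\<bar> \<partial>\<mu>)) ` test_functions \<Omega>)"
      using le by (intro bdd_aboveI2)
    then have "T w - (\<integral>x. \<bar>F x - w x\<bar> \<partial>\<mu>) \<le> S F"
      unfolding S_def by (rule cSUP_upper[OF w])
    moreover have "S F \<le> T w + (\<integral>x. \<bar>F x - w x\<bar> \<partial>\<mu>)"
      unfolding S_def by (rule cSUP_least) (use w le in auto)
    ultimately show ?thesis by linarith
  qed
  show ?thesis
  proof (rule that[of S])
    fix F G :: "real^'n \<Rightarrow> real" assume F: "integrable \<mu> F" and G: "integrable \<mu> G"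
    have "\<bar>S (\<lambda>x. F x + G x) - (S F + S G)\<bar> \<le> 0 + e" if "e > 0" for e
    proof -
      have e: "e / 4 > 0" using that by simp
      obtain u where u: "u \<in> test_functions \<Omega>" "(\<integral>x. \<bar>F x - u x\<bar> \<partial>\<mu>) < e / 4"
        by (rule test_function_approximation[OF F e])
      obtain v where v: "v \<in> test_functions \<Omega>" "(\<integral>x. \<bar>G x - v x\<bar> \<partial>\<mu>) < e / 4"
        by (rule test_function_approximation[OF G e])
      note iu = integrable_test_function[OF u(1)] integrable_test_function[OF v(1)]
      have "(\<integral>x. \<bar>F x + G x - (u x + v x)\<bar> \<partial>\<mu>) \<le> (\<integral>x. \<bar>F x - u x\<bar> + \<bar>G x - v x\<bar> \<partial>\<mu>)"
        using F G iu by (intro integral_mono) auto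
      also have "\<dots> = (\<integral>x. \<bar>F x - u x\<bar> \<partial>\<mu>) + (\<integral>x. \<bar>G x - v x\<bar> \<partial>\<mu>)" using F G iu by simp
      finally show ?thesis
        using S[OF Bochner_Integration.integrable_add[OF F G] test_functions_add[OF u(1) v(1)]] S[OF F u(1)] S[OF G v(1)] u v
          add[OF u(1) v(1)] by linarith
    qed
    then show "S (\<lambda>x. F x + G x) = S F + S G" by (rule eq_if_abs_diff_le_epsilon)
  next
    fix c and F :: "real^'n \<Rightarrow> real" assume F: "integrable \<mu> F"
    have "\<bar>S (\<lambda>x. c * F x) - c * S F\<bar> \<le> 0 + e" if "e > 0" for e
    proof -
      have e: "e / (2 * (\<bar>c\<bar> + 1)) > 0" using that by simp
      obtain u where u: "u \<in> test_functions \<Omega>" "(\<integral>x. \<bar>F x - u x\<bar> \<partial>\<mu>) < e / (2 * (\<bar>c\<bar> + 1))"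
        by (rule test_function_approximation[OF F e])
      have eq: "(\<integral>x. \<bar>c * F x - c * u x\<bar> \<partial>\<mu>) = \<bar>c\<bar> * (\<integral>x. \<bar>F x - u x\<bar> \<partial>\<mu>)"
        by (simp add: right_diff_distrib[symmetric] abs_mult)
      have "\<bar>c\<bar> * (\<integral>x. \<bar>F x - u x\<bar> \<partial>\<mu>) \<le> \<bar>c\<bar> * (e / (2 * (\<bar>c\<bar> + 1)))"
        using u(2) by (intro mult_left_mono) auto
      also have "\<dots> \<le> e / 2" using \<open>e > 0\<close> by (simp add: field_simps)
      finally have small: "\<bar>c\<bar> * (\<integral>x. \<bar>F x - u x\<bar> \<partial>\<mu>) \<le> e / 2" .
      have "\<bar>c * T u - c * S F\<bar> = \<bar>c\<bar> * \<bar>S F - T u\<bar>"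
        by (metis abs_minus_commute abs_mult right_diff_distrib)
      also have "\<dots> \<le> \<bar>c\<bar> * (\<integral>x. \<bar>F x - u x\<bar> \<partial>\<mu>)" by (intro mult_left_mono S F u) auto
      finally have "\<bar>c * T u - c * S F\<bar> \<le> \<bar>c\<bar> * (\<integral>x. \<bar>F x - u x\<bar> \<partial>\<mu>)" .
      moreover have "\<bar>S (\<lambda>x. c * F x) - c * T u\<bar> \<le> \<bar>c\<bar> * (\<integral>x. \<bar>F x - u x\<bar> \<partial>\<mu>)"
        using S[OF integrable_mult_right[of c \<mu> F] test_functions_cmult[OF u(1), of c]] F
        by (simp add: eq cmult[OF u(1)])
      ultimately show ?thesis using small by linarith
    qed
    then show "S (\<lambda>x. c * F x) = c * S F" by (rule eq_if_abs_diff_le_epsilon)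
  next
    fix F :: "real^'n \<Rightarrow> real" assume F: "integrable \<mu> F"
    have "T (\<lambda>x. 0) = 0" using cmult[OF test_functions_0, of 0] by simp
    then show "\<bar>S F\<bar> \<le> (\<integral>x. \<bar>F x\<bar> \<partial>\<mu>)" using S[OF F test_functions_0] by simp
  next
    fix u assume "u \<in> test_functions \<Omega>"
    then show "S u = T u" using S[OF integrable_test_function, of u u] by simp
  qed
qed

text \<open>An instance of \<open>L\<^sup>\<infinity>\<close> being the dual of \<open>L\<^sup>1\<close>. The positive functional
  \<open>F \<mapsto> S F + \<integral>F d\<mu>\<close>, weighted with an integrable \<open>p > 0\<close>, is a finite measure, to which the
  Radon-Nikodym theorem applies.\<close>

lemma bounded_functional_density:
  fixes S :: "(real^'n \<Rightarrow> real) \<Rightarrow> real"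
  assumes sf: "sigma_finite_measure \<mu>"
    and add: "\<And>F G. \<lbrakk>integrable \<mu> F; integrable \<mu> G\<rbrakk> \<Longrightarrow> S (\<lambda>x. F x + G x) = S F + S G"
    and cmult: "\<And>c F. integrable \<mu> F \<Longrightarrow> S (\<lambda>x. c * F x) = c * S F"
    and bound: "\<And>F. integrable \<mu> F \<Longrightarrow> \<bar>S F\<bar> \<le> (\<integral>x. \<bar>F x\<bar> \<partial>\<mu>)"
  shows "\<exists>g\<in>borel_measurable borel. (\<forall>x. \<bar>g x\<bar> \<le> 1) \<and> (\<forall>F. integrable \<mu> F \<longrightarrow> S F = (\<integral>x. g x * F x \<partial>\<mu>))"
proof -
  interpret sigma_finite_measure \<mu> by fact
  obtain p :: "real^'n \<Rightarrow> real" where pm [measurable]: "p \<in> borel_measurable \<mu>" and pi: "integrable \<mu> p" and pp: "\<And>x. p x > 0"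
    using exists_positive_integrable by auto
  have pA: "integrable \<mu> (\<lambda>x. indicator A x * p x)" if "A \<in> sets borel" for A
    using that by (intro Bochner_Integration.integrable_bound[OF pi]) (auto simp: sets_eq_borel indicator_def)
  define \<Phi> where "\<Phi> = (\<lambda>F. S F + (\<integral>x. F x \<partial>\<mu>))"
  have \<Phi>_add: "\<Phi> (\<lambda>x. F x + G x) = \<Phi> F + \<Phi> G" if "integrable \<mu> F" "integrable \<mu> G" for F G
    using that by (simp add: \<Phi>_def add)
  have \<Phi>_bound: "\<bar>\<Phi> F\<bar> \<le> 2 * (\<integral>x. \<bar>F x\<bar> \<partial>\<mu>)" if "integrable \<mu> F" for F
    using bound[OF that] integral_abs_bound[of \<mu> F] abs_triangle_ineq[of "S F" "integral\<^sup>L \<mu> F"]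
    unfolding \<Phi>_def by linarith
  have \<Phi>_nonneg: "\<Phi> F \<ge> 0" if "integrable \<mu> F" "\<And>x. F x \<ge> 0" for F
    using bound[OF that(1)] that(2) by (simp add: \<Phi>_def)
  have \<Phi>_0: "\<Phi> (\<lambda>x. 0) = 0" using \<Phi>_bound[of "\<lambda>x. 0"] by simp
  have \<Phi>_sum: "\<Phi> (\<lambda>x. \<Sum>i<n. F i x) = (\<Sum>i<n. \<Phi> (F i))" if "\<And>i. integrable \<mu> (F i)" for F and n :: nat
    by (induction n) (use that in \<open>simp_all add: \<Phi>_0 \<Phi>_add\<close>)
  have \<Phi>_diff: "\<bar>\<Phi> F - \<Phi> G\<bar> \<le> 2 * (\<integral>x. \<bar>F x - G x\<bar> \<partial>\<mu>)" if "integrable \<mu> F" "integrable \<mu> G" for F G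
  proof -
    have "\<Phi> (\<lambda>x. G x + (F x - G x)) = \<Phi> G + \<Phi> (\<lambda>x. F x - G x)"
      using that by (intro \<Phi>_add) auto
    then show ?thesis using \<Phi>_bound[of "\<lambda>x. F x - G x"] that by simp
  qed
  \<comment> \<open>The weight keeps the argument of \<open>\<Phi>\<close> integrable for every
    Borel set, even one of infinite measure.\<close>
  define \<nu> where "\<nu> = (\<lambda>A. \<Phi> (\<lambda>x. indicator A x * p x))"
  have \<nu>_nonneg: "\<nu> A \<ge> 0" if "A \<in> sets borel" for A
    unfolding \<nu>_def using pA[OF that] by (intro \<Phi>_nonneg mult_nonneg_nonneg) (auto intro: less_imp_le[OF pp])
  have \<nu>_sums: "(\<lambda>i. \<nu> (A i)) sums \<nu> (\<Union>i. A i)" if A: "range A \<subseteq> sets borel" "disjoint_family A" for A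
  proof -
    have [measurable]: "A i \<in> sets borel" for i using A by auto
    define F where "F = (\<lambda>n x. \<Sum>i<n. indicator (A i) x * p x)"
    define F' where "F' = (\<lambda>x. indicator (\<Union>i. A i) x * p x)"
    have eq: "F n x = indicator (\<Union>i<n. A i) x * p x" for n x
    proof -
      have "disjoint_family_on A {..<n}" using A(2) by (auto simp: disjoint_family_on_def)
      from indicator_UN_disjoint[OF _ this, of x]
      have "indicator (\<Union>i<n. A i) x = (\<Sum>i<n. indicator (A i) x :: real)" by simp
      then show ?thesis unfolding F_def by (simp only: sum_distrib_right)
    qed
    have "(\<lambda>n. \<integral>x. \<bar>F n x - F' x\<bar> \<partial>\<mu>) \<longlonglongrightarrow> 0"
    proof (rule L1_dominated_convergence(3)[OF _ _ pi])
      show "F' \<in> borel_measurable \<mu>" unfolding F'_def by measurable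
      show "F n \<in> borel_measurable \<mu>" for n unfolding F_def by measurable
      show "AE x in \<mu>. \<bar>F n x\<bar> \<le> p x" for n
        unfolding eq using pp by (intro AE_I2) (auto simp: indicator_def intro: less_imp_le)
      show "AE x in \<mu>. (\<lambda>n. F n x) \<longlonglongrightarrow> F' x"
      proof (rule AE_I2)
        fix x
        show "(\<lambda>n. F n x) \<longlonglongrightarrow> F' x"
        proof (cases "x \<in> (\<Union>i. A i)")
          case True
          then obtain i where i: "x \<in> A i" by auto
          have "\<forall>\<^sub>F n in sequentially. F n x = F' x"
            using eventually_gt_at_top[of i] unfolding eq F'_def
            by eventually_elim (use i in \<open>auto simp: indicator_def\<close>)
          then show ?thesis by (rule tendsto_eventually)
        next
          case False
          then show ?thesis by (auto simp: eq F'_def indicator_def)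
        qed
      qed
    qed
    then have lim: "(\<lambda>n. 2 * (\<integral>x. \<bar>F n x - F' x\<bar> \<partial>\<mu>)) \<longlonglongrightarrow> 0" by (intro tendsto_mult_right_zero)
    have intF: "integrable \<mu> (F n)" "integrable \<mu> F'" for n
      unfolding F_def F'_def by (rule Bochner_Integration.integrable_sum, rule pA, simp) (rule pA, simp)
    have "(\<lambda>n. \<Phi> (F n)) \<longlonglongrightarrow> \<Phi> F'"
      by (rule Lim_null_comparison[OF _ lim, THEN LIM_zero_cancel])
         (auto intro!: always_eventually \<Phi>_diff intF)
    moreover have "\<Phi> (F n) = (\<Sum>i<n. \<nu> (A i))" for n
      unfolding F_def \<nu>_def by (intro \<Phi>_sum pA) auto
    ultimately show ?thesis by (simp add: sums_def F'_def \<nu>_def)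
  qed
  define N where "N = measure_of UNIV (sets borel) (\<lambda>A. ennreal (\<nu> A))"
  have setsN: "sets N = sets borel" unfolding N_def by (simp add: sets.sigma_sets_eq[of borel, simplified])
  have N: "emeasure N A = ennreal (\<nu> A)" if "A \<in> sets borel" for A
    unfolding N_def
  proof (rule emeasure_measure_of_sigma)
    show "sigma_algebra UNIV (sets (borel :: (real^'n) measure))" using sets.sigma_algebra_axioms[of "borel :: (real^'n) measure"] by simp
    show "positive (sets borel) (\<lambda>A. ennreal (\<nu> A))" by (simp add: positive_def \<nu>_def \<Phi>_0)
    show "countably_additive (sets borel) (\<lambda>A. ennreal (\<nu> A))"
    proof (rule countably_additiveI)
      fix A :: "nat \<Rightarrow> (real^'n) set" assume A: "range A \<subseteq> sets borel" "disjoint_family A"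
      have "(\<lambda>i. ennreal (\<nu> (A i))) sums ennreal (\<nu> (\<Union>i. A i))"
        using \<nu>_sums[OF A] A(1) by (subst sums_ennreal) (auto intro!: \<nu>_nonneg)
      then show "(\<Sum>i. ennreal (\<nu> (A i))) = ennreal (\<nu> (\<Union>i. A i))" by (rule sums_unique[symmetric])
    qed
  qed fact
  have "absolutely_continuous \<mu> N"
    unfolding absolutely_continuous_def
  proof
    fix A assume A: "A \<in> null_sets \<mu>"
    then have Ab: "A \<in> sets borel" by (auto simp: sets_eq_borel)
    have "(\<integral>x. \<bar>indicator A x * p x\<bar> \<partial>\<mu>) = 0"
      using AE_not_in[OF A] by (intro integral_eq_zero_AE) (auto elim!: eventually_mono)
    then have "\<nu> A = 0" using \<Phi>_bound[OF pA[OF Ab]] by (simp add: \<nu>_def)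
    then show "A \<in> null_sets N" using Ab by (auto simp: null_sets_def setsN N)
  qed
  from Radon_Nikodym[OF this] obtain q where q: "q \<in> borel_measurable \<mu>" "density \<mu> q = N"
    using setsN by (auto simp: sets_eq_borel)
  note [measurable] = q(1)
  have Nq: "ennreal (\<nu> A) = (\<integral>\<^sup>+x. q x * indicator A x \<partial>\<mu>)" if "A \<in> sets borel" for A
    using N[OF that] that unfolding q(2)[symmetric] by (subst (asm) emeasure_density) (auto simp: sets_eq_borel)
  define q' where "q' = (\<lambda>x. enn2real (q x))"
  have q'm [measurable]: "q' \<in> borel_measurable \<mu>" unfolding q'_def by measurable
  have "(\<integral>\<^sup>+x. q x \<partial>\<mu>) \<noteq> \<infinity>" using Nq[of UNIV, symmetric] by simp
  then have AEq: "AE x in \<mu>. q x \<noteq> \<infinity>" by (intro nn_integral_PInf_AE) auto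
  then have qq': "AE x in \<mu>. q x = ennreal (q' x)"
    by eventually_elim (auto simp: q'_def ennreal_enn2real_if)
  have q'0: "q' x \<ge> 0" for x by (simp add: q'_def)
  have q'A: "integrable \<mu> (\<lambda>x. indicator A x * q' x) \<and> (\<integral>x. indicator A x * q' x \<partial>\<mu>) = \<nu> A" if A: "A \<in> sets borel" for A
  proof -
    have [measurable]: "A \<in> sets borel" by fact
    have nn: "(\<integral>\<^sup>+x. ennreal (indicator A x * q' x) \<partial>\<mu>) = ennreal (\<nu> A)"
      unfolding Nq[OF A] using qq' by (intro nn_integral_cong_AE) (auto elim!: eventually_mono split: split_indicator)
    have "has_bochner_integral \<mu> (\<lambda>x. indicator A x * q' x) (\<nu> A)"
      by (rule has_bochner_integral_nn_integral[OF _ _ \<nu>_nonneg[OF A] nn]) (auto simp: q'0)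
    then show ?thesis by (auto simp: has_bochner_integral_iff)
  qed
  \<comment> \<open>\<open>q'\<close> is the density of \<open>\<nu>\<close>. Since
    \<open>\<Phi>\<close> is bounded by twice the \<open>L^1\<close> norm, \<open>\<nu> B\<close> is
    at most twice the integral of \<open>p\<close> over \<open>B\<close>; for \<open>B\<close> the
    set where the claim fails, this makes \<open>B\<close> null.\<close>
  have q'le: "AE x in \<mu>. q' x \<le> 2 * p x"
  proof -
    define B where "B = {x. q' x > 2 * p x}"
    have B [measurable]: "B \<in> sets borel"
    proof -
      have "{x\<in>space \<mu>. q' x > 2 * p x} \<in> sets \<mu>" by measurable
      then show ?thesis by (simp add: B_def sets_eq_borel)
    qed
    let ?d = "\<lambda>x. indicator B x * q' x - 2 * (indicator B x * p x)"
    have d0: "?d x \<ge> 0" for x by (auto simp: B_def indicator_def)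
    have di: "integrable \<mu> ?d" using q'A[OF B] pA[OF B] by auto
    have "\<nu> B \<le> 2 * (\<integral>x. indicator B x * p x \<partial>\<mu>)"
      using \<Phi>_bound[OF pA[OF B]] pp by (simp add: \<nu>_def abs_mult less_imp_le)
    then have "(\<integral>x. ?d x \<partial>\<mu>) \<le> 0" using q'A[OF B] pA[OF B] by simp
    then have "(\<integral>x. ?d x \<partial>\<mu>) = 0" by (rule antisym) (rule Bochner_Integration.integral_nonneg, rule d0)
    then have "AE x in \<mu>. ?d x = 0" using integral_nonneg_eq_0_iff_AE[OF di] d0 by auto
    then show ?thesis by eventually_elim (auto simp: B_def indicator_def split: if_splits)
  qed
  \<comment> \<open>If \<open>S\<close> has the density \<open>g\<close>, then \<open>\<Phi>\<close>
    has \<open>g + 1\<close> and \<open>\<nu>\<close> has \<open>(g + 1) * p\<close>; solving for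
    \<open>g\<close> gives the quotient. Clipping makes the bound by 1 hold at every point.\<close>
  define g where "g = (\<lambda>x. max (-1) (min 1 (q' x / p x - 1)))"
  have gm [measurable]: "g \<in> borel_measurable borel"
  proof -
    have "g \<in> borel_measurable \<mu>" unfolding g_def by measurable
    then show ?thesis by (simp add: measurable_cong_sets[OF sets_eq_borel])
  qed
  have g1: "\<bar>g x\<bar> \<le> 1" for x by (auto simp: g_def abs_le_iff)
  have gi: "integrable \<mu> (\<lambda>x. g x * F x)" if "integrable \<mu> F" for F
    using that g1 mult_right_mono[OF g1 abs_ge_zero]
    by (intro Bochner_Integration.integrable_bound[OF that]) (auto simp: abs_mult)
  have gq: "AE x in \<mu>. q' x = (g x + 1) * p x"
    using q'le
  proof eventually_elim
    case (elim x)
    then have "q' x / p x \<le> 2" using pp[of x] by (simp add: field_simps)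
    moreover have "0 \<le> q' x / p x" using pp[of x] q'0[of x] by (simp add: less_imp_le)
    ultimately have "g x = q' x / p x - 1" by (simp add: g_def)
    then show ?case using pp[of x] by (simp add: field_simps)
  qed
  \<comment> \<open>\<open>R\<close> measures the failure of the representation. It is continuous in
    \<open>L^1\<close> and vanishes on \<open>indicator A * p\<close> for all Borel
    \<open>A\<close>, hence on \<open>p * G\<close> whenever \<open>G\<close> is integrable for
    \<open>p d\<mu>\<close>; every integrable \<open>F\<close> has this form with
    \<open>G = F / p\<close>.\<close>
  define R where "R = (\<lambda>F. S F - (\<integral>x. g x * F x \<partial>\<mu>))"
  have R_add: "R (\<lambda>x. F x + G x) = R F + R G" if "integrable \<mu> F" "integrable \<mu> G" for F G
    using that gi by (simp add: R_def add distrib_left)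
  have R_cmult: "R (\<lambda>x. c * F x) = c * R F" if "integrable \<mu> F" for c F
    using that by (simp add: R_def cmult right_diff_distrib mult.left_commute[of _ c])
  have R_bound: "\<bar>R F\<bar> \<le> 2 * (\<integral>x. \<bar>F x\<bar> \<partial>\<mu>)" if "integrable \<mu> F" for F
  proof -
    have "\<bar>\<integral>x. g x * F x \<partial>\<mu>\<bar> \<le> (\<integral>x. \<bar>g x * F x\<bar> \<partial>\<mu>)" by (rule integral_abs_bound)
    also have "\<dots> \<le> (\<integral>x. \<bar>F x\<bar> \<partial>\<mu>)"
      by (rule integral_mono[OF integrable_abs[OF gi[OF that]] integrable_abs[OF that]])
         (use mult_right_mono[OF g1 abs_ge_zero] in \<open>auto simp: abs_mult\<close>)
    finally show ?thesis using bound[OF that] by (simp add: R_def)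
  qed
  have R_A: "R (\<lambda>x. indicator A x * p x) = 0" if A: "A \<in> sets borel" for A
  proof -
    have [measurable]: "A \<in> sets borel" by fact
    have "\<nu> A = (\<integral>x. indicator A x * q' x \<partial>\<mu>)" using q'A[OF A] by simp
    also have "\<dots> = (\<integral>x. g x * (indicator A x * p x) + indicator A x * p x \<partial>\<mu>)"
      by (rule integral_cong_AE, measurable) (use gq in \<open>eventually_elim, simp add: algebra_simps\<close>)
    also have "\<dots> = (\<integral>x. g x * (indicator A x * p x) \<partial>\<mu>) + (\<integral>x. indicator A x * p x \<partial>\<mu>)"
      by (rule Bochner_Integration.integral_add[OF gi[OF pA[OF A]] pA[OF A]])
    finally show ?thesis by (simp add: R_def \<nu>_def \<Phi>_def)
  qed
  define M' where "M' = density \<mu> (\<lambda>x. ennreal (p x))"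
  have M'i: "integrable M' G \<longleftrightarrow> integrable \<mu> (\<lambda>x. p x * G x)" if "G \<in> borel_measurable \<mu>" for G :: "real^'n \<Rightarrow> real"
    unfolding M'_def using integrable_density[OF that pm] pp by (auto simp: less_imp_le)
  have M'm: "borel_measurable M' = borel_measurable \<mu>" by (rule measurable_cong_sets) (simp_all add: M'_def)
  have M'D: "integrable \<mu> (\<lambda>x. p x * H x)" if "integrable M' H" for H
  proof -
    have "H \<in> borel_measurable \<mu>" using borel_measurable_integrable[OF that] unfolding M'm .
    then show ?thesis using M'i that by simp
  qed
  have R0: "R (\<lambda>x. p x * G x) = 0" if "integrable M' G" for G
    using that
  proof (induction rule: integrable_induct)
    case (base A c)
    then have "A \<in> sets borel" by (simp add: M'_def sets_eq_borel)
    then show ?case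
      using R_cmult[OF pA, of A c] R_A[of A] by (simp add: mult_ac)
  next
    case (add F G)
    then have "integrable \<mu> (\<lambda>x. p x * F x)" "integrable \<mu> (\<lambda>x. p x * G x)"
      by (auto intro: M'D)
    then show ?case using add R_add by (simp add: distrib_left)
  next
    case (lim G s)
    have int: "integrable \<mu> (\<lambda>x. p x * G x)" "integrable \<mu> (\<lambda>x. p x * s n x)" for n
      by (rule M'D, fact lim)+
    have "(\<lambda>n. \<integral>x. \<bar>p x * s n x - p x * G x\<bar> \<partial>\<mu>) \<longlonglongrightarrow> 0"
    proof (rule L1_dominated_convergence(3))
      show "integrable \<mu> (\<lambda>x. 2 * \<bar>p x * G x\<bar>)" using int by auto
      show "AE x in \<mu>. (\<lambda>n. p x * s n x) \<longlonglongrightarrow> p x * G x"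
        by (rule AE_I2) (use lim in \<open>auto intro!: tendsto_intros simp: M'_def\<close>)
      show "AE x in \<mu>. \<bar>p x * s n x\<bar> \<le> 2 * \<bar>p x * G x\<bar>" for n
      proof (rule AE_I2)
        fix x
        have "\<bar>s n x\<bar> \<le> 2 * \<bar>G x\<bar>" using lim by (simp add: M'_def)
        from mult_left_mono[OF this, of "p x"] show "\<bar>p x * s n x\<bar> \<le> 2 * \<bar>p x * G x\<bar>"
          using pp[of x] by (simp add: abs_mult)
      qed
    qed (use int in auto)
    then have l0: "(\<lambda>n. 2 * (\<integral>x. \<bar>p x * G x - p x * s n x\<bar> \<partial>\<mu>)) \<longlonglongrightarrow> 0"
      by (intro tendsto_mult_right_zero) (simp add: abs_minus_commute)
    have "\<bar>R (\<lambda>x. p x * G x)\<bar> \<le> 2 * (\<integral>x. \<bar>p x * G x - p x * s n x\<bar> \<partial>\<mu>)" for n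
    proof -
      have "R (\<lambda>x. p x * s n x + (p x * G x - p x * s n x)) = R (\<lambda>x. p x * s n x) + R (\<lambda>x. p x * G x - p x * s n x)"
        using int by (intro R_add) auto
      then show ?thesis using R_bound[of "\<lambda>x. p x * G x - p x * s n x"] int lim by simp
    qed
    then have "\<bar>R (\<lambda>x. p x * G x)\<bar> \<le> 0" by (intro tendsto_lowerbound[OF l0]) auto
    then show ?case by simp
  qed
  have "S F = (\<integral>x. g x * F x \<partial>\<mu>)" if F: "integrable \<mu> F" for F
  proof -
    have [measurable]: "F \<in> borel_measurable \<mu>" using F by auto
    have eq: "(\<lambda>x. p x * (F x / p x)) = F" using pp by (auto simp: fun_eq_iff) (metis less_irrefl)
    have "integrable M' (\<lambda>x. F x / p x)" using F by (subst M'i) (simp, unfold eq)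
    from R0[OF this] show ?thesis unfolding eq by (simp add: R_def)
  qed
  then show ?thesis using gm g1 by blast
qed

end

section \<open>Integral curves of Lipschitz fields\<close>

lemma norm_diff_le_vector_derivative:
  fixes f :: "real \<Rightarrow> 'a::real_normed_vector"
  assumes f: "\<And>t. t \<in> {a..b} \<Longrightarrow> (f has_vector_derivative f' t) (at t within {a..b})"
    and bd: "\<And>t. t \<in> {a..b} \<Longrightarrow> norm (f' t) \<le> C" and st: "s \<in> {a..b}" "t \<in> {a..b}"
  shows "norm (f s - f t) \<le> C * \<bar>s - t\<bar>"
proof -
  have "norm (f s - f t) \<le> C * norm (s - t)"
  proof (rule differentiable_bound[OF _ f[unfolded has_vector_derivative_def]])
    show "onorm (\<lambda>h. h *\<^sub>R f' u) \<le> C" if u: "u \<in> {a..b}" for u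
    proof (rule onorm_bound)
      show "0 \<le> C" using bd[OF u] norm_ge_zero order_trans by blast
      show "norm (h *\<^sub>R f' u) \<le> C * norm h" for h
        using mult_right_mono[OF bd[OF u], of "\<bar>h\<bar>"] by (simp add: mult.commute)
    qed
  qed (use st in auto)
  then show ?thesis by simp
qed

text \<open>A short-time substitute for Gronwall's inequality: the maximal distance \<open>m\<close>
  satisfies \<open>m \<le> norm (\<gamma> 0 - \<eta> 0) + L * r * m\<close>, and
  \<open>L * r \<le> 1/2\<close> gives \<open>m \<le> 2 * norm (\<gamma> 0 - \<eta> 0)\<close>.
  Inserting this once more produces a factor \<open>1 + O(t)\<close>, the form in which the
  distortion estimate needs it.\<close>

lemma integral_curve_dependence:
  fixes \<gamma> \<eta> :: "real \<Rightarrow> 'a::real_normed_vector"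
  assumes lip: "L-lipschitz_on S Y" and ab: "a \<le> 0" "0 \<le> b" "- r \<le> a" "b \<le> r" and r: "L * r \<le> 1/2"
    and \<gamma>: "\<And>t. t \<in> {a..b} \<Longrightarrow> \<gamma> t \<in> S \<and> (\<gamma> has_vector_derivative Y (\<gamma> t)) (at t within {a..b})"
    and \<eta>: "\<And>t. t \<in> {a..b} \<Longrightarrow> \<eta> t \<in> S \<and> (\<eta> has_vector_derivative Y (\<eta> t)) (at t within {a..b})"
    and t: "t \<in> {a..b}"
  shows "norm (\<gamma> t - \<eta> t) \<le> (1 + 2 * L * \<bar>t\<bar>) * norm (\<gamma> 0 - \<eta> 0)"
proof -
  have L: "L \<ge> 0" using lip by (rule lipschitz_on_nonneg)
  let ?\<delta> = "\<lambda>t. \<gamma> t - \<eta> t"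
  have der: "(?\<delta> has_vector_derivative Y (\<gamma> t) - Y (\<eta> t)) (at t within {a..b})" if "t \<in> {a..b}" for t
    using \<gamma>[OF that] \<eta>[OF that] by (intro has_vector_derivative_diff) auto
  have "continuous_on {a..b} (\<lambda>t. norm (?\<delta> t))"
    by (intro continuous_on_norm continuous_on_vector_derivative[OF der])
  then obtain s where s: "s \<in> {a..b}" "\<And>t. t \<in> {a..b} \<Longrightarrow> norm (?\<delta> t) \<le> norm (?\<delta> s)"
    using continuous_attains_sup[of "{a..b}" "\<lambda>t. norm (?\<delta> t)"] ab by auto
  define m where "m = norm (?\<delta> s)"
  have Lm: "norm (Y (\<gamma> t) - Y (\<eta> t)) \<le> L * m" if "t \<in> {a..b}" for t
  proof -
    have "norm (Y (\<gamma> t) - Y (\<eta> t)) \<le> L * norm (?\<delta> t)"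
      using \<gamma>[OF that] \<eta>[OF that] by (intro lipschitz_on_normD[OF lip]) auto
    also have "\<dots> \<le> L * m" using s(2)[OF that] L by (simp add: m_def mult_left_mono)
    finally show ?thesis .
  qed
  have est: "norm (?\<delta> u) \<le> norm (?\<delta> 0) + L * m * \<bar>u\<bar>" if "u \<in> {a..b}" for u
  proof -
    have "norm (?\<delta> u - ?\<delta> 0) \<le> L * m * \<bar>u - 0\<bar>"
      by (rule norm_diff_le_vector_derivative[OF der Lm that]) (use ab in auto)
    then show ?thesis using norm_triangle_sub[of "?\<delta> u" "?\<delta> 0"] by simp
  qed
  have "L * m * \<bar>s\<bar> \<le> L * m * r"
    using s(1) ab L by (intro mult_left_mono) (auto simp: m_def)
  also have "\<dots> = (L * r) * m" by simp
  also have "\<dots> \<le> (1/2) * m" using r by (intro mult_right_mono) (auto simp: m_def)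
  finally have "m \<le> 2 * norm (?\<delta> 0)" using est[OF s(1)] by (simp add: m_def)
  then have "L * m * \<bar>t\<bar> \<le> L * (2 * norm (?\<delta> 0)) * \<bar>t\<bar>"
    using L by (intro mult_right_mono mult_left_mono) auto
  then show ?thesis using est[OF t] by (simp add: algebra_simps)
qed

text \<open>Picard iteration on the bounded continuous functions, the time being clamped to \<open>[-\<tau>, \<tau>]\<close>.\<close>

lemma exists_integral_curve:
  fixes Y :: "'a::euclidean_space \<Rightarrow> 'a"
  assumes lip: "L-lipschitz_on UNIV Y" and \<tau>: "\<tau> > 0" "L * \<tau> \<le> 1/2"
  shows "\<exists>\<gamma>. \<gamma> 0 = x \<and> (\<forall>t. \<gamma> t = \<gamma> (max (- \<tau>) (min \<tau> t))) \<and>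
    (\<forall>t\<in>{-\<tau>..\<tau>}. (\<gamma> has_vector_derivative Y (\<gamma> t)) (at t within {-\<tau>..\<tau>}))"
proof -
  have L: "L \<ge> 0" using lip by (rule lipschitz_on_nonneg)
  have contY: "continuous_on UNIV Y" using lip by (rule lipschitz_on_continuous_on)
  \<comment> \<open>The signed integral of \<open>g\<close> from 0 to \<open>t\<close>;
    \<open>integral {0..t} g\<close> would be 0 for \<open>t < 0\<close>.\<close>
  define J where "J = (\<lambda>g t. integral {-\<tau>..t} g - integral {-\<tau>..0} (g :: real \<Rightarrow> 'a))"
  have J: "(J g has_vector_derivative g t) (at t within {-\<tau>..\<tau>})" if "continuous_on {-\<tau>..\<tau>} g" "t \<in> {-\<tau>..\<tau>}" for g t
    unfolding J_def using integral_has_vector_derivative[OF that] by (auto intro!: derivative_eq_intros)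
  have J0: "J g 0 = 0" for g by (simp add: J_def)
  define cl where "cl = (\<lambda>t. max (- \<tau>) (min \<tau> t))"
  have cl: "cl t \<in> {-\<tau>..\<tau>}" for t using \<tau> by (auto simp: cl_def)
  have cl_id: "cl t = t" if "t \<in> {-\<tau>..\<tau>}" for t using that by (auto simp: cl_def)
  have cont_cl: "continuous_on UNIV cl" unfolding cl_def by (intro continuous_intros)
  have contYg: "continuous_on {-\<tau>..\<tau>} (\<lambda>s. Y (apply_bcontfun \<gamma> s))" for \<gamma> :: "real \<Rightarrow>\<^sub>C 'a"
    by (intro continuous_on_compose2[OF contY]) auto
  define P where "P = (\<lambda>\<gamma> t. x + J (\<lambda>s. Y (apply_bcontfun \<gamma> s)) (cl t))"
  have contJ: "continuous_on {-\<tau>..\<tau>} (J (\<lambda>s. Y (apply_bcontfun \<gamma> s)))" for \<gamma> :: "real \<Rightarrow>\<^sub>C 'a"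
    by (rule continuous_on_vector_derivative[OF J[OF contYg]])
  have P: "P \<gamma> \<in> bcontfun" for \<gamma> :: "real \<Rightarrow>\<^sub>C 'a"
  proof -
    have "compact (J (\<lambda>s. Y (apply_bcontfun \<gamma> s)) ` {-\<tau>..\<tau>})"
      by (intro compact_continuous_image contJ) auto
    then obtain B where B: "\<And>t. t \<in> {-\<tau>..\<tau>} \<Longrightarrow> norm (J (\<lambda>s. Y (apply_bcontfun \<gamma> s)) t) \<le> B"
      using compact_imp_bounded by (fastforce simp: bounded_iff)
    show ?thesis
    proof (rule bcontfun_normI)
      show "continuous_on UNIV (P \<gamma>)" unfolding P_def
        by (intro continuous_intros continuous_on_compose2[OF contJ cont_cl]) (use cl in auto)
      show "norm (P \<gamma> t) \<le> norm x + B" for t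
        unfolding P_def by (intro norm_triangle_le add_left_mono B cl)
    qed
  qed
  define Q where "Q = (\<lambda>\<gamma>. Bcontfun (P \<gamma>))"
  have Q: "apply_bcontfun (Q \<gamma>) t = P \<gamma> t" for \<gamma> t by (simp add: Q_def Bcontfun_inverse[OF P])
  \<comment> \<open>Over a time span of length at most \<open>\<tau>\<close> the iteration contracts
    by the factor \<open>L * \<tau> \<le> 1/2\<close>.\<close>
  have contr: "dist (Q \<gamma>) (Q \<eta>) \<le> (1/2) * dist \<gamma> \<eta>" for \<gamma> \<eta>
  proof (rule dist_bound)
    fix t
    let ?D = "\<lambda>t. J (\<lambda>s. Y (apply_bcontfun \<gamma> s)) t - J (\<lambda>s. Y (apply_bcontfun \<eta> s)) t"
    have "norm (?D (cl t) - ?D 0) \<le> (L * dist \<gamma> \<eta>) * \<bar>cl t - 0\<bar>"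
    proof (rule norm_diff_le_vector_derivative)
      show "(?D has_vector_derivative (Y (apply_bcontfun \<gamma> s) - Y (apply_bcontfun \<eta> s))) (at s within {-\<tau>..\<tau>})"
        if "s \<in> {-\<tau>..\<tau>}" for s
        by (intro has_vector_derivative_diff J contYg that)
      show "norm (Y (apply_bcontfun \<gamma> s) - Y (apply_bcontfun \<eta> s)) \<le> L * dist \<gamma> \<eta>" for s
      proof -
        have "norm (Y (apply_bcontfun \<gamma> s) - Y (apply_bcontfun \<eta> s)) \<le> L * dist (apply_bcontfun \<gamma> s) (apply_bcontfun \<eta> s)"
          using lipschitz_onD[OF lip] by (simp add: dist_norm)
        also have "\<dots> \<le> L * dist \<gamma> \<eta>" by (intro mult_left_mono dist_bounded L)
        finally show ?thesis .
      qed
    qed (use cl[of t] \<tau> in auto)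
    also have "\<dots> \<le> (L * dist \<gamma> \<eta>) * \<tau>"
      using cl[of t] L by (intro mult_left_mono) auto
    also have "\<dots> = (L * \<tau>) * dist \<gamma> \<eta>" by simp
    also have "\<dots> \<le> (1/2) * dist \<gamma> \<eta>" using \<tau>(2) by (rule mult_right_mono) simp
    finally show "dist (apply_bcontfun (Q \<gamma>) t) (apply_bcontfun (Q \<eta>) t) \<le> (1/2) * dist \<gamma> \<eta>"
      by (simp add: Q P_def dist_norm J0)
  qed
  then obtain \<Gamma> where \<Gamma>: "Q \<Gamma> = \<Gamma>"
    using banach_fix_type[of "1/2" Q] by auto
  define \<gamma> where "\<gamma> = apply_bcontfun \<Gamma>"
  have eq: "\<gamma> t = x + J (\<lambda>s. Y (\<gamma> s)) (cl t)" for t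
    using Q[of \<Gamma> t] unfolding \<Gamma> by (simp add: \<gamma>_def P_def)
  show ?thesis
  proof (intro exI[of _ \<gamma>] conjI allI ballI)
    show "\<gamma> 0 = x" using \<tau> eq[of 0] cl_id[of 0] by (simp add: J0)
    show "\<gamma> t = \<gamma> (max (- \<tau>) (min \<tau> t))" for t
    proof -
      have "\<gamma> t = \<gamma> (cl t)" using eq[of t] eq[of "cl t"] cl_id[OF cl[of t]] by simp
      then show ?thesis unfolding cl_def .
    qed
    fix t assume t: "t \<in> {-\<tau>..\<tau>}"
    have "((\<lambda>t. x + J (\<lambda>s. Y (\<gamma> s)) t) has_vector_derivative Y (\<gamma> t)) (at t within {-\<tau>..\<tau>})"
      unfolding \<gamma>_def by (auto intro!: derivative_eq_intros J contYg t)
    then show "(\<gamma> has_vector_derivative Y (\<gamma> t)) (at t within {-\<tau>..\<tau>})"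
    proof (rule has_vector_derivative_transform[OF t, rotated])
      fix s assume "s \<in> {-\<tau>..\<tau>}"
      then show "\<gamma> s = x + J (\<lambda>s. Y (\<gamma> s)) s" using eq[of s] by (simp only: cl_id)
    qed
  qed
qed

text \<open>Only times in \<open>[-\<tau>, \<tau>]\<close> matter. Clamping makes
  \<open>\<phi>\<close> continuous on the whole product, so measurability and Fubini's theorem apply
  without restricting a domain. \<open>L\<close>, \<open>M\<close> and \<open>\<tau>\<close> are
  explicit because all later constants are built from them.\<close>

locale local_flow =
  fixes Y :: "real^'n \<Rightarrow> real^'n" and L M \<tau> :: real and \<phi> :: "real \<Rightarrow> real^'n \<Rightarrow> real^'n"
  assumes lip: "L-lipschitz_on UNIV Y" and bounded: "\<And>x. norm (Y x) \<le> M"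
    and \<tau>_pos: "\<tau> > 0" and \<tau>_small: "L * \<tau> \<le> 1/2"
    and \<phi>_0: "\<And>x. \<phi> 0 x = x" and \<phi>_clamp: "\<And>t x. \<phi> t x = \<phi> (max (- \<tau>) (min \<tau> t)) x"
    and \<phi>_deriv: "\<And>t x. t \<in> {-\<tau>..\<tau>} \<Longrightarrow> ((\<lambda>t. \<phi> t x) has_vector_derivative Y (\<phi> t x)) (at t within {-\<tau>..\<tau>})"
begin

lemma L_nonneg: "L \<ge> 0" using lip by (rule lipschitz_on_nonneg)

lemma M_nonneg: "M \<ge> 0" using bounded norm_ge_zero order_trans by blast

lemma \<phi>_time_lipschitz:
  assumes "t \<in> {-\<tau>..\<tau>}" "s \<in> {-\<tau>..\<tau>}"
  shows "norm (\<phi> t x - \<phi> s x) \<le> M * \<bar>t - s\<bar>"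
  by (rule norm_diff_le_vector_derivative[OF \<phi>_deriv bounded assms])

lemma \<phi>_lipschitz:
  assumes "t \<in> {-\<tau>..\<tau>}"
  shows "(1 + 2 * L * \<bar>t\<bar>)-lipschitz_on UNIV (\<phi> t)"
proof (rule lipschitz_onI)
  fix x y
  have "norm (\<phi> t x - \<phi> t y) \<le> (1 + 2 * L * \<bar>t\<bar>) * norm (\<phi> 0 x - \<phi> 0 y)"
    using assms \<phi>_deriv \<tau>_pos by (intro integral_curve_dependence[OF lip _ _ _ _ \<tau>_small, of "- \<tau>" \<tau>]) auto
  then show "dist (\<phi> t x) (\<phi> t y) \<le> (1 + 2 * L * \<bar>t\<bar>) * dist x y" by (simp add: dist_norm \<phi>_0)
qed (use L_nonneg in auto)

text \<open>Both \<open>\<lambda>s. \<phi> (t + s) x\<close> and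
  \<open>\<lambda>s. \<phi> s (\<phi> t x)\<close> solve the autonomous equation and start at
  \<open>\<phi> t x\<close>, so the dependence estimate with initial distance 0 makes them equal at
  \<open>s = - t\<close>.\<close>

lemma \<phi>_inverse:
  assumes t: "t \<in> {-\<tau>..\<tau>}"
  shows "\<phi> (- t) (\<phi> t x) = x"
proof -
  \<comment> \<open>On the interval between 0 and \<open>- t\<close> both \<open>s\<close> and
    \<open>t + s\<close> stay in the range where the equation holds.\<close>
  define a where "a = min 0 (- t)"
  define b where "b = max 0 (- t)"
  have sub: "s \<in> {-\<tau>..\<tau>}" "t + s \<in> {-\<tau>..\<tau>}" if "s \<in> {a..b}" for s
    using that t \<tau>_pos by (auto simp: a_def b_def min_def max_def split: if_splits)
  have "norm (\<phi> (t + (- t)) x - \<phi> (- t) (\<phi> t x)) \<le> (1 + 2 * L * \<bar>- t\<bar>) * norm (\<phi> (t + 0) x - \<phi> 0 (\<phi> t x))"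
  proof (rule integral_curve_dependence[OF lip _ _ _ _ \<tau>_small, of a b])
    fix s assume s: "s \<in> {a..b}"
    have "((\<lambda>u. \<phi> u x) \<circ> (\<lambda>s. t + s) has_vector_derivative 1 *\<^sub>R Y (\<phi> (t + s) x)) (at s within {a..b})"
    proof (rule vector_diff_chain_within)
      show "((\<lambda>s. t + s) has_vector_derivative 1) (at s within {a..b})" by (auto intro!: derivative_eq_intros)
      show "((\<lambda>u. \<phi> u x) has_vector_derivative Y (\<phi> (t + s) x)) (at (t + s) within (\<lambda>s. t + s) ` {a..b})"
      proof (rule has_vector_derivative_within_subset[OF \<phi>_deriv])
        show "t + s \<in> {-\<tau>..\<tau>}" using sub(2)[OF s] .
        show "(\<lambda>s. t + s) ` {a..b} \<subseteq> {-\<tau>..\<tau>}" using sub(2) by blast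
      qed
    qed
    then show "\<phi> (t + s) x \<in> UNIV \<and> ((\<lambda>s. \<phi> (t + s) x) has_vector_derivative Y (\<phi> (t + s) x)) (at s within {a..b})"
      by (simp add: o_def)
    have "((\<lambda>s. \<phi> s (\<phi> t x)) has_vector_derivative Y (\<phi> s (\<phi> t x))) (at s within {a..b})"
    proof (rule has_vector_derivative_within_subset[OF \<phi>_deriv])
      show "s \<in> {-\<tau>..\<tau>}" using sub(1)[OF s] .
      show "{a..b} \<subseteq> {-\<tau>..\<tau>}" using sub(1) by blast
    qed
    then show "\<phi> s (\<phi> t x) \<in> UNIV \<and> ((\<lambda>s. \<phi> s (\<phi> t x)) has_vector_derivative Y (\<phi> s (\<phi> t x))) (at s within {a..b})"
      by simp
  qed (use t \<tau>_pos in \<open>auto simp: a_def b_def\<close>)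
  then show ?thesis by (simp add: \<phi>_0)
qed

lemma \<phi>_displacement:
  assumes "t \<in> {-\<tau>..\<tau>}"
  shows "norm (\<phi> t x - x) \<le> M * \<bar>t\<bar>"
  using \<phi>_time_lipschitz[OF assms, of 0 x] \<tau>_pos by (simp add: \<phi>_0)

lemma \<phi>_continuous: "continuous_on UNIV (\<lambda>(t, x). \<phi> t x)"
proof -
  define cl where "cl = (\<lambda>t. max (- \<tau>) (min \<tau> t))"
  have cl: "cl t \<in> {-\<tau>..\<tau>}" "\<bar>cl t - cl s\<bar> \<le> \<bar>t - s\<bar>" for t s using \<tau>_pos by (auto simp: cl_def)
  \<comment> \<open>The factor 2 bounds the Lipschitz constant \<open>1 + 2 * L * \<tau>\<close> in
    space.\<close>
  have est: "dist (\<phi> t x) (\<phi> s y) \<le> M * \<bar>t - s\<bar> + 2 * dist x y" for t s x y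
  proof -
    have "dist (\<phi> t x) (\<phi> s x) \<le> M * \<bar>cl t - cl s\<bar>"
      using \<phi>_time_lipschitz[OF cl(1)[of t] cl(1)[of s], of x] \<phi>_clamp[of t x] \<phi>_clamp[of s x]
      by (simp add: cl_def dist_norm)
    also have "\<dots> \<le> M * \<bar>t - s\<bar>" by (intro mult_left_mono cl M_nonneg)
    finally have 1: "dist (\<phi> t x) (\<phi> s x) \<le> M * \<bar>t - s\<bar>" .
    have "dist (\<phi> s x) (\<phi> s y) \<le> (1 + 2 * L * \<bar>cl s\<bar>) * dist x y"
      using lipschitz_onD[OF \<phi>_lipschitz[OF cl(1)[of s]], of x y] \<phi>_clamp[of s x] \<phi>_clamp[of s y]
      by (simp add: cl_def)
    also have "\<dots> \<le> 2 * dist x y"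
    proof (rule mult_right_mono)
      have "L * \<bar>cl s\<bar> \<le> L * \<tau>" using cl(1)[of s] L_nonneg by (intro mult_left_mono) auto
      then show "1 + 2 * L * \<bar>cl s\<bar> \<le> 2" using \<tau>_small by simp
    qed simp
    finally show ?thesis using 1 dist_triangle[of "\<phi> t x" "\<phi> s y" "\<phi> s x"] by linarith
  qed
  show ?thesis
    unfolding continuous_on_def
  proof safe
    fix t :: real and x :: "real^'n"
    have "((\<lambda>p. M * \<bar>t - fst p\<bar> + 2 * dist x (snd p)) \<longlongrightarrow> M * \<bar>t - fst (t, x)\<bar> + 2 * dist x (snd (t, x))) (at (t, x))"
      by (intro tendsto_intros)
    then have lim: "((\<lambda>p. M * \<bar>t - fst p\<bar> + 2 * dist x (snd p)) \<longlongrightarrow> 0) (at (t, x))" by simp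
    show "((\<lambda>(t, x). \<phi> t x) \<longlongrightarrow> \<phi> t x) (at (t, x))"
      by (rule metric_tendsto_imp_tendsto[OF lim])
         (auto intro!: always_eventually simp: dist_commute[of "\<phi> _ _" "\<phi> t x"] case_prod_beta
            intro: order_trans[OF est abs_ge_self])
  qed
qed

lemma \<phi>_measurable [measurable]: "(\<lambda>p. \<phi> (fst p) (snd p)) \<in> borel_measurable borel"
  using borel_measurable_continuous_onI[OF \<phi>_continuous] unfolding case_prod_beta .

end

lemma exists_local_flow:
  assumes "L-lipschitz_on UNIV Y" "\<And>x. norm (Y x) \<le> M" "\<tau> > 0" "L * \<tau> \<le> 1/2"
  shows "\<exists>\<phi>. local_flow Y L M \<tau> \<phi>"
proof -
  obtain \<psi> where "\<And>x. \<psi> x 0 = x \<and> (\<forall>t. \<psi> x t = \<psi> x (max (- \<tau>) (min \<tau> t))) \<and>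
    (\<forall>t\<in>{-\<tau>..\<tau>}. (\<psi> x has_vector_derivative Y (\<psi> x t)) (at t within {-\<tau>..\<tau>}))"
    using exists_integral_curve[OF assms(1,3,4)] by metis
  then have "local_flow Y L M \<tau> (\<lambda>t x. \<psi> x t)"
    using assms by unfold_locales auto
  then show ?thesis by blast
qed

section \<open>Uniqueness of maximal integral curves\<close>

text \<open>The times of agreement form a closed subset of the connected common interval. It
  contains 0, and it is open by the short-time dependence estimate restarted at such a time.\<close>

lemma integral_curve_unique:
  assumes open_\<Omega>: "open \<Omega>" and X: "locally_Lipschitz_on \<Omega> X"
    and \<gamma>: "integral_curve \<Omega> X x I \<gamma>" and \<eta>: "integral_curve \<Omega> X x J \<eta>"
    and t: "t \<in> I" "t \<in> J"
  shows "\<gamma> t = \<eta> t"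
proof -
  define T where "T = I \<inter> J"
  have T: "open T" "is_interval T" "0 \<in> T"
    using \<gamma> \<eta> by (auto simp: T_def integral_curve_def is_interval_Int)
  have dI: "\<And>s. s \<in> T \<Longrightarrow> \<gamma> s \<in> \<Omega> \<and> (\<gamma> has_vector_derivative X (\<gamma> s)) (at s)"
    and dJ: "\<And>s. s \<in> T \<Longrightarrow> \<eta> s \<in> \<Omega> \<and> (\<eta> has_vector_derivative X (\<eta> s)) (at s)"
    using \<gamma> \<eta> by (auto simp: T_def integral_curve_def)
  have cI: "isCont \<gamma> s" and cJ: "isCont \<eta> s" if "s \<in> T" for s
    using dI[OF that] dJ[OF that] by (auto intro: has_vector_derivative_continuous)
  define A where "A = {s \<in> T. \<gamma> s - \<eta> s = 0}"
  have "closedin (top_of_set T) A"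
    unfolding A_def
    by (rule continuous_closedin_preimage_constant) (auto intro!: continuous_at_imp_continuous_on continuous_diff cI cJ)
  moreover have "openin (top_of_set T) A"
  proof -
    have "open A"
      unfolding open_contains_ball
    proof
      fix s assume "s \<in> A"
      then have s: "s \<in> T" "\<gamma> s = \<eta> s" by (auto simp: A_def)
      define p where "p = \<gamma> s"
      obtain u l where u: "u > 0" and l: "l-lipschitz_on (cball p u \<inter> \<Omega>) X"
        using local_lipschitzE[OF X[unfolded locally_Lipschitz_on_def], of 0 p] dI[OF s(1)]
        by (metis IntI UNIV_I centre_in_cball less_imp_le p_def)
      have l0: "l \<ge> 0" using l by (rule lipschitz_on_nonneg)
      have limI: "(\<gamma> \<longlongrightarrow> \<gamma> s) (nhds s)" and limJ: "(\<eta> \<longlongrightarrow> \<eta> s) (nhds s)"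
        using cI[OF s(1)] cJ[OF s(1)] by (simp_all add: isCont_def tendsto_at_iff_tendsto_nhds)
      have "\<forall>\<^sub>F r in nhds s. r \<in> T \<and> \<gamma> r \<in> ball p u \<and> \<eta> r \<in> ball p u"
      proof (intro eventually_conj)
        show "\<forall>\<^sub>F r in nhds s. r \<in> T" using T(1) s(1) by (rule eventually_nhds_in_open)
        show "\<forall>\<^sub>F r in nhds s. \<gamma> r \<in> ball p u"
          by (rule topological_tendstoD[OF limI open_ball]) (use u in \<open>simp add: p_def\<close>)
        show "\<forall>\<^sub>F r in nhds s. \<eta> r \<in> ball p u"
          by (rule topological_tendstoD[OF limJ open_ball]) (use u s(2) in \<open>simp add: p_def\<close>)
      qed
      then obtain d where d: "d > 0" "\<And>r. dist r s < d \<Longrightarrow> r \<in> T \<and> \<gamma> r \<in> ball p u \<and> \<eta> r \<in> ball p u"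
        unfolding eventually_nhds_metric by auto
      \<comment> \<open>\<open>e < d\<close> keeps both curves in the ball on which \<open>X\<close>
        is \<open>l\<close>-Lipschitz, and \<open>l * e \<le> 1/2\<close> is the smallness that the
        dependence estimate asks for.\<close>
      define e where "e = min (d/2) (1 / (2 * (l + 1)))"
      have e: "e > 0" "e < d" "l * e \<le> 1/2"
      proof -
        show "e > 0" "e < d" using d l0 by (auto simp: e_def)
        have "l * e \<le> l * (1 / (2 * (l + 1)))" using l0 by (intro mult_left_mono) (auto simp: e_def)
        also have "\<dots> \<le> 1/2" using l0 by (simp add: field_simps)
        finally show "l * e \<le> 1/2" .
      qed
      have "ball s e \<subseteq> A"
      proof
        fix r assume r: "r \<in> ball s e"
        have shift: "((\<lambda>v. \<zeta> (s + v)) has_vector_derivative X (\<zeta> (s + v))) (at v within {-e..e})"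
          if "(\<zeta> has_vector_derivative X (\<zeta> (s + v))) (at (s + v))" for \<zeta> :: "real \<Rightarrow> real^'a" and v
        proof -
          have "(\<zeta> \<circ> (\<lambda>v. s + v) has_vector_derivative 1 *\<^sub>R X (\<zeta> (s + v))) (at v within {-e..e})"
          proof (rule vector_diff_chain_within)
            show "((\<lambda>v. s + v) has_vector_derivative 1) (at v within {-e..e})" by (auto intro!: derivative_eq_intros)
          qed (use that in \<open>auto intro: has_vector_derivative_at_within\<close>)
          then show ?thesis by (simp add: o_def)
        qed
        have inT: "s + v \<in> T \<and> \<gamma> (s + v) \<in> ball p u \<and> \<eta> (s + v) \<in> ball p u" if "v \<in> {-e..e}" for v
          using that e by (intro d(2)) (auto simp: dist_real_def)
        have "norm (\<gamma> (s + (r - s)) - \<eta> (s + (r - s))) \<le> (1 + 2 * l * \<bar>r - s\<bar>) * norm (\<gamma> (s + 0) - \<eta> (s + 0))"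
        proof (rule integral_curve_dependence[OF l _ _ _ _ e(3), of "- e" e])
          fix v assume v: "v \<in> {-e..e}"
          show "\<gamma> (s + v) \<in> cball p u \<inter> \<Omega> \<and> ((\<lambda>v. \<gamma> (s + v)) has_vector_derivative X (\<gamma> (s + v))) (at v within {-e..e})"
            using inT[OF v] dI[of "s + v"] shift[of \<gamma> v] by auto
          show "\<eta> (s + v) \<in> cball p u \<inter> \<Omega> \<and> ((\<lambda>v. \<eta> (s + v)) has_vector_derivative X (\<eta> (s + v))) (at v within {-e..e})"
            using inT[OF v] dJ[of "s + v"] shift[of \<eta> v] by auto
        qed (use e r in \<open>auto simp: dist_real_def\<close>)
        then have "\<gamma> r = \<eta> r" using s(2) by simp
        moreover have "r \<in> T" using d(2)[of r] r e by (auto simp: dist_commute)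
        ultimately show "r \<in> A" by (simp add: A_def)
      qed
      then show "\<exists>e>0. ball s e \<subseteq> A" using e(1) by blast
    qed
    then show ?thesis by (intro open_openin_trans[OF T(1)]) (auto simp: A_def)
  qed
  moreover have "connected T" using T(2) by (simp add: is_interval_connected)
  moreover have "0 \<in> A" using T(3) \<gamma> \<eta> by (auto simp: A_def integral_curve_def)
  ultimately have "A = T" by (metis connected_clopen empty_iff)
  then show ?thesis using t by (auto simp: A_def T_def)
qed

text \<open>\<open>flow\<close> and \<open>flow_interval\<close> are definite descriptions, so a
  maximal curve has to be exhibited. By uniqueness all integral curves from \<open>x\<close> glue to
  one curve on the union \<open>U\<close> of their intervals; it is maximal and extends the given
  one.\<close>

lemma flow_eq_integral_curve:
  assumes open_\<Omega>: "open \<Omega>" and X: "locally_Lipschitz_on \<Omega> X"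
    and \<gamma>: "integral_curve \<Omega> X x I \<gamma>" and t: "t \<in> I"
  shows "t \<in> flow_interval \<Omega> X x" "flow \<Omega> X t x = \<gamma> t"
proof -
  note uniq = integral_curve_unique[OF open_\<Omega> X]
  define U where "U = \<Union>{J. \<exists>\<eta>. integral_curve \<Omega> X x J \<eta>}"
  define \<zeta> where "\<zeta> = (\<lambda>s. SOME y. \<exists>J \<eta>. integral_curve \<Omega> X x J \<eta> \<and> s \<in> J \<and> y = \<eta> s)"
  have \<zeta>: "\<zeta> s = \<eta> s" if "integral_curve \<Omega> X x J \<eta>" "s \<in> J" for J \<eta> s
  proof -
    have "\<exists>J \<eta>'. integral_curve \<Omega> X x J \<eta>' \<and> s \<in> J \<and> \<zeta> s = \<eta>' s"
      unfolding \<zeta>_def by (rule someI_ex) (use that in blast)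
    then obtain J' \<eta>' where "integral_curve \<Omega> X x J' \<eta>'" "s \<in> J'" "\<zeta> s = \<eta>' s" by blast
    then show ?thesis using uniq[OF _ that(1) _ that(2)] by simp
  qed
  have curve: "integral_curve \<Omega> X x U \<zeta>"
    unfolding integral_curve_def
  proof (intro conjI ballI)
    show "open U" unfolding U_def by (rule open_Union) (auto simp: integral_curve_def)
    have "0 \<in> I" using \<gamma> by (simp add: integral_curve_def)
    then show "0 \<in> U" using \<gamma> unfolding U_def by blast
    have "connected U" unfolding U_def
    proof (rule connected_Union)
      show "\<Inter> {J. \<exists>\<eta>. integral_curve \<Omega> X x J \<eta>} \<noteq> {}" by (auto simp: integral_curve_def)
    qed (auto simp: integral_curve_def is_interval_connected)
    then show "is_interval U" by (simp add: is_interval_connected_1)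
    show "\<zeta> 0 = x" using \<zeta>[OF \<gamma>] \<gamma> by (simp add: integral_curve_def)
    fix s assume "s \<in> U"
    then obtain J \<eta> where \<eta>: "integral_curve \<Omega> X x J \<eta>" "s \<in> J" unfolding U_def by blast
    show "\<zeta> s \<in> \<Omega>" using \<zeta>[OF \<eta>] \<eta> by (simp add: integral_curve_def)
    have J: "open J" and d: "(\<eta> has_vector_derivative X (\<eta> s)) (at s)"
      using \<eta> by (auto simp: integral_curve_def)
    have "(\<zeta> has_vector_derivative X (\<eta> s)) (at s)"
      by (rule has_vector_derivative_transform_within_open[OF d J \<eta>(2)]) (use \<zeta>[OF \<eta>(1)] in simp)
    then show "(\<zeta> has_vector_derivative X (\<zeta> s)) (at s)" using \<zeta>[OF \<eta>] by simp
  qed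
  have max: "maximal_integral_curve \<Omega> X x U \<zeta>"
    unfolding maximal_integral_curve_def
  proof (intro conjI curve allI impI)
    fix J \<eta> assume "integral_curve \<Omega> X x J \<eta> \<and> U \<subseteq> J \<and> (\<forall>t\<in>U. \<eta> t = \<zeta> t)"
    then show "J = U" unfolding U_def by blast
  qed
  have max_uniq: "J = U" if "maximal_integral_curve \<Omega> X x J \<eta>" for J \<eta>
  proof -
    have c: "integral_curve \<Omega> X x J \<eta>" using that by (simp add: maximal_integral_curve_def)
    then have "J \<subseteq> U" unfolding U_def by blast
    moreover have "\<forall>s\<in>J. \<zeta> s = \<eta> s" using \<zeta>[OF c] by blast
    ultimately show ?thesis using that curve unfolding maximal_integral_curve_def by metis
  qed
  have "flow_interval \<Omega> X x = U"
    unfolding flow_interval_def by (rule the_equality) (use max max_uniq in blast)+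
  moreover have "t \<in> U" using \<gamma> t unfolding U_def by blast
  ultimately show "t \<in> flow_interval \<Omega> X x" by simp
  show "flow \<Omega> X t x = \<gamma> t"
    unfolding flow_def
  proof (rule the_equality)
    show "\<exists>I \<eta>. maximal_integral_curve \<Omega> X x I \<eta> \<and> t \<in> I \<and> \<gamma> t = \<eta> t"
      using max \<open>t \<in> U\<close> \<zeta>[OF \<gamma> t] by metis
    fix y assume "\<exists>I \<eta>. maximal_integral_curve \<Omega> X x I \<eta> \<and> t \<in> I \<and> y = \<eta> t"
    then obtain J \<eta> where "integral_curve \<Omega> X x J \<eta>" "t \<in> J" "y = \<eta> t"
      unfolding maximal_integral_curve_def by blast
    then show "y = \<gamma> t" using uniq[OF _ \<gamma>] t by blast
  qed
qed

section \<open>Cutting off a locally Lipschitz field\<close>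

lemma locally_Lipschitz_on_compact:
  assumes X: "locally_Lipschitz_on \<Omega> X" and K: "compact K" "K \<subseteq> \<Omega>"
  obtains l where "l-lipschitz_on K X"
proof -
  have "local_lipschitz {0::real} K (\<lambda>_. X)"
    by (rule local_lipschitz_subset[OF X[unfolded locally_Lipschitz_on_def]]) (use K in auto)
  from local_lipschitz_compact_implies_lipschitz[OF this K(1)] show ?thesis
    using that by auto
qed

text \<open>\<open>X\<close> is multiplied by a plateau function \<open>\<theta>\<close> of the
  distance to \<open>K\<close>, equal to 1 up to \<open>d\<close> and to 0 from \<open>2 * d\<close>
  on. The product is Lipschitz because \<open>X\<close> is bounded and Lipschitz on the compact
  neighbourhood of radius \<open>2 * d\<close>.\<close>

lemma locally_Lipschitz_on_cutoff:
  fixes X :: "real^'n \<Rightarrow> real^'n"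
  assumes X: "locally_Lipschitz_on \<Omega> X" and K: "compact K" "K \<noteq> {}"
    and d: "d > 0" and sub: "{x. infdist x K \<le> 2 * d} \<subseteq> \<Omega>"
  shows "\<exists>Y L M. L-lipschitz_on UNIV Y \<and> (\<forall>x. norm (Y x) \<le> M) \<and> (\<forall>x. infdist x K \<le> d \<longrightarrow> Y x = X x)"
proof -
  define K2 where "K2 = {x. infdist x K \<le> 2 * d}"
  have K2: "compact K2" unfolding K2_def using d by (intro compact_infdist_le K) auto
  obtain l where l: "l-lipschitz_on K2 X"
    using locally_Lipschitz_on_compact[OF X K2] sub unfolding K2_def by blast
  have l0: "l \<ge> 0" using l by (rule lipschitz_on_nonneg)
  have "compact (X ` K2)" by (intro compact_continuous_image K2 lipschitz_on_continuous_on[OF l])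
  then obtain M where M: "M > 0" "\<And>x. x \<in> K2 \<Longrightarrow> norm (X x) \<le> M"
    using compact_imp_bounded bounded_pos by (metis imageI)
  define \<theta> where "\<theta> = (\<lambda>x. max 0 (min 1 (2 - infdist x K / d)))"
  have \<theta>: "0 \<le> \<theta> x" "\<theta> x \<le> 1" for x by (auto simp: \<theta>_def)
  have \<theta>_lip: "\<bar>\<theta> x - \<theta> y\<bar> \<le> (1/d) * norm (x - y)" for x y
  proof -
    have "\<bar>\<theta> x - \<theta> y\<bar> \<le> \<bar>infdist x K / d - infdist y K / d\<bar>" by (auto simp: \<theta>_def)
    also have "\<dots> = (1/d) * \<bar>infdist x K - infdist y K\<bar>"
      using d by (simp add: diff_divide_distrib[symmetric])
    also have "\<dots> \<le> (1/d) * norm (x - y)"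
      using d infdist_triangle_abs[of x K y] by (intro mult_left_mono) (auto simp: dist_norm)
    finally show ?thesis .
  qed
  have \<theta>_out: "\<theta> x = 0" if "x \<notin> K2" for x using that d by (auto simp: \<theta>_def K2_def field_simps)
  define Y where "Y = (\<lambda>x. \<theta> x *\<^sub>R X x)"
  have Yb: "norm (Y x) \<le> M" for x
  proof (cases "x \<in> K2")
    case True
    have "\<theta> x * norm (X x) \<le> 1 * M" using \<theta>[of x] M True by (intro mult_mono) auto
    then show ?thesis using \<theta>[of x] by (simp add: Y_def)
  next
    case False
    then show ?thesis using M by (simp add: Y_def \<theta>_out)
  qed
  \<comment> \<open>One point in \<open>K2\<close> is enough: if \<open>y\<close> lies outside,
    \<open>\<theta> y = 0\<close>, and the Lipschitz bound of \<open>\<theta>\<close> alone controls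
    the difference. With both points outside, \<open>Y\<close> vanishes at both.\<close>
  have one: "norm (Y x - Y y) \<le> (l + M/d) * norm (x - y)" if "x \<in> K2" for x y
  proof (cases "y \<in> K2")
    case True
    have "Y x - Y y = \<theta> x *\<^sub>R (X x - X y) + (\<theta> x - \<theta> y) *\<^sub>R X y" by (simp add: Y_def algebra_simps)
    then have "norm (Y x - Y y) \<le> \<theta> x * norm (X x - X y) + \<bar>\<theta> x - \<theta> y\<bar> * norm (X y)"
      using norm_triangle_ineq[of "\<theta> x *\<^sub>R (X x - X y)" "(\<theta> x - \<theta> y) *\<^sub>R X y"] \<theta>[of x] by simp
    also have "\<dots> \<le> 1 * (l * norm (x - y)) + ((1/d) * norm (x - y)) * M"
      using \<theta>[of x] \<theta>_lip[of x y] M d True that l0 lipschitz_on_normD[OF l that True]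
      by (intro add_mono mult_mono) auto
    finally show ?thesis by (simp add: algebra_simps)
  next
    case False
    then have "norm (Y x - Y y) = \<bar>\<theta> x - \<theta> y\<bar> * norm (X x)" using \<theta>[of x] by (simp add: Y_def \<theta>_out)
    also have "\<dots> \<le> ((1/d) * norm (x - y)) * M"
      using \<theta>_lip[of x y] M d that by (intro mult_mono) auto
    also have "\<dots> \<le> (l + M/d) * norm (x - y)" using l0 by (simp add: algebra_simps)
    finally show ?thesis .
  qed
  have "(l + M/d)-lipschitz_on UNIV Y"
  proof (rule lipschitz_onI)
    fix x y :: "real^'n"
    consider "x \<in> K2" | "y \<in> K2" | "x \<notin> K2" "y \<notin> K2" by blast
    then show "dist (Y x) (Y y) \<le> (l + M/d) * dist x y"
    proof cases
      case 3
      then show ?thesis using l0 M d by (simp add: Y_def \<theta>_out)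
    qed (use one[of x y] one[of y x] in \<open>auto simp: dist_norm norm_minus_commute\<close>)
  qed (use l0 M d in auto)
  moreover have "Y x = X x" if "infdist x K \<le> d" for x
    using that d by (auto simp: Y_def \<theta>_def field_simps)
  ultimately show ?thesis using Yb by blast
qed

section \<open>Measure distortion of the flow\<close>

lemma integrable_mult_bounded:
  fixes F g :: "'a::euclidean_space \<Rightarrow> real"
  assumes F: "integrable lborel F" and g: "g \<in> borel_measurable borel" and bd: "\<And>x. \<bar>g x\<bar> \<le> B"
  shows "integrable lborel (\<lambda>x. F x * g x)" "\<bar>\<integral>x. F x * g x \<partial>lborel\<bar> \<le> B * (\<integral>x. \<bar>F x\<bar> \<partial>lborel)"
proof -
  have [measurable]: "F \<in> borel_measurable borel" using F by auto
  have iF: "integrable lborel (\<lambda>x. B * \<bar>F x\<bar>)" using F by auto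
  have le: "\<bar>F x * g x\<bar> \<le> B * \<bar>F x\<bar>" for x
    using mult_left_mono[OF bd[of x] abs_ge_zero[of "F x"]] by (simp add: abs_mult mult.commute)
  show int: "integrable lborel (\<lambda>x. F x * g x)"
    by (rule Bochner_Integration.integrable_bound[OF iF])
       (use g le in \<open>auto intro!: AE_I2 intro: order_trans[OF le abs_ge_self]\<close>)
  have "\<bar>\<integral>x. F x * g x \<partial>lborel\<bar> \<le> (\<integral>x. \<bar>F x * g x\<bar> \<partial>lborel)" by (rule integral_abs_bound)
  also have "\<dots> \<le> (\<integral>x. B * \<bar>F x\<bar> \<partial>lborel)"
    by (rule integral_mono[OF integrable_abs[OF int] iF le])
  finally show "\<bar>\<integral>x. F x * g x \<partial>lborel\<bar> \<le> B * (\<integral>x. \<bar>F x\<bar> \<partial>lborel)" by simp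
qed

text \<open>The left side is convex on \<open>[0, 1]\<close> and lies below its chord, of slope
  \<open>2 ^ n - 1\<close>; the induction works with this sharper slope. The lemma linearises the
  distortion in time.\<close>

lemma power_one_plus_le:
  assumes "0 \<le> s" "s \<le> (1::real)"
  shows "(1 + s) ^ n \<le> 1 + 2 ^ n * s"
proof -
  have "(1 + s) ^ n \<le> 1 + (2 ^ n - 1) * s"
  proof (induction n)
    case (Suc n)
    have "(1 + s) * (1 + s) ^ n \<le> (1 + s) * (1 + (2 ^ n - 1) * s)"
      using Suc assms by (intro mult_left_mono) auto
    also have "\<dots> = 1 + 2 ^ n * s + (2 ^ n - 1) * (s * s)" by (simp add: algebra_simps)
    also have "\<dots> \<le> 1 + 2 ^ n * s + (2 ^ n - 1) * (1 * s)"
      using assms by (intro add_left_mono mult_left_mono mult_right_mono) auto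
    finally show ?case by (simp add: algebra_simps)
  qed simp
  also have "\<dots> \<le> 1 + 2 ^ n * s" using assms by (simp add: algebra_simps)
  finally show ?thesis .
qed

context local_flow
begin

text \<open>The power of the common Lipschitz constant of \<open>\<phi> t\<close> and
  \<open>\<phi> (- t)\<close>; it takes the place of a bound for the Jacobian and its
  inverse.\<close>

definition distortion :: "real \<Rightarrow> real" where
  "distortion t = (1 + 2 * L * \<bar>t\<bar>) ^ CARD('n)"

text \<open>The slope that \<open>power_one_plus_le\<close> yields for the distortion with
  \<open>s = 2 * L * \<bar>t\<bar>\<close>.\<close>

definition distortion_rate :: real where
  "distortion_rate = 2 ^ CARD('n) * (2 * L)"

lemma distortion_bounds:
  assumes t: "t \<in> {-\<tau>..\<tau>}"
  shows "1 \<le> distortion t" "distortion t \<le> 1 + distortion_rate * \<bar>t\<bar>" "distortion t \<le> 2 ^ CARD('n)"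
    "0 \<le> distortion_rate"
proof -
  have "L * \<bar>t\<bar> \<le> L * \<tau>" using t L_nonneg by (intro mult_left_mono) auto
  then have s: "0 \<le> 2 * L * \<bar>t\<bar>" "2 * L * \<bar>t\<bar> \<le> 1" using L_nonneg \<tau>_small by auto
  show "1 \<le> distortion t" unfolding distortion_def using s by (intro one_le_power) auto
  show "distortion t \<le> 1 + distortion_rate * \<bar>t\<bar>"
    unfolding distortion_def distortion_rate_def using power_one_plus_le[OF s, of "CARD('n)"] by (simp add: mult.assoc)
  show "distortion t \<le> 2 ^ CARD('n)" unfolding distortion_def using s by (intro power_mono) auto
  show "0 \<le> distortion_rate" using L_nonneg by (simp add: distortion_rate_def)
qed

lemma \<phi>_borel [measurable]: "\<phi> t \<in> borel_measurable borel"
proof (rule borel_measurable_continuous_onI)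
  have "continuous_on UNIV ((\<lambda>(t, x). \<phi> t x) \<circ> Pair t)"
    by (rule continuous_on_compose) (auto intro!: continuous_intros continuous_on_subset[OF \<phi>_continuous])
  then show "continuous_on UNIV (\<phi> t)" by (simp add: o_def)
qed

lemma \<phi>_time_borel [measurable]: "(\<lambda>t. \<phi> t x) \<in> borel_measurable borel"
proof (rule borel_measurable_continuous_onI)
  have "continuous_on UNIV ((\<lambda>(t, x). \<phi> t x) \<circ> (\<lambda>t. (t, x)))"
    by (rule continuous_on_compose) (auto intro!: continuous_intros continuous_on_subset[OF \<phi>_continuous])
  then show "continuous_on UNIV (\<lambda>t. \<phi> t x)" by (simp add: o_def)
qed

lemma emeasure_vimage_\<phi>:
  assumes t: "t \<in> {-\<tau>..\<tau>}" and A: "A \<in> sets borel"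
  shows "emeasure lborel (\<phi> t -` A) \<le> ennreal (distortion t) * emeasure lborel A"
proof -
  have t': "- t \<in> {-\<tau>..\<tau>}" using t by auto
  have l: "(1 + 2 * L * \<bar>t\<bar>)-lipschitz_on UNIV (\<phi> (- t))" using \<phi>_lipschitz[OF t'] by simp
  have "emeasure lborel (\<phi> t -` A) \<le> ennreal ((1 + 2 * L * \<bar>t\<bar>) ^ DIM(real^'n)) * emeasure lborel A"
  proof (rule emeasure_vimage_lipschitz_homeo[OF l _ _ _ \<phi>_borel A])
    show "0 < 1 + 2 * L * \<bar>t\<bar>" using L_nonneg by (simp add: add_pos_nonneg)
    show "\<phi> t (\<phi> (- t) x) = x" for x using \<phi>_inverse[OF t', of x] by simp
    show "\<phi> (- t) (\<phi> t x) = x" for x by (rule \<phi>_inverse[OF t])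
  qed
  then show ?thesis by (simp add: distortion_def)
qed

lemma nn_integral_\<phi>:
  assumes t: "t \<in> {-\<tau>..\<tau>}" and w: "w \<in> borel_measurable borel"
  shows "(\<integral>\<^sup>+x. w (\<phi> t x) \<partial>lborel) \<le> ennreal (distortion t) * (\<integral>\<^sup>+x. w x \<partial>lborel)"
proof -
  have "(\<integral>\<^sup>+x. w (\<phi> t x) \<partial>lborel) = (\<integral>\<^sup>+x. w x \<partial>distr lborel borel (\<phi> t))"
    using w by (subst nn_integral_distr) auto
  also have "\<dots> \<le> (\<integral>\<^sup>+x. w x \<partial>scale_measure (ennreal (distortion t)) lborel)"
  proof (rule nn_integral_mono_measure)
    show "distr lborel borel (\<phi> t) \<le> scale_measure (ennreal (distortion t)) lborel"
    proof (rule le_measure[THEN iffD2], simp, rule ballI)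
      fix A assume "A \<in> sets (distr lborel borel (\<phi> t))"
      then have A: "A \<in> sets borel" by simp
      then show "emeasure (distr lborel borel (\<phi> t)) A \<le> emeasure (scale_measure (ennreal (distortion t)) lborel) A"
        using emeasure_vimage_\<phi>[OF t A] by (subst emeasure_distr) auto
    qed
  qed simp
  also have "\<dots> = ennreal (distortion t) * (\<integral>\<^sup>+x. w x \<partial>lborel)"
    using w by (subst nn_integral_scale_measure) auto
  finally show ?thesis .
qed

lemma integrable_\<phi>:
  fixes F :: "real^'n \<Rightarrow> real"
  assumes t: "t \<in> {-\<tau>..\<tau>}" and F: "integrable lborel F"
  shows "integrable lborel (\<lambda>x. F (\<phi> t x))"
    "(\<integral>x. \<bar>F (\<phi> t x)\<bar> \<partial>lborel) \<le> distortion t * (\<integral>x. \<bar>F x\<bar> \<partial>lborel)"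
proof -
  have [measurable]: "F \<in> borel_measurable borel" using F by auto
  have nn: "(\<integral>\<^sup>+x. ennreal \<bar>F (\<phi> t x)\<bar> \<partial>lborel) \<le> ennreal (distortion t) * (\<integral>\<^sup>+x. ennreal \<bar>F x\<bar> \<partial>lborel)"
    by (rule nn_integral_\<phi>[OF t]) measurable
  also have "\<dots> = ennreal (distortion t) * ennreal (\<integral>x. \<bar>F x\<bar> \<partial>lborel)"
    using F by (subst nn_integral_eq_integral) auto
  also have "\<dots> = ennreal (distortion t * (\<integral>x. \<bar>F x\<bar> \<partial>lborel))"
    using distortion_bounds(1)[OF t] by (subst ennreal_mult) auto
  finally have le: "(\<integral>\<^sup>+x. ennreal \<bar>F (\<phi> t x)\<bar> \<partial>lborel) \<le> ennreal (distortion t * (\<integral>x. \<bar>F x\<bar> \<partial>lborel))" .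
  then have "(\<integral>\<^sup>+x. ennreal \<bar>F (\<phi> t x)\<bar> \<partial>lborel) < \<infinity>"
    by (metis ennreal_less_top infinity_ennreal_def le_less_trans)
  then show int: "integrable lborel (\<lambda>x. F (\<phi> t x))"
    by (intro integrableI_bounded) auto
  have "ennreal (\<integral>x. \<bar>F (\<phi> t x)\<bar> \<partial>lborel) \<le> ennreal (distortion t * (\<integral>x. \<bar>F x\<bar> \<partial>lborel))"
    using le int by (subst (asm) nn_integral_eq_integral) auto
  then show "(\<integral>x. \<bar>F (\<phi> t x)\<bar> \<partial>lborel) \<le> distortion t * (\<integral>x. \<bar>F x\<bar> \<partial>lborel)"
    using distortion_bounds(1)[OF t] by (subst (asm) ennreal_le_iff) auto
qed

text \<open>The upper bound for \<open>\<phi> t\<close>, and the same bound for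
  \<open>\<phi> (- t)\<close> applied to \<open>F \<circ> \<phi> t\<close>, estimate the two
  integrals by each other; together they do the work of a change of variables.\<close>

lemma integral_\<phi>_nonneg:
  fixes F :: "real^'n \<Rightarrow> real"
  assumes t: "t \<in> {-\<tau>..\<tau>}" and F: "integrable lborel F" and nn: "\<And>x. F x \<ge> 0"
  shows "\<bar>(\<integral>x. F (\<phi> t x) \<partial>lborel) - (\<integral>x. F x \<partial>lborel)\<bar> \<le> distortion_rate * \<bar>t\<bar> * (\<integral>x. F x \<partial>lborel)"
proof -
  have t': "- t \<in> {-\<tau>..\<tau>}" using t by auto
  define a where "a = (\<integral>x. F (\<phi> t x) \<partial>lborel)"
  define b where "b = (\<integral>x. F x \<partial>lborel)"
  define c where "c = distortion t"
  have c: "1 \<le> c" "c - 1 \<le> distortion_rate * \<bar>t\<bar>" using distortion_bounds[OF t] by (auto simp: c_def)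
  have b0: "b \<ge> 0" unfolding b_def using nn by simp
  have ab: "a \<le> c * b" using integrable_\<phi>(2)[OF t F] nn by (simp add: a_def b_def c_def)
  have "(\<integral>x. \<bar>F (\<phi> t (\<phi> (- t) x))\<bar> \<partial>lborel) \<le> distortion (- t) * (\<integral>x. \<bar>F (\<phi> t x)\<bar> \<partial>lborel)"
    by (rule integrable_\<phi>(2)[OF t' integrable_\<phi>(1)[OF t F]])
  moreover have "\<phi> t (\<phi> (- t) x) = x" for x using \<phi>_inverse[OF t', of x] by simp
  ultimately have ba: "b \<le> c * a" using nn by (simp add: a_def b_def c_def distortion_def)
  \<comment> \<open>\<open>b \<le> c * a\<close> gives \<open>c * (b - a) \<le> (c - 1) * b\<close>;
    the right side is enlarged by the factor \<open>c \<ge> 1\<close> so that \<open>c\<close>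
    cancels.\<close>
  have "b - a \<le> (c - 1) * b"
  proof -
    have "(c - 1) * b \<le> c * ((c - 1) * b)" using c b0 mult_right_mono[of 1 c "(c - 1) * b"] by simp
    then have "c * (b - a) \<le> c * ((c - 1) * b)" using ba by (simp add: algebra_simps)
    then show ?thesis using c by simp
  qed
  moreover have "a - b \<le> (c - 1) * b" using ab by (simp add: algebra_simps)
  ultimately have "\<bar>a - b\<bar> \<le> (c - 1) * b" by simp
  also have "\<dots> \<le> distortion_rate * \<bar>t\<bar> * b" using c b0 by (intro mult_right_mono)
  finally show ?thesis by (simp add: a_def b_def)
qed

lemma integral_\<phi>:
  fixes F :: "real^'n \<Rightarrow> real"
  assumes t: "t \<in> {-\<tau>..\<tau>}" and F: "integrable lborel F"
  shows "\<bar>(\<integral>x. F (\<phi> t x) \<partial>lborel) - (\<integral>x. F x \<partial>lborel)\<bar> \<le> distortion_rate * \<bar>t\<bar> * (\<integral>x. \<bar>F x\<bar> \<partial>lborel)"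
proof -
  define P where "P = (\<lambda>x. max 0 (F x))"
  define N where "N = (\<lambda>x. max 0 (- F x))"
  have iP: "integrable lborel P" and iN: "integrable lborel N" using F by (auto simp: P_def N_def)
  have FPN: "F x = P x - N x" "\<bar>F x\<bar> = P x + N x" for x by (auto simp: P_def N_def)
  note P = integral_\<phi>_nonneg[OF t iP] and N = integral_\<phi>_nonneg[OF t iN]
  have "(\<integral>x. F (\<phi> t x) \<partial>lborel) - (\<integral>x. F x \<partial>lborel) =
      ((\<integral>x. P (\<phi> t x) \<partial>lborel) - (\<integral>x. P x \<partial>lborel)) - ((\<integral>x. N (\<phi> t x) \<partial>lborel) - (\<integral>x. N x \<partial>lborel))"
    using iP iN integrable_\<phi>(1)[OF t iP] integrable_\<phi>(1)[OF t iN] by (simp add: FPN(1))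
  moreover have "\<bar>(\<integral>x. P (\<phi> t x) \<partial>lborel) - (\<integral>x. P x \<partial>lborel)\<bar> \<le> distortion_rate * \<bar>t\<bar> * (\<integral>x. P x \<partial>lborel)"
    by (rule P) (simp add: P_def)
  moreover have "\<bar>(\<integral>x. N (\<phi> t x) \<partial>lborel) - (\<integral>x. N x \<partial>lborel)\<bar> \<le> distortion_rate * \<bar>t\<bar> * (\<integral>x. N x \<partial>lborel)"
    by (rule N) (simp add: N_def)
  moreover have "(\<integral>x. \<bar>F x\<bar> \<partial>lborel) = (\<integral>x. P x \<partial>lborel) + (\<integral>x. N x \<partial>lborel)"
    using iP iN by (simp add: FPN(2))
  ultimately show ?thesis by (simp add: distrib_left)
qed

text \<open>The comparison passes through \<open>(F * u) \<circ> \<phi> t\<close>: the distortion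
  bound controls its integral, and replacing \<open>u \<circ> \<phi> t\<close> by \<open>u\<close>
  costs \<open>l * M * \<bar>t\<bar>\<close>. All regularity is taken from \<open>u\<close>, so the
  difference quotients in \<open>t\<close> are bounded uniformly over the \<open>L^1\<close> unit
  ball of \<open>F\<close>.\<close>

lemma integral_\<phi>_mult:
  fixes F u :: "real^'n \<Rightarrow> real"
  assumes t: "t \<in> {-\<tau>..\<tau>}" and F: "integrable lborel F"
    and ub: "\<And>x. \<bar>u x\<bar> \<le> B" and ul: "l-lipschitz_on UNIV u"
  shows "\<bar>(\<integral>x. F (\<phi> t x) * u x \<partial>lborel) - (\<integral>x. F x * u x \<partial>lborel)\<bar>
    \<le> (distortion_rate * B + 2 ^ CARD('n) * (l * M)) * \<bar>t\<bar> * (\<integral>x. \<bar>F x\<bar> \<partial>lborel)"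
proof -
  have [measurable]: "F \<in> borel_measurable borel" using F by auto
  have [measurable]: "u \<in> borel_measurable borel"
    by (rule borel_measurable_continuous_onI[OF lipschitz_on_continuous_on[OF ul]])
  have l0: "l \<ge> 0" using ul by (rule lipschitz_on_nonneg)
  have B0: "B \<ge> 0" using ub[of 0] by linarith
  note iF = integrable_\<phi>(1)[OF t F]
  have iFu: "integrable lborel (\<lambda>x. F x * u x)" by (rule integrable_mult_bounded[OF F _ ub]) measurable
  have i1: "integrable lborel (\<lambda>x. F (\<phi> t x) * u x)" by (rule integrable_mult_bounded[OF iF _ ub]) measurable
  have i2: "integrable lborel (\<lambda>x. F (\<phi> t x) * u (\<phi> t x))" using integrable_\<phi>(1)[OF t iFu] .
  have "\<bar>(\<integral>x. F (\<phi> t x) * u (\<phi> t x) \<partial>lborel) - (\<integral>x. F x * u x \<partial>lborel)\<bar> \<le> distortion_rate * \<bar>t\<bar> * (\<integral>x. \<bar>F x * u x\<bar> \<partial>lborel)"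
    by (rule integral_\<phi>[OF t iFu])
  also have "\<dots> \<le> distortion_rate * \<bar>t\<bar> * (B * (\<integral>x. \<bar>F x\<bar> \<partial>lborel))"
  proof (rule mult_left_mono)
    have "(\<integral>x. \<bar>F x * u x\<bar> \<partial>lborel) \<le> (\<integral>x. B * \<bar>F x\<bar> \<partial>lborel)"
    proof (rule integral_mono[OF integrable_abs[OF iFu]])
      show "integrable lborel (\<lambda>x. B * \<bar>F x\<bar>)" using F by auto
      show "\<bar>F x * u x\<bar> \<le> B * \<bar>F x\<bar>" for x
        using mult_left_mono[OF ub[of x] abs_ge_zero[of "F x"]] by (simp add: abs_mult mult.commute)
    qed
    then show "(\<integral>x. \<bar>F x * u x\<bar> \<partial>lborel) \<le> B * (\<integral>x. \<bar>F x\<bar> \<partial>lborel)" by simp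
  qed (use distortion_bounds(4)[OF t] in simp)
  finally have 1: "\<bar>(\<integral>x. F (\<phi> t x) * u (\<phi> t x) \<partial>lborel) - (\<integral>x. F x * u x \<partial>lborel)\<bar>
      \<le> distortion_rate * \<bar>t\<bar> * (B * (\<integral>x. \<bar>F x\<bar> \<partial>lborel))" .
  have du: "\<bar>u x - u (\<phi> t x)\<bar> \<le> l * (M * \<bar>t\<bar>)" for x
  proof -
    have "\<bar>u x - u (\<phi> t x)\<bar> \<le> l * norm (x - \<phi> t x)" using lipschitz_on_normD[OF ul, of x "\<phi> t x"] by simp
    also have "\<dots> \<le> l * (M * \<bar>t\<bar>)"
      using \<phi>_displacement[OF t, of x] l0 by (intro mult_left_mono) (auto simp: norm_minus_commute)
    finally show ?thesis .
  qed
  have "\<bar>\<integral>x. F (\<phi> t x) * (u x - u (\<phi> t x)) \<partial>lborel\<bar> \<le> (l * (M * \<bar>t\<bar>)) * (\<integral>x. \<bar>F (\<phi> t x)\<bar> \<partial>lborel)"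
    by (rule integrable_mult_bounded(2)[OF iF _ du]) measurable
  also have "\<dots> \<le> (l * (M * \<bar>t\<bar>)) * (2 ^ CARD('n) * (\<integral>x. \<bar>F x\<bar> \<partial>lborel))"
  proof (rule mult_left_mono)
    have "(\<integral>x. \<bar>F (\<phi> t x)\<bar> \<partial>lborel) \<le> distortion t * (\<integral>x. \<bar>F x\<bar> \<partial>lborel)" by (rule integrable_\<phi>(2)[OF t F])
    also have "\<dots> \<le> 2 ^ CARD('n) * (\<integral>x. \<bar>F x\<bar> \<partial>lborel)" by (rule mult_right_mono[OF distortion_bounds(3)[OF t]]) simp
    finally show "(\<integral>x. \<bar>F (\<phi> t x)\<bar> \<partial>lborel) \<le> 2 ^ CARD('n) * (\<integral>x. \<bar>F x\<bar> \<partial>lborel)" .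
  qed (use l0 M_nonneg in simp)
  finally have 2: "\<bar>\<integral>x. F (\<phi> t x) * (u x - u (\<phi> t x)) \<partial>lborel\<bar>
      \<le> (l * (M * \<bar>t\<bar>)) * (2 ^ CARD('n) * (\<integral>x. \<bar>F x\<bar> \<partial>lborel))" .
  have "(\<integral>x. F (\<phi> t x) * (u x - u (\<phi> t x)) \<partial>lborel) = (\<integral>x. F (\<phi> t x) * u x \<partial>lborel) - (\<integral>x. F (\<phi> t x) * u (\<phi> t x) \<partial>lborel)"
    using i1 i2 by (simp add: right_diff_distrib)
  then have "\<bar>(\<integral>x. F (\<phi> t x) * u x \<partial>lborel) - (\<integral>x. F x * u x \<partial>lborel)\<bar> \<le>
      \<bar>(\<integral>x. F (\<phi> t x) * u (\<phi> t x) \<partial>lborel) - (\<integral>x. F x * u x \<partial>lborel)\<bar> + \<bar>\<integral>x. F (\<phi> t x) * (u x - u (\<phi> t x)) \<partial>lborel\<bar>"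
    by linarith
  also have "\<dots> \<le> distortion_rate * \<bar>t\<bar> * (B * (\<integral>x. \<bar>F x\<bar> \<partial>lborel)) + (l * (M * \<bar>t\<bar>)) * (2 ^ CARD('n) * (\<integral>x. \<bar>F x\<bar> \<partial>lborel))"
    using 1 2 by (rule add_mono)
  finally show ?thesis by (simp add: algebra_simps)
qed

end

section \<open>Integration by parts against a Lipschitz field\<close>

lemma lipschitz_mult_bounded:
  fixes f g :: "'a::real_normed_vector \<Rightarrow> real"
  assumes f: "l-lipschitz_on UNIV f" "\<And>x. \<bar>f x\<bar> \<le> A" and g: "m-lipschitz_on UNIV g" "\<And>x. \<bar>g x\<bar> \<le> B"
  shows "(A * m + B * l)-lipschitz_on UNIV (\<lambda>x. f x * g x)"
proof (rule lipschitz_onI)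
  have A: "A \<ge> 0" and B: "B \<ge> 0" using f(2)[of 0] g(2)[of 0] by linarith+
  fix x y
  have "f x * g x - f y * g y = f x * (g x - g y) + g y * (f x - f y)" by (simp add: algebra_simps)
  then have "\<bar>f x * g x - f y * g y\<bar> \<le> \<bar>f x\<bar> * \<bar>g x - g y\<bar> + \<bar>g y\<bar> * \<bar>f x - f y\<bar>"
    using abs_triangle_ineq[of "f x * (g x - g y)" "g y * (f x - f y)"] by (simp add: abs_mult)
  also have "\<dots> \<le> A * (m * dist x y) + B * (l * dist x y)"
    using f g A B lipschitz_onD[OF f(1), of x y] lipschitz_onD[OF g(1), of x y]
    by (intro add_mono mult_mono) (auto simp: dist_real_def)
  finally show "dist (f x * g x) (f y * g y) \<le> (A * m + B * l) * dist x y"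
    by (simp add: dist_real_def algebra_simps)
qed (use f(2)[of 0] g(2)[of 0] lipschitz_on_nonneg[OF f(1)] lipschitz_on_nonneg[OF g(1)] in auto)

lemma lipschitz_on_vec_nth:
  assumes "l-lipschitz_on UNIV (Y :: 'a::metric_space \<Rightarrow> real^'n)"
  shows "l-lipschitz_on UNIV (\<lambda>x. Y x $ i)"
proof (rule lipschitz_onI)
  fix x y
  have "dist (Y x $ i) (Y y $ i) \<le> dist (Y x) (Y y)" by (rule dist_vec_nth_le)
  also have "\<dots> \<le> l * dist x y" using lipschitz_onD[OF assms] by simp
  finally show "dist (Y x $ i) (Y y $ i) \<le> l * dist x y" .
qed (rule lipschitz_on_nonneg[OF assms])

lemma test_functions_borel:
  assumes "u \<in> test_functions \<Omega>"
  shows "u \<in> borel_measurable borel" "partial_deriv i u \<in> borel_measurable borel"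
  using test_functions_continuous[OF assms] test_functions_continuous_partial[OF assms]
  by (auto intro: borel_measurable_continuous_onI)

interpretation lborel_UNIV: locally_finite_measure_on UNIV "lborel :: (real^'n) measure"
  by unfold_locales (use emeasure_bounded_finite[OF compact_imp_bounded] in auto)

text \<open>\<open>w * u * Y $ i\<close> is Lipschitz with compact support, so its
  \<open>i\<close>-th partial derivative has integral 0; the product rule and summation over
  \<open>i\<close> give the formula.\<close>

lemma integration_by_parts_Lipschitz:
  fixes Y :: "real^'n \<Rightarrow> real^'n"
  assumes lip: "L-lipschitz_on UNIV Y" and bd: "\<And>x. norm (Y x) \<le> M"
    and Db: "\<And>i. D i \<in> borel_measurable borel" "\<And>i x. \<bar>D i x\<bar> \<le> L"
    and D: "\<And>i. AE x in lborel. ((\<lambda>t. Y (x + t *\<^sub>R axis i 1) $ i) has_real_derivative D i x) (at 0)"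
    and u: "u \<in> test_functions UNIV" and w: "w \<in> test_functions UNIV"
  shows "(\<integral>x. u x * field_deriv Y w x \<partial>lborel) = - (\<integral>x. w x * (field_deriv Y u x + u x * (\<Sum>i\<in>UNIV. D i x)) \<partial>lborel)"
proof -
  note [measurable] = test_functions_borel[OF u] test_functions_borel[OF w] Db(1)
  have contY: "continuous_on UNIV Y" using lip by (rule lipschitz_on_continuous_on)
  have [measurable]: "(\<lambda>x. Y x $ i) \<in> borel_measurable borel" for i
    by (intro borel_measurable_continuous_onI continuous_intros contY)
  obtain Bu where Bu: "Bu > 0" "\<And>x. \<bar>u x\<bar> \<le> Bu" "\<And>i x. \<bar>partial_deriv i u x\<bar> \<le> Bu"
    using test_functions_bounded[OF u] by metis
  obtain Bw where Bw: "Bw > 0" "\<And>x. \<bar>w x\<bar> \<le> Bw" "\<And>i x. \<bar>partial_deriv i w x\<bar> \<le> Bw"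
    using test_functions_bounded[OF w] by metis
  obtain lu where lu: "lu-lipschitz_on UNIV u" using test_functions_lipschitz[OF u] by blast
  obtain lw where lw: "lw-lipschitz_on UNIV w" using test_functions_lipschitz[OF w] by blast
  have Yi: "\<bar>Y x $ i\<bar> \<le> M" for x i using component_le_norm_cart[of "Y x" i] bd[of x] by linarith
  have iu: "integrable lborel u" and iw: "integrable lborel w"
    by (rule lborel_UNIV.integrable_test_function[OF u], rule lborel_UNIV.integrable_test_function[OF w])
  have M0: "M \<ge> 0" using bd[of 0] norm_ge_zero order_trans by blast
  have int: "integrable lborel (\<lambda>x. u x * (partial_deriv i w x * Y x $ i))"
    "integrable lborel (\<lambda>x. w x * (partial_deriv i u x * Y x $ i))" "integrable lborel (\<lambda>x. w x * (u x * D i x))" for i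
  proof -
    show "integrable lborel (\<lambda>x. u x * (partial_deriv i w x * Y x $ i))"
      by (rule integrable_mult_bounded[OF iu, where B = "Bw * M"])
         (measurable, unfold abs_mult, intro mult_mono Bw Yi, use Bw in auto)
    show "integrable lborel (\<lambda>x. w x * (partial_deriv i u x * Y x $ i))"
      by (rule integrable_mult_bounded[OF iw, where B = "Bu * M"])
         (measurable, unfold abs_mult, intro mult_mono Bu Yi, use Bu in auto)
    show "integrable lborel (\<lambda>x. w x * (u x * D i x))"
      by (rule integrable_mult_bounded[OF iw, where B = "Bu * L"])
         (measurable, unfold abs_mult, intro mult_mono Bu Db, use Bu in auto)
  qed
  have zero: "(\<integral>x. u x * (partial_deriv i w x * Y x $ i) + (w x * (partial_deriv i u x * Y x $ i) + w x * (u x * D i x)) \<partial>lborel) = 0" for i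
  proof -
    have "bounded (closure {x. u x \<noteq> 0})" using test_functions_compact[OF u] by (rule compact_imp_bounded)
    then obtain R where R: "\<And>x. x \<in> closure {x. u x \<noteq> 0} \<Longrightarrow> norm x \<le> R" by (auto simp: bounded_iff)
    have l1: "(Bw * lu + Bu * lw)-lipschitz_on UNIV (\<lambda>x. w x * u x)"
      by (rule lipschitz_mult_bounded[OF lw Bw(2) lu Bu(2)])
    have b1: "\<bar>w x * u x\<bar> \<le> Bw * Bu" for x
      unfolding abs_mult by (intro mult_mono Bw Bu) (use Bw in auto)
    note l2 = lipschitz_mult_bounded[OF l1 b1 lipschitz_on_vec_nth[OF lip, of i] Yi]
    show ?thesis
    proof (rule integral_directional_derivative_eq_0[OF l2, where v = "axis i 1" and R = R])
      show "w x * u x * Y x $ i = 0" if "norm x > R" for x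
        using test_functions_eq_0[of x u] R[of x] that by force
      show "(\<lambda>x. u x * (partial_deriv i w x * Y x $ i) + (w x * (partial_deriv i u x * Y x $ i) + w x * (u x * D i x))) \<in> borel_measurable borel"
        by measurable
      show "AE x in lborel. ((\<lambda>t. w (x + t *\<^sub>R axis i 1) * u (x + t *\<^sub>R axis i 1) * Y (x + t *\<^sub>R axis i 1) $ i)
          has_real_derivative u x * (partial_deriv i w x * Y x $ i) + (w x * (partial_deriv i u x * Y x $ i) + w x * (u x * D i x))) (at 0)"
        using D[of i]
      proof eventually_elim
        case (elim x)
        note dw = has_real_derivative_partial_deriv(1)[OF test_functions_differentiable[OF w], of x i]
        note du = has_real_derivative_partial_deriv(1)[OF test_functions_differentiable[OF u], of x i]
        show ?case
          by (rule DERIV_cong[OF DERIV_mult[OF DERIV_mult[OF dw du] elim]]) (simp add: algebra_simps)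
      qed
    qed
  qed
  have "0 = (\<Sum>i\<in>UNIV. (\<integral>x. u x * (partial_deriv i w x * Y x $ i) + (w x * (partial_deriv i u x * Y x $ i) + w x * (u x * D i x)) \<partial>lborel))"
    by (simp only: zero sum.neutral_const)
  also have "\<dots> = (\<Sum>i\<in>UNIV. (\<integral>x. u x * (partial_deriv i w x * Y x $ i) \<partial>lborel) +
      ((\<integral>x. w x * (partial_deriv i u x * Y x $ i) \<partial>lborel) + (\<integral>x. w x * (u x * D i x) \<partial>lborel)))"
    by (intro sum.cong refl) (simp only: Bochner_Integration.integral_add Bochner_Integration.integrable_add int)
  also have "\<dots> = (\<Sum>i\<in>UNIV. (\<integral>x. u x * (partial_deriv i w x * Y x $ i) \<partial>lborel)) +
      ((\<Sum>i\<in>UNIV. (\<integral>x. w x * (partial_deriv i u x * Y x $ i) \<partial>lborel)) + (\<Sum>i\<in>UNIV. (\<integral>x. w x * (u x * D i x) \<partial>lborel)))"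
    by (simp only: sum.distrib)
  also have "(\<Sum>i\<in>UNIV. (\<integral>x. u x * (partial_deriv i w x * Y x $ i) \<partial>lborel)) = (\<integral>x. u x * field_deriv Y w x \<partial>lborel)"
    using int(1) by (subst Bochner_Integration.integral_sum[symmetric]) (auto simp: field_deriv_def sum_distrib_left mult_ac)
  also have "(\<Sum>i\<in>UNIV. (\<integral>x. w x * (partial_deriv i u x * Y x $ i) \<partial>lborel)) + (\<Sum>i\<in>UNIV. (\<integral>x. w x * (u x * D i x) \<partial>lborel)) =
     (\<integral>x. (\<Sum>i\<in>UNIV. w x * (partial_deriv i u x * Y x $ i)) + (\<Sum>i\<in>UNIV. w x * (u x * D i x)) \<partial>lborel)"
    using int(2,3) by (simp add: Bochner_Integration.integral_sum)
  also have "\<dots> = (\<integral>x. w x * (field_deriv Y u x + u x * (\<Sum>i\<in>UNIV. D i x)) \<partial>lborel)"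
    by (rule Bochner_Integration.integral_cong) (auto simp: field_deriv_def sum_distrib_left distrib_left mult_ac)
  finally show ?thesis by simp
qed

section \<open>Differentiating along the flow\<close>

lemma AE_lborel_imp_exists_in_interval:
  fixes a b :: real
  assumes "AE t in lborel. P t" "a < b"
  shows "\<exists>t\<in>{a<..<b}. P t"
proof (rule ccontr)
  assume "\<not> (\<exists>t\<in>{a<..<b}. P t)"
  then have "AE t in lborel. t \<notin> {a<..<b}" using assms(1) by (auto elim: eventually_mono)
  then have "emeasure lborel {a<..<b} = 0" by (subst (asm) AE_iff_measurable[of "{a<..<b}"]) auto
  then show False using assms(2) by simp
qed

text \<open>The sum of the \<open>D i\<close> is a bounded Borel version of the divergence of
  \<open>Y\<close>, free of the arbitrary values that the pointwise divergence takes on a null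
  set.\<close>

locale flow_with_divergence = local_flow Y L M \<tau> \<phi>
  for Y :: "real^'n \<Rightarrow> real^'n" and L M \<tau> :: real and \<phi> +
  fixes D :: "'n \<Rightarrow> real^'n \<Rightarrow> real"
  assumes D_borel [measurable]: "\<And>i. D i \<in> borel_measurable borel" and D_bound: "\<And>i x. \<bar>D i x\<bar> \<le> L"
    and D_deriv: "\<And>i. AE x in lborel. ((\<lambda>t. Y (x + t *\<^sub>R axis i 1) $ i) has_real_derivative D i x) (at 0)"
begin

text \<open>This is \<open>div (u Y)\<close>, that is, minus the formal adjoint of \<open>Y\<close>
  applied to \<open>u\<close>.\<close>

definition field_adjoint :: "(real^'n \<Rightarrow> real) \<Rightarrow> real^'n \<Rightarrow> real" where
  "field_adjoint u x = field_deriv Y u x + u x * (\<Sum>i\<in>UNIV. D i x)"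

lemma Y_component_borel [measurable]: "(\<lambda>x. Y x $ i) \<in> borel_measurable borel"
  by (intro borel_measurable_continuous_onI continuous_intros lipschitz_on_continuous_on[OF lip])

lemma field_adjoint_borel:
  assumes "u \<in> test_functions \<Omega>"
  shows "field_adjoint u \<in> borel_measurable borel"
proof -
  note [measurable] = test_functions_borel[OF assms]
  show ?thesis unfolding field_adjoint_def[abs_def] field_deriv_def by measurable
qed

lemma field_adjoint_bounded:
  assumes u: "u \<in> test_functions \<Omega>"
  shows "\<exists>B. \<forall>x. \<bar>field_adjoint u x\<bar> \<le> B"
proof -
  obtain B where B: "B > 0" "\<And>x. \<bar>u x\<bar> \<le> B" "\<And>i x. \<bar>partial_deriv i u x\<bar> \<le> B"
    using test_functions_bounded[OF u] by metis
  have Yi: "\<bar>Y x $ i\<bar> \<le> M" for x i using component_le_norm_cart[of "Y x" i] bounded[of x] by linarith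
  have "\<bar>field_adjoint u x\<bar> \<le> (\<Sum>i\<in>(UNIV::'n set). M * B) + B * (\<Sum>i\<in>(UNIV::'n set). L)" for x
  proof -
    have "\<bar>field_deriv Y u x\<bar> \<le> (\<Sum>i\<in>(UNIV::'n set). M * B)"
      unfolding field_deriv_def
      by (rule order_trans[OF sum_abs], rule sum_mono, unfold abs_mult, intro mult_mono Yi B M_nonneg abs_ge_zero)
    moreover have "\<bar>u x * (\<Sum>i\<in>UNIV. D i x)\<bar> \<le> B * (\<Sum>i\<in>(UNIV::'n set). L)"
      unfolding abs_mult
      by (rule mult_mono[OF B(2) order_trans[OF sum_abs sum_mono[OF D_bound]]]) (use B in auto)
    ultimately show ?thesis unfolding field_adjoint_def by linarith
  qed
  then show ?thesis by blast
qed

lemma DERIV_along_flow: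
  fixes w :: "real^'n \<Rightarrow> real"
  assumes "w differentiable (at x)"
  shows "((\<lambda>t. w (\<phi> t x)) has_real_derivative field_deriv Y w x) (at 0)"
proof -
  have "((\<lambda>t. \<phi> t x) has_vector_derivative Y (\<phi> 0 x)) (at 0 within {-\<tau>..\<tau>})"
    using \<tau>_pos by (intro \<phi>_deriv) auto
  then have "((\<lambda>t. \<phi> t x) has_derivative (\<lambda>h. h *\<^sub>R Y x)) (at 0)"
    using \<tau>_pos by (subst (asm) at_within_Icc_at) (auto simp: has_vector_derivative_def \<phi>_0)
  moreover have "(w has_derivative (\<lambda>h. \<Sum>j\<in>UNIV. h $ j * partial_deriv j w x)) (at (\<phi> 0 x))"
    unfolding \<phi>_0 by (rule has_real_derivative_partial_deriv(2)[OF assms])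
  ultimately have "((\<lambda>t. w (\<phi> t x)) has_derivative (\<lambda>h. \<Sum>j\<in>UNIV. (h *\<^sub>R Y x) $ j * partial_deriv j w x)) (at 0)"
    by (rule has_derivative_compose)
  moreover have "(\<lambda>h::real. \<Sum>j\<in>UNIV. (h *\<^sub>R Y x) $ j * partial_deriv j w x) = (*) (field_deriv Y w x)"
    by (simp add: field_deriv_def fun_eq_iff sum_distrib_left sum_distrib_right mult_ac)
  ultimately show ?thesis by (simp add: has_field_derivative_def)
qed

text \<open>The quotients of \<open>w \<circ> \<phi> t\<close> converge pointwise to
  \<open>field_deriv Y w\<close> and are bounded by \<open>lw * M\<close>; the derivative is then
  moved to \<open>u\<close> by parts.\<close>

lemma quotient_limit_test:
  assumes t: "\<And>m. 0 < t m" "\<And>m. t m < \<tau>" "t \<longlonglongrightarrow> 0"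
    and u: "u \<in> test_functions UNIV" and w: "w \<in> test_functions UNIV"
  shows "(\<lambda>m. ((\<integral>x. w (\<phi> (t m) x) * u x \<partial>lborel) - (\<integral>x. w x * u x \<partial>lborel)) / t m)
    \<longlonglongrightarrow> - (\<integral>x. w x * field_adjoint u x \<partial>lborel)"
proof -
  note [measurable] = test_functions_borel[OF u] test_functions_borel[OF w]
  have ti: "t m \<in> {-\<tau>..\<tau>}" for m using t(1,2)[of m] by auto
  obtain Bu where Bu: "\<And>x. \<bar>u x\<bar> \<le> Bu" using test_functions_bounded[OF u] by metis
  obtain lw where lw: "lw-lipschitz_on UNIV w" using test_functions_lipschitz[OF w] by blast
  have lw0: "lw \<ge> 0" using lw by (rule lipschitz_on_nonneg)
  have iu: "integrable lborel u" and iw: "integrable lborel w"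
    by (rule lborel_UNIV.integrable_test_function[OF u], rule lborel_UNIV.integrable_test_function[OF w])
  have i1: "integrable lborel (\<lambda>x. w (\<phi> (t m) x) * u x)" for m
    by (rule integrable_mult_bounded[OF integrable_\<phi>(1)[OF ti iw] _ Bu]) measurable
  have i2: "integrable lborel (\<lambda>x. w x * u x)"
    by (rule integrable_mult_bounded[OF iw _ Bu]) measurable
  define q where "q = (\<lambda>m x. (w (\<phi> (t m) x) - w x) / t m * u x)"
  have eq: "((\<integral>x. w (\<phi> (t m) x) * u x \<partial>lborel) - (\<integral>x. w x * u x \<partial>lborel)) / t m = integral\<^sup>L lborel (q m)" for m
  proof -
    have "q m = (\<lambda>x. (w (\<phi> (t m) x) * u x - w x * u x) / t m)"
      by (simp add: q_def fun_eq_iff left_diff_distrib diff_divide_distrib)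
    then show ?thesis using i1[of m] i2 by simp
  qed
  have fm: "(\<lambda>x. u x * field_deriv Y w x) \<in> borel_measurable lborel"
    unfolding field_deriv_def by measurable
  have "(\<lambda>m. integral\<^sup>L lborel (q m)) \<longlonglongrightarrow> (\<integral>x. u x * field_deriv Y w x \<partial>lborel)"
  proof (rule integral_dominated_convergence[OF fm])
    show "q m \<in> borel_measurable lborel" for m unfolding q_def by measurable
    show "integrable lborel (\<lambda>x. (lw * M) * \<bar>u x\<bar>)" using iu by auto
    show "AE x in lborel. (\<lambda>m. q m x) \<longlonglongrightarrow> u x * field_deriv Y w x"
    proof (rule AE_I2)
      fix x
      have "((\<lambda>h. (w (\<phi> (0 + h) x) - w (\<phi> 0 x)) / h) \<longlongrightarrow> field_deriv Y w x) (at 0)"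
        using DERIV_along_flow[OF test_functions_differentiable[OF w]] unfolding DERIV_def .
      moreover have "filterlim t (at 0) sequentially"
        using t(3) t(1) by (auto simp: filterlim_at intro!: always_eventually) (metis less_irrefl)
      ultimately have "(\<lambda>m. (w (\<phi> (0 + t m) x) - w (\<phi> 0 x)) / t m) \<longlonglongrightarrow> field_deriv Y w x"
        by (rule filterlim_compose)
      then have "(\<lambda>m. (w (\<phi> (t m) x) - w x) / t m * u x) \<longlonglongrightarrow> field_deriv Y w x * u x"
        unfolding \<phi>_0 add_0 by (rule tendsto_mult[OF _ tendsto_const])
      then show "(\<lambda>m. q m x) \<longlonglongrightarrow> u x * field_deriv Y w x"
        unfolding q_def mult.commute[of "u x"] .
    qed
    show "AE x in lborel. norm (q m x) \<le> (lw * M) * \<bar>u x\<bar>" for m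
    proof (rule AE_I2)
      fix x
      have "\<bar>w (\<phi> (t m) x) - w x\<bar> \<le> lw * norm (\<phi> (t m) x - x)" using lipschitz_on_normD[OF lw, of "\<phi> (t m) x" x] by simp
      also have "\<dots> \<le> lw * (M * t m)"
        using \<phi>_displacement[OF ti, of m x] lw0 t(1)[of m] by (intro mult_left_mono) auto
      finally have "\<bar>(w (\<phi> (t m) x) - w x) / t m\<bar> \<le> lw * M"
        using t(1)[of m] by (simp add: abs_divide divide_le_eq mult.assoc)
      from mult_right_mono[OF this abs_ge_zero[of "u x"]]
      show "norm (q m x) \<le> (lw * M) * \<bar>u x\<bar>" by (simp add: q_def abs_mult)
    qed
  qed
  moreover have "(\<integral>x. u x * field_deriv Y w x \<partial>lborel) = - (\<integral>x. w x * field_adjoint u x \<partial>lborel)"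
    unfolding field_adjoint_def by (rule integration_by_parts_Lipschitz[OF lip bounded D_borel D_bound D_deriv u w])
  ultimately show ?thesis unfolding eq by simp
qed

text \<open>Test functions are dense, and both sides are \<open>L\<^sup>1\<close>-continuous in \<open>F\<close> uniformly in \<open>m\<close>.\<close>

lemma quotient_limit:
  assumes t: "\<And>m. 0 < t m" "\<And>m. t m < \<tau>" "t \<longlonglongrightarrow> 0"
    and u: "u \<in> test_functions UNIV" and F: "integrable lborel F"
  shows "(\<lambda>m. ((\<integral>x. F (\<phi> (t m) x) * u x \<partial>lborel) - (\<integral>x. F x * u x \<partial>lborel)) / t m)
    \<longlonglongrightarrow> - (\<integral>x. F x * field_adjoint u x \<partial>lborel)"
proof -
  note [measurable] = test_functions_borel[OF u] field_adjoint_borel[OF u]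
  have ti: "t m \<in> {-\<tau>..\<tau>}" for m using t(1,2)[of m] by auto
  obtain Bu where Bu: "\<And>x. \<bar>u x\<bar> \<le> Bu" using test_functions_bounded[OF u] by metis
  obtain lu where lu: "lu-lipschitz_on UNIV u" using test_functions_lipschitz[OF u] by blast
  obtain A where A: "\<And>x. \<bar>field_adjoint u x\<bar> \<le> A" using field_adjoint_bounded[OF u] by blast
  have A0: "A \<ge> 0" using A[of 0] by linarith
  define C where "C = distortion_rate * Bu + 2 ^ CARD('n) * (lu * M)"
  have Bu0: "Bu \<ge> 0" using Bu[of 0] by linarith
  have C0: "C \<ge> 0" unfolding C_def
    using distortion_bounds(4)[OF ti[of 0]] Bu0 lipschitz_on_nonneg[OF lu] M_nonneg by auto
  define q where "q = (\<lambda>m F. ((\<integral>x. F (\<phi> (t m) x) * u x \<partial>lborel) - (\<integral>x. F x * u x \<partial>lborel)) / t m)"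
  define S where "S = (\<lambda>F. - (\<integral>x. F x * field_adjoint u x \<partial>lborel))"
  have q_bound: "\<bar>q m F\<bar> \<le> C * (\<integral>x. \<bar>F x\<bar> \<partial>lborel)" if "integrable lborel F" for m F
    using integral_\<phi>_mult[OF ti[of m] that Bu lu] t(1)[of m]
    unfolding q_def C_def by (simp add: abs_divide pos_divide_le_eq mult_ac)
  have S_bound: "\<bar>S F\<bar> \<le> A * (\<integral>x. \<bar>F x\<bar> \<partial>lborel)" if "integrable lborel F" for F
    unfolding S_def using integrable_mult_bounded(2)[OF that _ A] by simp
  have i1: "integrable lborel (\<lambda>x. F (\<phi> (t m) x) * u x)" "integrable lborel (\<lambda>x. F x * u x)"
      "integrable lborel (\<lambda>x. F x * field_adjoint u x)" if "integrable lborel F" for F m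
    by (rule integrable_mult_bounded[OF integrable_\<phi>(1)[OF ti that] _ Bu], measurable)
       (rule integrable_mult_bounded[OF that _ Bu], measurable, rule integrable_mult_bounded[OF that _ A], measurable)
  have q_diff: "q m (\<lambda>x. F x - G x) = q m F - q m G" if "integrable lborel F" "integrable lborel G" for m F G
    unfolding q_def using i1(1)[OF that(1), of m] i1(1)[OF that(2), of m] i1(2)[OF that(1)] i1(2)[OF that(2)]
    by (simp add: left_diff_distrib diff_divide_distrib[symmetric])
  have S_diff: "S (\<lambda>x. F x - G x) = S F - S G" if "integrable lborel F" "integrable lborel G" for F G
    unfolding S_def using i1(3)[OF that(1)] i1(3)[OF that(2)] by (simp add: left_diff_distrib)
  have "(\<lambda>m. q m F) \<longlonglongrightarrow> S F"
  proof (rule LIMSEQ_I)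
    fix e :: real assume "e > 0"
    \<comment> \<open>The error of approximating \<open>F\<close> by \<open>w\<close> enters with
      the weight \<open>C + A\<close> and thus costs at most \<open>e / 2\<close>.\<close>
    define e' where "e' = e / (2 * (C + A + 1))"
    have e': "e' > 0" using \<open>e > 0\<close> C0 A0 by (simp add: e'_def)
    obtain w where w: "w \<in> test_functions UNIV" "(\<integral>x. \<bar>F x - w x\<bar> \<partial>lborel) < e'"
      by (rule lborel_UNIV.test_function_approximation[OF F e'])
    have iw: "integrable lborel w" by (rule lborel_UNIV.integrable_test_function[OF w(1)])
    have iFw: "integrable lborel (\<lambda>x. F x - w x)" using F iw by simp
    have "(\<lambda>m. q m w) \<longlonglongrightarrow> S w" unfolding q_def S_def by (rule quotient_limit_test[OF t u w(1)])
    then obtain N where N: "\<And>m. m \<ge> N \<Longrightarrow> \<bar>q m w - S w\<bar> < e / 2"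
      using \<open>e > 0\<close> by (fastforce dest: LIMSEQ_D[where r = "e / 2"])
    have "norm (q m F - S F) < e" if "m \<ge> N" for m
    proof -
      let ?I = "\<integral>x. \<bar>F x - w x\<bar> \<partial>lborel"
      have "q m F - S F = q m (\<lambda>x. F x - w x) - S (\<lambda>x. F x - w x) + (q m w - S w)"
        by (simp add: q_diff[OF F iw] S_diff[OF F iw])
      then have "\<bar>q m F - S F\<bar> \<le> \<bar>q m (\<lambda>x. F x - w x)\<bar> + \<bar>S (\<lambda>x. F x - w x)\<bar> + \<bar>q m w - S w\<bar>" by linarith
      also have "\<dots> < C * ?I + A * ?I + e / 2"
        using q_bound[OF iFw, of m] S_bound[OF iFw] N[OF that] by linarith
      also have "\<dots> = (C + A) * ?I + e / 2" by (simp add: distrib_right)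
      also have "\<dots> \<le> (C + A) * e' + e / 2" using w(2) C0 A0 by (intro add_right_mono mult_left_mono) auto
      also have "(C + A) * e' \<le> e / 2" using \<open>e > 0\<close> C0 A0 by (simp add: e'_def field_simps)
      finally show ?thesis by simp
    qed
    then show "\<exists>N. \<forall>m\<ge>N. norm (q m F - S F) < e" by blast
  qed
  then show ?thesis by (simp add: q_def S_def)
qed

text \<open>After the integrals are exchanged, each time slice exceeds the slice at time 0 by at
  most \<open>O(t)\<close>, by \<open>integral_\<phi>_mult\<close> with \<open>\<bar>u\<bar>\<close>
  as multiplier; the outer factor \<open>t\<close> is the length of the time interval.\<close>

lemma nn_integral_along_flow_bound:
  assumes t: "0 < t" "t < \<tau>" and H: "integrable lborel H" "\<And>x. H x \<ge> 0"
    and u: "u \<in> borel_measurable borel" "\<And>x. \<bar>u x\<bar> \<le> B" "l-lipschitz_on UNIV u"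
  shows "(\<integral>\<^sup>+x. (\<integral>\<^sup>+s\<in>{0..t}. ennreal (H (\<phi> s x)) \<partial>lborel) * ennreal \<bar>u x\<bar> \<partial>lborel)
    \<le> ennreal (t * ((\<integral>x. H x * \<bar>u x\<bar> \<partial>lborel) + (distortion_rate * B + 2 ^ CARD('n) * (l * M)) * t * (\<integral>x. H x \<partial>lborel)))"
proof -
  define C where "C = distortion_rate * B + 2 ^ CARD('n) * (l * M)"
  have [measurable]: "H \<in> borel_measurable borel" using H by auto
  note [measurable] = u(1)
  have ml: "l-lipschitz_on UNIV (\<lambda>x. \<bar>u x\<bar>)"
  proof (rule lipschitz_onI)
    show "dist \<bar>u x\<bar> \<bar>u y\<bar> \<le> l * dist x y" for x y
      using lipschitz_onD[OF u(3), of x y] by (simp add: dist_real_def)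
  qed (rule lipschitz_on_nonneg[OF u(3)])
  have \<phi>pair [measurable]: "(\<lambda>p. \<phi> (fst p) (snd p)) \<in> borel_measurable (lborel \<Otimes>\<^sub>M lborel)"
    using \<phi>_measurable by (simp add: lborel_prod)
  have C0: "C \<ge> 0" unfolding C_def
    using distortion_bounds(4)[of 0] \<tau>_pos u(2)[of 0] lipschitz_on_nonneg[OF u(3)] M_nonneg by auto
  have slice: "(\<integral>\<^sup>+x. ennreal (H (\<phi> s x)) * ennreal \<bar>u x\<bar> \<partial>lborel) \<le> ennreal ((\<integral>x. H x * \<bar>u x\<bar> \<partial>lborel) + C * t * (\<integral>x. H x \<partial>lborel))"
    if s: "s \<in> {0..t}" for s
  proof -
    have si: "s \<in> {-\<tau>..\<tau>}" using s t by auto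
    have int: "integrable lborel (\<lambda>x. H (\<phi> s x) * \<bar>u x\<bar>)"
      by (rule integrable_mult_bounded[OF integrable_\<phi>(1)[OF si H(1)], where B = B]) (use u in auto)
    have "(\<integral>\<^sup>+x. ennreal (H (\<phi> s x)) * ennreal \<bar>u x\<bar> \<partial>lborel) = ennreal (\<integral>x. H (\<phi> s x) * \<bar>u x\<bar> \<partial>lborel)"
      using int H(2) by (subst nn_integral_eq_integral[symmetric]) (auto simp: ennreal_mult)
    also have "\<dots> \<le> ennreal ((\<integral>x. H x * \<bar>u x\<bar> \<partial>lborel) + C * t * (\<integral>x. H x \<partial>lborel))"
    proof (rule ennreal_leI)
      have "(\<integral>x. H (\<phi> s x) * \<bar>u x\<bar> \<partial>lborel) - (\<integral>x. H x * \<bar>u x\<bar> \<partial>lborel) \<le> C * \<bar>s\<bar> * (\<integral>x. \<bar>H x\<bar> \<partial>lborel)"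
        unfolding C_def by (rule order_trans[OF abs_ge_self integral_\<phi>_mult[OF si H(1) _ ml]]) (use u(2) in simp)
      also have "\<dots> \<le> C * t * (\<integral>x. \<bar>H x\<bar> \<partial>lborel)"
        using s C0 by (intro mult_right_mono mult_left_mono) auto
      finally show "(\<integral>x. H (\<phi> s x) * \<bar>u x\<bar> \<partial>lborel) \<le> (\<integral>x. H x * \<bar>u x\<bar> \<partial>lborel) + C * t * (\<integral>x. H x \<partial>lborel)"
        using H(2) by simp
    qed
    finally show ?thesis .
  qed
  have "(\<integral>\<^sup>+x. (\<integral>\<^sup>+s\<in>{0..t}. ennreal (H (\<phi> s x)) \<partial>lborel) * ennreal \<bar>u x\<bar> \<partial>lborel) =
     (\<integral>\<^sup>+x. (\<integral>\<^sup>+s. (ennreal (H (\<phi> s x)) * ennreal \<bar>u x\<bar>) * indicator {0..t} s \<partial>lborel) \<partial>lborel)"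
    by (intro nn_integral_cong, subst nn_integral_multc[symmetric]) (auto simp: mult_ac)
  also have "\<dots> = (\<integral>\<^sup>+s. (\<integral>\<^sup>+x. (ennreal (H (\<phi> s x)) * ennreal \<bar>u x\<bar>) * indicator {0..t} s \<partial>lborel) \<partial>lborel)"
  proof (rule lborel_pair.Fubini')
    have "(\<lambda>p. (ennreal (H (\<phi> (fst p) (snd p))) * ennreal \<bar>u (snd p)\<bar>) * indicator {0..t} (fst p)) \<in> borel_measurable (lborel \<Otimes>\<^sub>M lborel)"
      by measurable
    then show "(\<lambda>(s, x). (ennreal (H (\<phi> s x)) * ennreal \<bar>u x\<bar>) * indicator {0..t} s) \<in> borel_measurable (lborel \<Otimes>\<^sub>M lborel)"
      by (simp add: case_prod_beta)
  qed
  also have "\<dots> = (\<integral>\<^sup>+s. (\<integral>\<^sup>+x. ennreal (H (\<phi> s x)) * ennreal \<bar>u x\<bar> \<partial>lborel) * indicator {0..t} s \<partial>lborel)"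
    by (intro nn_integral_cong nn_integral_multc) measurable
  also have "\<dots> \<le> (\<integral>\<^sup>+s. ennreal ((\<integral>x. H x * \<bar>u x\<bar> \<partial>lborel) + C * t * (\<integral>x. H x \<partial>lborel)) * indicator {0..t} s \<partial>lborel)"
    by (rule nn_integral_mono) (use slice in \<open>auto split: split_indicator\<close>)
  also have "\<dots> = ennreal ((\<integral>x. H x * \<bar>u x\<bar> \<partial>lborel) + C * t * (\<integral>x. H x \<partial>lborel)) * ennreal t"
    using t by (subst nn_integral_cmult) auto
  also have "\<dots> = ennreal (t * ((\<integral>x. H x * \<bar>u x\<bar> \<partial>lborel) + C * t * (\<integral>x. H x \<partial>lborel)))"
    using t C0 H by (subst ennreal_mult[symmetric]) (auto simp: mult.commute intro!: add_nonneg_nonneg mult_nonneg_nonneg)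
  finally show ?thesis by (simp add: C_def)
qed

theorem upper_gradient_along_flow:
  assumes u: "u \<in> test_functions UNIV" and F: "integrable lborel F"
    and H: "integrable lborel H" "\<And>x. H x \<ge> 0"
    and ug: "AE t in lborel. t \<in> {0<..<\<tau>} \<longrightarrow> (AE x in lborel. u x \<noteq> 0 \<longrightarrow>
        ennreal \<bar>F (\<phi> t x) - F x\<bar> \<le> (\<integral>\<^sup>+s\<in>{0..t}. ennreal (H (\<phi> s x)) \<partial>lborel))"
  shows "\<bar>\<integral>x. F x * field_adjoint u x \<partial>lborel\<bar> \<le> (\<integral>x. H x * \<bar>u x\<bar> \<partial>lborel)"
proof -
  have [measurable]: "F \<in> borel_measurable borel" using F by auto
  note [measurable] = test_functions_borel[OF u]
  obtain B where B: "\<And>x. \<bar>u x\<bar> \<le> B" using test_functions_bounded[OF u] by metis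
  obtain l where l: "l-lipschitz_on UNIV u" using test_functions_lipschitz[OF u] by blast
  define C where "C = distortion_rate * B + 2 ^ CARD('n) * (l * M)"
  define A where "A = (\<lambda>t. AE x in lborel. u x \<noteq> 0 \<longrightarrow>
        ennreal \<bar>F (\<phi> t x) - F x\<bar> \<le> (\<integral>\<^sup>+s\<in>{0..t}. ennreal (H (\<phi> s x)) \<partial>lborel))"
  have ug': "AE t in lborel. t \<in> {0<..<\<tau>} \<longrightarrow> A t" using ug unfolding A_def .
  \<comment> \<open>The inequality is available for almost every time only. Every interval from 0 to
    \<open>1 / (m + 1)\<close> contains an admissible time, and a sequence of such times suffices
    for the limit.\<close>
  have "\<exists>t\<in>{0<..<min \<tau> (1 / real (Suc m))}. t \<in> {0<..<\<tau>} \<longrightarrow> A t" for m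
    using AE_lborel_imp_exists_in_interval[OF ug', of 0 "min \<tau> (1 / real (Suc m))"] \<tau>_pos by simp
  then obtain t where t: "\<And>m. t m \<in> {0<..<min \<tau> (1 / real (Suc m))}" "\<And>m. t m \<in> {0<..<\<tau>} \<longrightarrow> A (t m)" by metis
  have t0: "0 < t m" "t m < \<tau>" for m using t(1)[of m] by auto
  have At: "A (t m)" for m using t(2)[of m] t0 by simp
  have t_lim: "t \<longlonglongrightarrow> 0"
  proof (rule tendsto_sandwich)
    show "\<forall>\<^sub>F m in sequentially. 0 \<le> t m" using t0 by (auto intro!: always_eventually less_imp_le)
    show "\<forall>\<^sub>F m in sequentially. t m \<le> 1 / real (Suc m)" using t(1) by (auto intro!: always_eventually less_imp_le)
    show "(\<lambda>m. 1 / real (Suc m)) \<longlonglongrightarrow> 0" by (rule LIMSEQ_Suc[OF lim_1_over_n])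
  qed simp
  have bound: "\<bar>((\<integral>x. F (\<phi> (t m) x) * u x \<partial>lborel) - (\<integral>x. F x * u x \<partial>lborel)) / t m\<bar>
      \<le> (\<integral>x. H x * \<bar>u x\<bar> \<partial>lborel) + C * t m * (\<integral>x. H x \<partial>lborel)" for m
  proof -
    have ti: "t m \<in> {-\<tau>..\<tau>}" using t0[of m] by auto
    have i1: "integrable lborel (\<lambda>x. F (\<phi> (t m) x) * u x)"
      by (rule integrable_mult_bounded[OF integrable_\<phi>(1)[OF ti F] _ B]) measurable
    have i2: "integrable lborel (\<lambda>x. F x * u x)"
      by (rule integrable_mult_bounded[OF F _ B]) measurable
    let ?R = "(\<integral>x. H x * \<bar>u x\<bar> \<partial>lborel) + C * t m * (\<integral>x. H x \<partial>lborel)"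
    have C0: "C \<ge> 0" unfolding C_def
      using distortion_bounds(4)[OF ti] B[of 0] lipschitz_on_nonneg[OF l] M_nonneg by auto
    have R0: "?R \<ge> 0" using C0 H t0[of m] by (auto intro!: add_nonneg_nonneg mult_nonneg_nonneg)
    have "ennreal (\<integral>x. \<bar>F (\<phi> (t m) x) * u x - F x * u x\<bar> \<partial>lborel) = (\<integral>\<^sup>+x. ennreal \<bar>F (\<phi> (t m) x) * u x - F x * u x\<bar> \<partial>lborel)"
      using i1 i2 by (subst nn_integral_eq_integral) auto
    also have "\<dots> = (\<integral>\<^sup>+x. ennreal \<bar>F (\<phi> (t m) x) - F x\<bar> * ennreal \<bar>u x\<bar> \<partial>lborel)"
      by (intro nn_integral_cong) (simp add: left_diff_distrib[symmetric] abs_mult ennreal_mult)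
    also have "\<dots> \<le> (\<integral>\<^sup>+x. (\<integral>\<^sup>+s\<in>{0..t m}. ennreal (H (\<phi> s x)) \<partial>lborel) * ennreal \<bar>u x\<bar> \<partial>lborel)"
      using At[of m] unfolding A_def
      by (intro nn_integral_mono_AE) (auto elim!: eventually_mono intro: mult_right_mono)
    also have "\<dots> \<le> ennreal (t m * ?R)"
      unfolding C_def by (rule nn_integral_along_flow_bound[OF t0 H _ B l]) measurable
    finally have "(\<integral>x. \<bar>F (\<phi> (t m) x) * u x - F x * u x\<bar> \<partial>lborel) \<le> t m * ?R"
      using R0 t0(1)[of m] by (subst (asm) ennreal_le_iff) auto
    moreover have "\<bar>(\<integral>x. F (\<phi> (t m) x) * u x \<partial>lborel) - (\<integral>x. F x * u x \<partial>lborel)\<bar> \<le> (\<integral>x. \<bar>F (\<phi> (t m) x) * u x - F x * u x\<bar> \<partial>lborel)"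
      using integral_abs_bound[of lborel "\<lambda>x. F (\<phi> (t m) x) * u x - F x * u x"] i1 i2 by simp
    ultimately show ?thesis
      using t0(1)[of m] by (simp add: abs_divide pos_divide_le_eq mult.commute)
  qed
  have lim_H: "(\<lambda>m. (\<integral>x. H x * \<bar>u x\<bar> \<partial>lborel) + C * t m * (\<integral>x. H x \<partial>lborel)) \<longlonglongrightarrow> (\<integral>x. H x * \<bar>u x\<bar> \<partial>lborel) + C * 0 * (\<integral>x. H x \<partial>lborel)"
    by (intro tendsto_intros t_lim)
  have lim_F: "(\<lambda>m. \<bar>((\<integral>x. F (\<phi> (t m) x) * u x \<partial>lborel) - (\<integral>x. F x * u x \<partial>lborel)) / t m\<bar>)
      \<longlonglongrightarrow> \<bar>- (\<integral>x. F x * field_adjoint u x \<partial>lborel)\<bar>"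
    by (intro tendsto_rabs quotient_limit t0 t_lim u F)
  have "\<bar>- (\<integral>x. F x * field_adjoint u x \<partial>lborel)\<bar> \<le> (\<integral>x. H x * \<bar>u x\<bar> \<partial>lborel) + C * 0 * (\<integral>x. H x \<partial>lborel)"
    by (rule LIMSEQ_le[OF lim_F lim_H]) (use bound in blast)
  then show ?thesis by simp
qed

end

section \<open>Upper gradients bound the distributional derivative\<close>

lemma L1_locD: "\<lbrakk>f \<in> L1_loc \<Omega>; compact K; K \<subseteq> \<Omega>\<rbrakk> \<Longrightarrow> set_integrable lebesgue K f"
  by (simp add: L1_loc_def)

lemma AE_lebesgue_iff: "(AE x in lebesgue. P x) \<longleftrightarrow> (AE x in lborel. P x)"
  by (rule AE_completion_iff)

text \<open>Truncation to a compact set makes \<open>f\<close> globally integrable, which the flow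
  estimates require, and a function measurable for the completion equals a Borel function almost
  everywhere.\<close>

lemma L1_loc_borel_representative:
  assumes f: "f \<in> L1_loc \<Omega>" and K: "compact K" "K \<subseteq> \<Omega>"
  obtains F where "integrable lborel F" "AE x in lborel. F x = indicator K x * f x"
proof -
  have int: "integrable lebesgue (\<lambda>x. indicator K x * f x)"
    using L1_locD[OF f K] by (simp add: set_integrable_def)
  then obtain F where F: "F \<in> borel_measurable lborel" "AE x in lborel. indicator K x * f x = F x"
    using completion_ex_borel_measurable_real[of "\<lambda>x. indicator K x * f x" lborel] by auto
  have "integrable lebesgue F"
    by (rule integrable_cong_AE_imp[OF int])
       (use F in \<open>auto simp: AE_lebesgue_iff measurable_completion\<close>)
  then have "integrable lborel F" using F(1) by (simp add: integrable_completion)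
  moreover have "AE x in lborel. F x = indicator K x * f x" using F(2) by (auto elim: eventually_mono)
  ultimately show ?thesis by (rule that)
qed

text \<open>Preimages under \<open>f\<close> and \<open>G\<close> differ only within a null set, and
  completeness makes such differences measurable.\<close>

lemma measurable_lebesgue_AE_cong:
  fixes f G :: "'a::euclidean_space \<Rightarrow> 'b::topological_space"
  assumes G: "G \<in> borel_measurable lebesgue" and eq: "AE x in lebesgue. G x = f x"
  shows "f \<in> borel_measurable lebesgue"
proof (rule measurableI)
  fix A :: "'b set" assume A: "A \<in> sets borel"
  show "f -` A \<inter> space lebesgue \<in> sets lebesgue"
  proof (rule completion.in_sets_AE)
    show "AE x in lebesgue. (x \<in> G -` A \<inter> space lebesgue) = (x \<in> f -` A \<inter> space lebesgue)"
      using eq by (auto elim!: eventually_mono)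
    show "G -` A \<inter> space lebesgue \<in> sets lebesgue" using G A by (rule measurable_sets)
  qed simp
qed simp

text \<open>A bridge from the integrals in the definitions to Borel integrands. Measurability of
  \<open>g\<close> is a consequence here; this matters for \<open>divergence\<close>, whose values
  on a null set are arbitrary.\<close>

lemma set_integral_lebesgue_eq_lborel:
  fixes G g :: "'a::euclidean_space \<Rightarrow> real"
  assumes G: "integrable lborel G" and eq: "AE x in lborel. indicator \<Omega> x * g x = G x"
  shows "set_integrable lebesgue \<Omega> g" "(LINT x:\<Omega>|lebesgue. g x) = integral\<^sup>L lborel G"
proof -
  have Gm: "G \<in> borel_measurable lborel" using G by auto
  have eq': "AE x in lebesgue. G x = indicator \<Omega> x *\<^sub>R g x"
    using eq unfolding AE_lebesgue_iff by (auto elim: eventually_mono)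
  have G': "G \<in> borel_measurable lebesgue" using Gm by (rule measurable_completion)
  have gm: "(\<lambda>x. indicator \<Omega> x *\<^sub>R g x) \<in> borel_measurable lebesgue"
    by (rule measurable_lebesgue_AE_cong[OF G' eq'])
  have "integrable lebesgue G" using G Gm by (simp add: integrable_completion)
  then show "set_integrable lebesgue \<Omega> g"
    unfolding set_integrable_def by (rule integrable_cong_AE_imp[OF _ gm]) (use eq' in \<open>auto elim: eventually_mono\<close>)
  have "(LINT x:\<Omega>|lebesgue. g x) = integral\<^sup>L lebesgue G"
    unfolding set_lebesgue_integral_def
    by (rule integral_cong_AE[OF gm G']) (use eq' in \<open>auto elim: eventually_mono\<close>)
  then show "(LINT x:\<Omega>|lebesgue. g x) = integral\<^sup>L lborel G" using Gm by (simp add: integral_completion)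
qed

section \<open>Cut-off fields whose flow agrees with the given one\<close>

lemma infdist_neighbourhood_subset:
  fixes K :: "'a::euclidean_space set"
  assumes "compact K" "K \<noteq> {}" "K \<subseteq> \<Omega>" "open \<Omega>"
  obtains d where "d > 0" "{x. infdist x K \<le> 2 * d} \<subseteq> \<Omega>"
proof -
  obtain e where e: "e > 0" "(\<Union>x\<in>K. cball x e) \<subseteq> \<Omega>"
    using compact_subset_open_imp_cball_epsilon_subset[OF assms(1,4,3)] by blast
  have "{x. infdist x K \<le> 2 * (e / 4)} \<subseteq> \<Omega>"
  proof
    fix x assume "x \<in> {x. infdist x K \<le> 2 * (e / 4)}"
    then have "(INF a\<in>K. dist x a) < e" using assms(2) e(1) by (simp add: infdist_notempty)
    then obtain a where "a \<in> K" "dist x a < e"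
      using cInf_lessD[of "dist x ` K" e] assms(2) by auto
    then have "x \<in> cball a e" "a \<in> K" by (auto simp: dist_commute)
    then show "x \<in> \<Omega>" using e(2) by blast
  qed
  then show ?thesis using e(1) by (intro that[of "e / 4"]) auto
qed

text \<open>Collects what a test function supported in \<open>K\<close> calls for: a global field
  that equals \<open>X\<close> near \<open>K\<close>, its short-time flow, and Borel versions of its
  diagonal partial derivatives, which are those of \<open>X\<close> almost everywhere on
  \<open>K\<close>.\<close>

lemma cutoff_with_divergence:
  fixes X :: "real^'n \<Rightarrow> real^'n"
  assumes "open \<Omega>" and X: "locally_Lipschitz_on \<Omega> X" and K: "compact K" "K \<noteq> {}" "K \<subseteq> \<Omega>"
  obtains Y L M \<tau> \<phi> D d where "flow_with_divergence Y L M \<tau> \<phi> D" "d > 0" "{x. infdist x K \<le> d} \<subseteq> \<Omega>"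
    "M * \<tau> \<le> d" "\<And>x. infdist x K \<le> d \<Longrightarrow> Y x = X x"
    "AE x in lborel. x \<in> K \<longrightarrow> (\<forall>i. partial_deriv i (\<lambda>y. X y $ i) x = D i x \<and>
       ((\<lambda>t. X (x + t *\<^sub>R axis i 1) $ i) has_real_derivative D i x) (at 0))"
proof -
  obtain d where d: "d > 0" "{x. infdist x K \<le> 2 * d} \<subseteq> \<Omega>"
    using infdist_neighbourhood_subset[OF K assms(1)] by blast
  obtain Y L M where Y: "L-lipschitz_on UNIV Y" "\<And>x. norm (Y x) \<le> M" "\<And>x. infdist x K \<le> d \<Longrightarrow> Y x = X x"
    using locally_Lipschitz_on_cutoff[OF X K(1,2) d] by blast
  have L0: "L \<ge> 0" using Y(1) by (rule lipschitz_on_nonneg)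
  have M0: "M \<ge> 0" using Y(2) norm_ge_zero order_trans by blast
  \<comment> \<open>The first bound gives \<open>L * \<tau> \<le> 1/2\<close> for the short-time
    estimates, the second keeps orbits from \<open>K\<close> within distance \<open>d\<close>, where
    \<open>Y = X\<close>. Adding 1 avoids a division by 0.\<close>
  define \<tau> where "\<tau> = min (1 / (2 * (L + 1))) (d / (M + 1))"
  have \<tau>: "\<tau> > 0" using L0 M0 d by (simp add: \<tau>_def)
  have L\<tau>: "L * \<tau> \<le> 1/2"
  proof -
    have "L * \<tau> \<le> L * (1 / (2 * (L + 1)))" using L0 by (intro mult_left_mono) (auto simp: \<tau>_def)
    also have "\<dots> \<le> 1/2" using L0 by (simp add: field_simps)
    finally show ?thesis .
  qed
  have M\<tau>: "M * \<tau> \<le> d"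
  proof -
    have "M * \<tau> \<le> M * (d / (M + 1))" using M0 by (intro mult_left_mono) (auto simp: \<tau>_def)
    also have "\<dots> \<le> d" using M0 d by (simp add: field_simps)
    finally show ?thesis .
  qed
  obtain \<phi> where \<phi>: "local_flow Y L M \<tau> \<phi>" using exists_local_flow[OF Y(1,2) \<tau> L\<tau>] by blast
  define P where "P = (\<lambda>i D. D \<in> borel_measurable borel \<and> (\<forall>x. \<bar>D x\<bar> \<le> L) \<and>
      (AE x in lborel. ((\<lambda>t. Y (x + t *\<^sub>R axis i 1) $ i) has_real_derivative D x) (at 0)))"
  have ex: "\<exists>D. P i D" for i
  proof -
    obtain D where "D \<in> borel_measurable borel" "\<And>x. \<bar>D x\<bar> \<le> L * norm (axis i 1 :: real^'n)"
      "AE x in lborel. ((\<lambda>t. Y (x + t *\<^sub>R axis i 1) $ i) has_real_derivative D x) (at 0)"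
      by (rule lipschitz_directional_derivative[OF lipschitz_on_vec_nth[OF Y(1), of i], of "axis i 1"]) (rule that)
    then show ?thesis unfolding P_def by (intro exI[of _ D]) simp
  qed
  define D where "D = (\<lambda>i. SOME D. P i D)"
  have PD: "P i (D i)" for i unfolding D_def by (rule someI_ex[OF ex])
  have D: "D i \<in> borel_measurable borel" "\<bar>D i x\<bar> \<le> L"
      "AE x in lborel. ((\<lambda>t. Y (x + t *\<^sub>R axis i 1) $ i) has_real_derivative D i x) (at 0)" for i x
    using PD[of i] unfolding P_def by blast+
  have fd: "flow_with_divergence Y L M \<tau> \<phi> D"
    using \<phi> D by (intro flow_with_divergence.intro flow_with_divergence_axioms.intro)
  have "AE x in lborel. \<forall>i. ((\<lambda>t. Y (x + t *\<^sub>R axis i 1) $ i) has_real_derivative D i x) (at 0)"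
    using D(3) by (simp add: AE_all_countable)
  then have ae: "AE x in lborel. x \<in> K \<longrightarrow> (\<forall>i. partial_deriv i (\<lambda>y. X y $ i) x = D i x \<and>
       ((\<lambda>t. X (x + t *\<^sub>R axis i 1) $ i) has_real_derivative D i x) (at 0))"
  proof (rule eventually_mono, intro impI allI)
    fix x i
    assume der: "\<forall>i. ((\<lambda>t. Y (x + t *\<^sub>R axis i 1) $ i) has_real_derivative D i x) (at 0)" and x: "x \<in> K"
    \<comment> \<open>A derivative at a point of \<open>K\<close> sees only values within distance
      \<open>d\<close>, where \<open>X\<close> and \<open>Y\<close> coincide.\<close>
    have near: "infdist (x + t *\<^sub>R axis i 1) K \<le> d" if "t \<in> {-d<..<d}" for t
      by (rule infdist_le2[OF x]) (use that in \<open>auto simp: dist_norm\<close>)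
    have "((\<lambda>t. X (x + t *\<^sub>R axis i 1) $ i) has_real_derivative D i x) (at 0)"
      by (rule has_field_derivative_transform_within_open[OF spec[OF der, of i], of "{-d<..<d}"])
         (use d Y(3) near in auto)
    then show "partial_deriv i (\<lambda>y. X y $ i) x = D i x \<and>
       ((\<lambda>t. X (x + t *\<^sub>R axis i 1) $ i) has_real_derivative D i x) (at 0)"
      by (auto simp: partial_deriv_def intro: DERIV_imp_deriv)
  qed
  have "{x. infdist x K \<le> d} \<subseteq> {x. infdist x K \<le> 2 * d}" using d(1) by auto
  then have sub: "{x. infdist x K \<le> d} \<subseteq> \<Omega>" using d(2) by blast
  show ?thesis by (rule that[OF fd d(1) sub M\<tau> Y(3) ae])
qed

context local_flow
begin

text \<open>Exchanging integrals reduces the claim to a fixed time \<open>s\<close>, where the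
  preimage of a null set is null by the distortion bound. It lets a Borel representative replace
  \<open>h\<close> under the integral along the curve.\<close>

lemma AE_orbit_avoids_null_set:
  assumes N: "N \<in> null_sets lborel" and t: "0 \<le> t" "t \<le> \<tau>"
  shows "AE x in lborel. AE s in lborel. s \<in> {0..t} \<longrightarrow> \<phi> s x \<notin> N"
proof -
  have [measurable]: "N \<in> sets borel" using N by auto
  have \<phi>pair [measurable]: "(\<lambda>p. \<phi> (fst p) (snd p)) \<in> borel_measurable (lborel \<Otimes>\<^sub>M lborel)"
    using \<phi>_measurable by (simp add: lborel_prod)
  have meas: "(\<lambda>(s, x). indicator {0..t} s * indicator N (\<phi> s x) :: ennreal) \<in> borel_measurable (lborel \<Otimes>\<^sub>M lborel)"
  proof -
    have "(\<lambda>p. indicator {0..t} (fst p) * indicator N (\<phi> (fst p) (snd p)) :: ennreal) \<in> borel_measurable (lborel \<Otimes>\<^sub>M lborel)"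
      by measurable
    then show ?thesis by (simp add: case_prod_beta)
  qed
  have zero: "(\<integral>\<^sup>+x. indicator N (\<phi> s x) \<partial>lborel) = (0::ennreal)" if "s \<in> {0..t}" for s
    using nn_integral_\<phi>[of s "indicator N"] that t \<tau>_pos N by (auto simp: null_sets_def)
  have "(\<integral>\<^sup>+x. (\<integral>\<^sup>+s. indicator {0..t} s * indicator N (\<phi> s x) \<partial>lborel) \<partial>lborel) =
     (\<integral>\<^sup>+s. (\<integral>\<^sup>+x. indicator {0..t} s * indicator N (\<phi> s x) \<partial>lborel) \<partial>(lborel :: real measure))"
    by (rule lborel_pair.Fubini'[OF meas])
  also have "\<dots> = (\<integral>\<^sup>+s. indicator {0..t} s * (\<integral>\<^sup>+x. indicator N (\<phi> s x) \<partial>lborel) \<partial>lborel)"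
    by (intro nn_integral_cong nn_integral_cmult) measurable
  also have "\<dots> = (\<integral>\<^sup>+s. 0 \<partial>(lborel :: real measure))"
    by (intro nn_integral_cong) (use zero in \<open>auto split: split_indicator\<close>)
  finally have "(\<integral>\<^sup>+x. (\<integral>\<^sup>+s. indicator {0..t} s * indicator N (\<phi> s x) \<partial>lborel) \<partial>lborel) = 0" by simp
  moreover have "(\<lambda>x. \<integral>\<^sup>+s. indicator {0..t} s * indicator N (\<phi> s x) \<partial>lborel) \<in> borel_measurable lborel"
  proof -
    have "(\<lambda>p. indicator {0..t} (snd p) * indicator N (\<phi> (snd p) (fst p)) :: ennreal) \<in> borel_measurable (lborel \<Otimes>\<^sub>M lborel)"
      using measurable_pair_swap[OF meas] by (simp add: case_prod_beta)
    from lborel.borel_measurable_nn_integral_fst[OF this] show ?thesis by simp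
  qed
  ultimately have "AE x in lborel. (\<integral>\<^sup>+s. indicator {0..t} s * indicator N (\<phi> s x) \<partial>lborel) = (0::ennreal)"
    by (subst (asm) nn_integral_0_iff_AE) auto
  then show ?thesis
  proof (rule eventually_mono)
    fix x assume "(\<integral>\<^sup>+s. indicator {0..t} s * indicator N (\<phi> s x) \<partial>lborel) = (0::ennreal)"
    then have "AE s in lborel. indicator {0..t} s * indicator N (\<phi> s x) = (0::ennreal)"
      by (subst (asm) nn_integral_0_iff_AE) auto
    then show "AE s in lborel. s \<in> {0..t} \<longrightarrow> \<phi> s x \<notin> N"
      by (rule eventually_mono) (auto simp: indicator_def split: if_splits)
  qed
qed

text \<open>The fixed-time counterpart, which lets a Borel representative replace \<open>f\<close>
  at the endpoint of a curve.\<close>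

lemma AE_\<phi>_avoids_null_set:
  assumes N: "N \<in> null_sets lborel" and t: "t \<in> {-\<tau>..\<tau>}"
  shows "AE x in lborel. \<phi> t x \<notin> N"
proof -
  have [measurable]: "N \<in> sets borel" using N by auto
  have "(\<integral>\<^sup>+x. indicator N (\<phi> t x) \<partial>lborel) = (0::ennreal)"
    using nn_integral_\<phi>[OF t, of "indicator N"] N by (auto simp: null_sets_def)
  then have "AE x in lborel. indicator N (\<phi> t x) = (0::ennreal)"
    by (subst (asm) nn_integral_0_iff_AE) auto
  then show ?thesis by (rule eventually_mono) (auto simp: indicator_def split: if_splits)
qed

text \<open>The displacement is at most \<open>M * \<tau> \<le> d\<close>, so the orbit stays where
  \<open>Y = X\<close> and is an integral curve of \<open>X\<close>; uniqueness identifies it with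
  the flow. The time interval is open because \<open>integral_curve\<close> asks for two-sided
  derivatives.\<close>

lemma flow_eq_\<phi>:
  assumes \<Omega>: "open \<Omega>" and X: "locally_Lipschitz_on \<Omega> X" and x: "x \<in> K"
    and sub: "{x. infdist x K \<le> d} \<subseteq> \<Omega>" and d: "M * \<tau> \<le> d"
    and YX: "\<And>x. infdist x K \<le> d \<Longrightarrow> Y x = X x" and t: "t \<in> {-\<tau><..<\<tau>}"
  shows "t \<in> flow_interval \<Omega> X x" "flow \<Omega> X t x = \<phi> t x" "infdist (\<phi> t x) K \<le> d"
proof -
  have near: "infdist (\<phi> s x) K \<le> d" if "s \<in> {-\<tau><..<\<tau>}" for s
  proof (rule infdist_le2[OF x])
    have "dist (\<phi> s x) x \<le> M * \<bar>s\<bar>" using \<phi>_displacement[of s x] that by (auto simp: dist_norm)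
    also have "\<dots> \<le> M * \<tau>" using that M_nonneg by (intro mult_left_mono) auto
    finally show "dist (\<phi> s x) x \<le> d" using d by simp
  qed
  then show "infdist (\<phi> t x) K \<le> d" using t by blast
  have "integral_curve \<Omega> X x {-\<tau><..<\<tau>} (\<lambda>s. \<phi> s x)"
    unfolding integral_curve_def
  proof (intro conjI ballI)
    fix s assume s: "s \<in> {-\<tau><..<\<tau>}"
    show "\<phi> s x \<in> \<Omega>" using near[OF s] sub by blast
    have "((\<lambda>s. \<phi> s x) has_vector_derivative Y (\<phi> s x)) (at s within {-\<tau>..\<tau>})"
      using s by (intro \<phi>_deriv) auto
    then show "((\<lambda>s. \<phi> s x) has_vector_derivative X (\<phi> s x)) (at s)"
      using s YX[OF near[OF s]] by (subst (asm) at_within_Icc_at) auto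
  qed (use \<tau>_pos \<phi>_0 in \<open>auto simp: is_interval_oo\<close>)
  from flow_eq_integral_curve[OF \<Omega> X this t] show "t \<in> flow_interval \<Omega> X x" "flow \<Omega> X t x = \<phi> t x" .
qed

end

section \<open>Transfer of the flow estimate to the original field\<close>

lemma test_function_support:
  assumes "u \<in> test_functions \<Omega>" "\<Omega> \<noteq> {}"
  obtains K where "compact K" "K \<noteq> {}" "K \<subseteq> \<Omega>" "closure {x. u x \<noteq> 0} \<subseteq> K"
proof -
  obtain x0 where x0: "x0 \<in> \<Omega>" using assms(2) by blast
  show ?thesis
  \<comment> \<open>The extra point keeps the set nonempty when \<open>u\<close> vanishes
    identically; \<open>infdist\<close> to the empty set is 0 by convention.\<close>
  proof (rule that[of "insert x0 (closure {x. u x \<noteq> 0})"])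
    show "compact (insert x0 (closure {x. u x \<noteq> 0}))" by (intro compact_insert test_functions_compact[OF assms(1)])
  qed (use x0 test_functions_subset[OF assms(1)] in auto)
qed

text \<open>All integrands vanish off \<open>K\<close>, and on \<open>K\<close> the cut-off changes
  neither the field nor, almost everywhere, its divergence. So the pairing that defines the
  distributional derivative is the integral controlled by the flow argument.\<close>

lemma distributional_pairing:
  fixes X :: "real^'n \<Rightarrow> real^'n"
  assumes fd: "flow_with_divergence Y L M \<tau> \<phi> D" and K: "K \<subseteq> \<Omega>" "closure {x. u x \<noteq> 0} \<subseteq> K"
    and d: "d > 0" and YX: "\<And>x. infdist x K \<le> d \<Longrightarrow> Y x = X x"
    and ae: "AE x in lborel. x \<in> K \<longrightarrow> (\<forall>i. partial_deriv i (\<lambda>y. X y $ i) x = D i x)"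
    and u: "u \<in> test_functions \<Omega>" and F: "integrable lborel F" "AE x in lborel. F x = indicator {x. infdist x K \<le> d} x * f x"
  shows "set_integrable lebesgue \<Omega> (\<lambda>x. f x * field_deriv X u x)"
    "set_integrable lebesgue \<Omega> (\<lambda>x. f x * u x * divergence X x)"
    "(LINT x:\<Omega>|lebesgue. f x * field_deriv X u x) + (LINT x:\<Omega>|lebesgue. f x * u x * divergence X x) =
      (\<integral>x. F x * flow_with_divergence.field_adjoint Y D u x \<partial>lborel)"
proof -
  interpret flow_with_divergence Y L M \<tau> \<phi> D by fact
  note [measurable] = test_functions_borel[OF u]
  obtain B where B: "B > 0" "\<And>x. \<bar>u x\<bar> \<le> B" "\<And>i x. \<bar>partial_deriv i u x\<bar> \<le> B"
    using test_functions_bounded[OF u] by metis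
  have u0: "u x = 0" "partial_deriv i u x = 0" if "x \<notin> K" for x i
    using that K(2) test_functions_eq_0[of x u] partial_deriv_eq_0_outside_support[of x u i] by blast+
  have Yi: "\<bar>Y x $ i\<bar> \<le> M" for x i using component_le_norm_cart[of "Y x" i] bounded[of x] by linarith
  have in_nbhd: "infdist x K \<le> d" if "x \<in> K" for x using that d by simp
  have i1: "integrable lborel (\<lambda>x. F x * field_deriv Y u x)"
  proof (rule integrable_mult_bounded(1)[OF F(1)])
    show "field_deriv Y u \<in> borel_measurable borel" unfolding field_deriv_def[abs_def] by measurable
    show "\<bar>field_deriv Y u x\<bar> \<le> (\<Sum>i\<in>(UNIV::'n set). M * B)" for x
      unfolding field_deriv_def
      by (rule order_trans[OF sum_abs], rule sum_mono, unfold abs_mult, intro mult_mono Yi B M_nonneg abs_ge_zero)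
  qed
  have i2: "integrable lborel (\<lambda>x. F x * (u x * (\<Sum>i\<in>UNIV. D i x)))"
  proof (rule integrable_mult_bounded(1)[OF F(1)])
    show "(\<lambda>x. u x * (\<Sum>i\<in>UNIV. D i x)) \<in> borel_measurable borel" by measurable
    show "\<bar>u x * (\<Sum>i\<in>UNIV. D i x)\<bar> \<le> B * (\<Sum>i\<in>(UNIV::'n set). L)" for x
      unfolding abs_mult
      by (rule mult_mono[OF B(2) order_trans[OF sum_abs sum_mono[OF D_bound]]]) (use B in auto)
  qed
  have e1: "AE x in lborel. indicator \<Omega> x * (f x * field_deriv X u x) = F x * field_deriv Y u x"
    using F(2)
  proof eventually_elim
    case (elim x)
    show ?case
    proof (cases "x \<in> K")
      case True
      then have "F x = f x" using elim in_nbhd[OF True] by simp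
      moreover have "field_deriv Y u x = field_deriv X u x" using YX[OF in_nbhd[OF True]] by (simp add: field_deriv_def)
      moreover have "x \<in> \<Omega>" using True K(1) by blast
      ultimately show ?thesis by simp
    next
      case False
      then show ?thesis by (simp add: field_deriv_def u0)
    qed
  qed
  have e2: "AE x in lborel. indicator \<Omega> x * (f x * u x * divergence X x) = F x * (u x * (\<Sum>i\<in>UNIV. D i x))"
    using F(2) ae
  proof eventually_elim
    case (elim x)
    show ?case
    proof (cases "x \<in> K")
      case True
      then have "F x = f x" using elim in_nbhd[OF True] by simp
      moreover have "divergence X x = (\<Sum>i\<in>UNIV. D i x)" using elim True by (simp add: divergence_def)
      moreover have "x \<in> \<Omega>" using True K(1) by blast
      ultimately show ?thesis by simp
    next
      case False
      then show ?thesis by (simp add: u0)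
    qed
  qed
  show "set_integrable lebesgue \<Omega> (\<lambda>x. f x * field_deriv X u x)"
    by (rule set_integral_lebesgue_eq_lborel(1)[OF i1 e1])
  show "set_integrable lebesgue \<Omega> (\<lambda>x. f x * u x * divergence X x)"
    by (rule set_integral_lebesgue_eq_lborel(1)[OF i2 e2])
  show "(LINT x:\<Omega>|lebesgue. f x * field_deriv X u x) + (LINT x:\<Omega>|lebesgue. f x * u x * divergence X x) =
      (\<integral>x. F x * field_adjoint u x \<partial>lborel)"
    unfolding set_integral_lebesgue_eq_lborel(2)[OF i1 e1] set_integral_lebesgue_eq_lborel(2)[OF i2 e2]
    using Bochner_Integration.integral_add[OF i1 i2] by (simp add: field_adjoint_def distrib_left)
qed

theorem upper_gradient_test_bound:
  fixes X :: "real^'n \<Rightarrow> real^'n"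
  assumes \<Omega>: "open \<Omega>" and X: "locally_Lipschitz_on \<Omega> X" and ug: "upper_gradient \<Omega> X h f"
    and u: "u \<in> test_functions \<Omega>"
  shows "\<bar>(LINT x:\<Omega>|lebesgue. f x * field_deriv X u x) + (LINT x:\<Omega>|lebesgue. f x * u x * divergence X x)\<bar>
    \<le> (LINT x:\<Omega>|lebesgue. h x * \<bar>u x\<bar>)"
proof (cases "\<Omega> = {}")
  case True
  then show ?thesis by (simp add: set_lebesgue_integral_def)
next
  case False
  obtain K where K: "compact K" "K \<noteq> {}" "K \<subseteq> \<Omega>" "closure {x. u x \<noteq> 0} \<subseteq> K"
    using test_function_support[OF u False] by blast
  obtain Y L M \<tau> \<phi> D d where fd: "flow_with_divergence Y L M \<tau> \<phi> D" and d: "d > 0" "{x. infdist x K \<le> d} \<subseteq> \<Omega>"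
    "M * \<tau> \<le> d" and YX: "\<And>x. infdist x K \<le> d \<Longrightarrow> Y x = X x"
    and ae: "AE x in lborel. x \<in> K \<longrightarrow> (\<forall>i. partial_deriv i (\<lambda>y. X y $ i) x = D i x \<and>
       ((\<lambda>t. X (x + t *\<^sub>R axis i 1) $ i) has_real_derivative D i x) (at 0))"
    by (rule cutoff_with_divergence[OF \<Omega> X K(1-3)]) (rule that)
  interpret flow_with_divergence Y L M \<tau> \<phi> D by (rule fd)
  have u': "u \<in> test_functions UNIV" using u test_functions_mono[of \<Omega> UNIV] by blast
  note [measurable] = test_functions_borel[OF u]
  define K1 where "K1 = {x. infdist x K \<le> d}"
  have K1: "compact K1" "K1 \<subseteq> \<Omega>" unfolding K1_def using K d by (auto intro!: compact_infdist_le)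
  have KK1: "x \<in> K1" if "x \<in> K" for x using that d by (simp add: K1_def)
  have f: "f \<in> L1_loc \<Omega>" and h: "h \<in> L1_loc \<Omega>" and h0: "AE x in lebesgue. x \<in> \<Omega> \<longrightarrow> 0 \<le> h x"
    using ug by (auto simp: upper_gradient_def)
  obtain F where F: "integrable lborel F" "AE x in lborel. F x = indicator K1 x * f x"
    by (rule L1_loc_borel_representative[OF f K1])
  obtain H0 where H0: "integrable lborel H0" "AE x in lborel. H0 x = indicator K1 x * h x"
    by (rule L1_loc_borel_representative[OF h K1])
  \<comment> \<open>\<open>h\<close> is nonnegative only almost everywhere on
    \<open>\<Omega>\<close>; the maximum makes \<open>H\<close> nonnegative at every point, as the
    flow estimate demands.\<close>
  define H where "H = (\<lambda>x. max 0 (H0 x))"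
  have H: "integrable lborel H" "\<And>x. H x \<ge> 0" using H0 by (auto simp: H_def)
  have HH: "AE x in lborel. H x = indicator K1 x * h x"
    using H0(2) h0[unfolded AE_lebesgue_iff]
  proof eventually_elim
    case (elim x)
    then show ?case using K1(2) by (cases "x \<in> K1") (auto simp: H_def)
  qed
  have "AE x in lborel. F x = indicator K1 x * f x \<and> H x = indicator K1 x * h x"
    using F(2) HH by eventually_elim simp
  \<comment> \<open>One Borel null set contains all points where a representative differs from the
    original on \<open>K1\<close>; the orbits have to avoid it.\<close>
  then obtain N where N: "{x \<in> space lborel. \<not> (F x = indicator K1 x * f x \<and> H x = indicator K1 x * h x)} \<subseteq> N"
      "emeasure lborel N = 0" "N \<in> sets lborel"
    by (rule AE_E)
  have N0: "N \<in> null_sets lborel" using N by auto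
  have FH: "F x = f x" "H x = h x" if x: "x \<in> K1" "x \<notin> N" for x
  proof -
    have "F x = indicator K1 x * f x \<and> H x = indicator K1 x * h x"
    proof (rule ccontr)
      assume "\<not> ?thesis"
      then have "x \<in> N" using N(1) by (intro subsetD[OF N(1)]) simp
      then show False using x by simp
    qed
    then show "F x = f x" "H x = h x" using x by auto
  qed
  have ug_ae: "AE t in lborel. AE x in lborel. (t, x) \<in> flow_domain_pos \<Omega> X \<longrightarrow>
        ennreal \<bar>f (flow \<Omega> X t x) - f x\<bar> \<le> (\<integral>\<^sup>+ s\<in>{0..t}. ennreal (h (flow \<Omega> X s x)) \<partial>lebesgue)"
  proof -
    have "AE p in lborel. case p of (t, x) \<Rightarrow> (t, x) \<in> flow_domain_pos \<Omega> X \<longrightarrow>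
        ennreal \<bar>f (flow \<Omega> X t x) - f x\<bar> \<le> (\<integral>\<^sup>+ s\<in>{0..t}. ennreal (h (flow \<Omega> X s x)) \<partial>lebesgue)"
      using ug unfolding upper_gradient_def AE_lebesgue_iff by blast
    \<comment> \<open>Fubini's theorem turns almost all pairs into almost all \<open>x\<close> for
      almost every \<open>t\<close>.\<close>
    from lborel_pair.AE_pair[OF this[folded lborel_prod]] show ?thesis by simp
  qed
  have "\<bar>\<integral>x. F x * field_adjoint u x \<partial>lborel\<bar> \<le> (\<integral>x. H x * \<bar>u x\<bar> \<partial>lborel)"
  proof (rule upper_gradient_along_flow[OF u' F(1) H])
    show "AE t in lborel. t \<in> {0<..<\<tau>} \<longrightarrow> (AE x in lborel. u x \<noteq> 0 \<longrightarrow>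
        ennreal \<bar>F (\<phi> t x) - F x\<bar> \<le> (\<integral>\<^sup>+s\<in>{0..t}. ennreal (H (\<phi> s x)) \<partial>lborel))"
      using ug_ae
    proof (rule eventually_mono, intro impI)
      fix t assume t: "t \<in> {0<..<\<tau>}"
        and tx: "AE x in lborel. (t, x) \<in> flow_domain_pos \<Omega> X \<longrightarrow>
        ennreal \<bar>f (flow \<Omega> X t x) - f x\<bar> \<le> (\<integral>\<^sup>+ s\<in>{0..t}. ennreal (h (flow \<Omega> X s x)) \<partial>lebesgue)"
      \<comment> \<open>For almost every \<open>x\<close> the endpoint, almost all of the orbit and
        the starting point avoid \<open>N\<close>, so \<open>F\<close> and \<open>H\<close> may
        replace \<open>f\<close> and \<open>h\<close> in the inequality.\<close>
      have a1: "AE x in lborel. \<phi> t x \<notin> N" by (rule AE_\<phi>_avoids_null_set[OF N0]) (use t in auto)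
      have a2: "AE x in lborel. AE s in lborel. s \<in> {0..t} \<longrightarrow> \<phi> s x \<notin> N"
        by (rule AE_orbit_avoids_null_set[OF N0]) (use t in auto)
      have a3: "AE x in lborel. x \<notin> N" by (rule AE_not_in[OF N0])
      show "AE x in lborel. u x \<noteq> 0 \<longrightarrow>
        ennreal \<bar>F (\<phi> t x) - F x\<bar> \<le> (\<integral>\<^sup>+s\<in>{0..t}. ennreal (H (\<phi> s x)) \<partial>lborel)"
        using tx a1 a2 a3
      proof (eventually_elim, intro impI)
        fix x
        assume ineq: "(t, x) \<in> flow_domain_pos \<Omega> X \<longrightarrow>
            ennreal \<bar>f (flow \<Omega> X t x) - f x\<bar> \<le> (\<integral>\<^sup>+ s\<in>{0..t}. ennreal (h (flow \<Omega> X s x)) \<partial>lebesgue)"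
          and 1: "\<phi> t x \<notin> N" and 2: "AE s in lborel. s \<in> {0..t} \<longrightarrow> \<phi> s x \<notin> N" and 3: "x \<notin> N" and ux: "u x \<noteq> 0"
        have xK: "x \<in> K" using ux K(4) test_functions_eq_0[of x u] by blast
        note fl = flow_eq_\<phi>[OF \<Omega> X xK d(2,3) YX]
        have tt: "t \<in> {-\<tau><..<\<tau>}" using t by auto
        have dom: "(t, x) \<in> flow_domain_pos \<Omega> X"
          using fl(1)[OF _ tt] xK K(3) t by (auto simp: flow_domain_pos_def)
        have "F (\<phi> t x) = f (flow \<Omega> X t x)" using fl(2,3)[OF _ tt] FH(1)[of "\<phi> t x"] 1 by (simp add: K1_def)
        moreover have "F x = f x" using FH(1)[OF KK1[OF xK] 3] .
        ultimately have "ennreal \<bar>F (\<phi> t x) - F x\<bar> \<le> (\<integral>\<^sup>+ s\<in>{0..t}. ennreal (h (flow \<Omega> X s x)) \<partial>lebesgue)"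
          using ineq dom by simp
        also have "\<dots> = (\<integral>\<^sup>+ s\<in>{0..t}. ennreal (h (flow \<Omega> X s x)) \<partial>lborel)" by (rule nn_integral_completion)
        also have "\<dots> = (\<integral>\<^sup>+ s\<in>{0..t}. ennreal (H (\<phi> s x)) \<partial>lborel)"
        proof (rule nn_integral_cong_AE)
          show "AE s in lborel. ennreal (h (flow \<Omega> X s x)) * indicator {0..t} s = ennreal (H (\<phi> s x)) * indicator {0..t} s"
            using 2
          proof eventually_elim
            case (elim s)
            show ?case
            proof (cases "s \<in> {0..t}")
              case True
              then have "s \<in> {-\<tau><..<\<tau>}" using t by auto
              from fl(2,3)[OF _ this] show ?thesis using FH(2)[of "\<phi> s x"] elim True by (simp add: K1_def)
            qed simp
          qed
        qed
        finally show "ennreal \<bar>F (\<phi> t x) - F x\<bar> \<le> (\<integral>\<^sup>+s\<in>{0..t}. ennreal (H (\<phi> s x)) \<partial>lborel)" .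
      qed
    qed
  qed
  moreover have "(LINT x:\<Omega>|lebesgue. h x * \<bar>u x\<bar>) = (\<integral>x. H x * \<bar>u x\<bar> \<partial>lborel)"
  proof (rule set_integral_lebesgue_eq_lborel(2))
    obtain B where B: "\<And>x. \<bar>u x\<bar> \<le> B" using test_functions_bounded[OF u] by metis
    show "integrable lborel (\<lambda>x. H x * \<bar>u x\<bar>)"
      by (rule integrable_mult_bounded(1)[OF H(1), where B = B]) (use B in auto)
    show "AE x in lborel. indicator \<Omega> x * (h x * \<bar>u x\<bar>) = H x * \<bar>u x\<bar>"
      using HH
    proof eventually_elim
      case (elim x)
      show ?case
      proof (cases "x \<in> K")
        case True
        then show ?thesis using elim KK1[OF True] K(3) by auto
      next
        case False
        then have "u x = 0" using K(4) test_functions_eq_0[of x u] by blast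
        then show ?thesis by simp
      qed
    qed
  qed
  moreover have "AE x in lborel. x \<in> K \<longrightarrow> (\<forall>i. partial_deriv i (\<lambda>y. X y $ i) x = D i x)"
    using ae by eventually_elim simp
  ultimately show ?thesis
    using distributional_pairing(3)[OF fd K(3,4) d(1) YX _ u F(1) F(2)[unfolded K1_def]] by simp
qed

section \<open>The weak derivative as a functional\<close>

lemma locally_Lipschitz_on_iff:
  "locally_Lipschitz_on \<Omega> X \<longleftrightarrow> (\<forall>x\<in>\<Omega>. \<exists>u>0. \<exists>l. l-lipschitz_on (cball x u \<inter> \<Omega>) X)"
proof
  assume "locally_Lipschitz_on \<Omega> X"
  then have "\<forall>x\<in>\<Omega>. \<exists>u>0. \<exists>l. \<forall>t\<in>cball (0::real) u \<inter> UNIV. l-lipschitz_on (cball x u \<inter> \<Omega>) X"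
    unfolding locally_Lipschitz_on_def local_lipschitz_def by blast
  then show "\<forall>x\<in>\<Omega>. \<exists>u>0. \<exists>l. l-lipschitz_on (cball x u \<inter> \<Omega>) X"
    by (metis IntI UNIV_I centre_in_cball less_imp_le)
next
  assume "\<forall>x\<in>\<Omega>. \<exists>u>0. \<exists>l. l-lipschitz_on (cball x u \<inter> \<Omega>) X"
  then show "locally_Lipschitz_on \<Omega> X"
    unfolding locally_Lipschitz_on_def local_lipschitz_def by blast
qed

lemma locally_Lipschitz_on_add:
  assumes "locally_Lipschitz_on \<Omega> X" "locally_Lipschitz_on \<Omega> Y"
  shows "locally_Lipschitz_on \<Omega> (\<lambda>x. X x + Y x)"
  unfolding locally_Lipschitz_on_iff
proof
  fix x assume x: "x \<in> \<Omega>"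
  obtain u l where u: "u > 0" "l-lipschitz_on (cball x u \<inter> \<Omega>) X"
    using assms(1) x unfolding locally_Lipschitz_on_iff by blast
  obtain v m where v: "v > 0" "m-lipschitz_on (cball x v \<inter> \<Omega>) Y"
    using assms(2) x unfolding locally_Lipschitz_on_iff by blast
  have "(l + m)-lipschitz_on (cball x (min u v) \<inter> \<Omega>) (\<lambda>x. X x + Y x)"
    by (intro lipschitz_on_add lipschitz_on_subset[OF u(2)] lipschitz_on_subset[OF v(2)]) auto
  then show "\<exists>u>0. \<exists>l. l-lipschitz_on (cball x u \<inter> \<Omega>) (\<lambda>x. X x + Y x)"
    using u(1) v(1) by (intro exI[of _ "min u v"]) auto
qed

lemma locally_Lipschitz_on_scaleR:
  assumes "locally_Lipschitz_on \<Omega> X"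
  shows "locally_Lipschitz_on \<Omega> (\<lambda>x. c *\<^sub>R X x)"
  unfolding locally_Lipschitz_on_iff
proof
  fix x assume "x \<in> \<Omega>"
  then obtain u l where "u > 0" "l-lipschitz_on (cball x u \<inter> \<Omega>) X"
    using assms unfolding locally_Lipschitz_on_iff by blast
  then show "\<exists>u>0. \<exists>l. l-lipschitz_on (cball x u \<inter> \<Omega>) (\<lambda>x. c *\<^sub>R X x)"
    by (intro exI[of _ u] exI[of _ "\<bar>c\<bar> * l"] conjI lipschitz_on_cmult)
qed

lemma locally_Lipschitz_on_0: "locally_Lipschitz_on \<Omega> (\<lambda>x. 0)"
  using local_lipschitz_constI[of "UNIV :: real set" \<Omega> "\<lambda>_. 0"] by (simp add: locally_Lipschitz_on_def)

lemma locally_Lipschitz_on_lincomb: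
  assumes "finite S" "\<And>j. j \<in> S \<Longrightarrow> locally_Lipschitz_on \<Omega> (X j)"
  shows "locally_Lipschitz_on \<Omega> (\<lambda>x. \<Sum>j\<in>S. c j *\<^sub>R X j x)"
  using assms
proof (induction S)
  case empty
  then show ?case by (simp add: locally_Lipschitz_on_0)
next
  case (insert i S)
  have "locally_Lipschitz_on \<Omega> (\<lambda>x. c i *\<^sub>R X i x + (\<Sum>j\<in>S. c j *\<^sub>R X j x))"
    by (intro locally_Lipschitz_on_add locally_Lipschitz_on_scaleR insert) (use insert.prems in auto)
  then show ?case using insert.hyps by simp
qed

text \<open>The third part serves the linearity of the divergence in the field:
  \<open>partial_deriv\<close> is total, but additive only where the derivatives exist, and this is
  secured for almost every point with \<open>u x \<noteq> 0\<close>.\<close>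

lemma field_pairing_integrable:
  assumes \<Omega>: "open \<Omega>" and X: "locally_Lipschitz_on \<Omega> X" and f: "f \<in> L1_loc \<Omega>" and u: "u \<in> test_functions \<Omega>"
  shows "set_integrable lebesgue \<Omega> (\<lambda>x. f x * field_deriv X u x)"
    and "set_integrable lebesgue \<Omega> (\<lambda>x. f x * u x * divergence X x)"
    and "AE x in lborel. x \<in> \<Omega> \<longrightarrow> u x \<noteq> 0 \<longrightarrow>
      (\<forall>i. ((\<lambda>t. X (x + t *\<^sub>R axis i 1) $ i) has_real_derivative partial_deriv i (\<lambda>y. X y $ i) x) (at 0))"
proof -
  have "set_integrable lebesgue \<Omega> (\<lambda>x. f x * field_deriv X u x) \<and>
    set_integrable lebesgue \<Omega> (\<lambda>x. f x * u x * divergence X x) \<and>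
    (AE x in lborel. x \<in> \<Omega> \<longrightarrow> u x \<noteq> 0 \<longrightarrow>
      (\<forall>i. ((\<lambda>t. X (x + t *\<^sub>R axis i 1) $ i) has_real_derivative partial_deriv i (\<lambda>y. X y $ i) x) (at 0)))"
  proof (cases "\<Omega> = {}")
    case True
    then show ?thesis by (simp add: set_integrable_def)
  next
    case False
    obtain K where K: "compact K" "K \<noteq> {}" "K \<subseteq> \<Omega>" "closure {x. u x \<noteq> 0} \<subseteq> K"
      using test_function_support[OF u False] by blast
    obtain Y L M \<tau> \<phi> D d where fd: "flow_with_divergence Y L M \<tau> \<phi> D" and d: "d > 0" "{x. infdist x K \<le> d} \<subseteq> \<Omega>"
      "M * \<tau> \<le> d" and YX: "\<And>x. infdist x K \<le> d \<Longrightarrow> Y x = X x"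
      and ae: "AE x in lborel. x \<in> K \<longrightarrow> (\<forall>i. partial_deriv i (\<lambda>y. X y $ i) x = D i x \<and>
         ((\<lambda>t. X (x + t *\<^sub>R axis i 1) $ i) has_real_derivative D i x) (at 0))"
      by (rule cutoff_with_divergence[OF \<Omega> X K(1-3)]) (rule that)
    have K1: "compact {x. infdist x K \<le> d}" using K d by (auto intro!: compact_infdist_le)
    obtain F where F: "integrable lborel F" "AE x in lborel. F x = indicator {x. infdist x K \<le> d} x * f x"
      by (rule L1_loc_borel_representative[OF f K1 d(2)])
    have ae1: "AE x in lborel. x \<in> K \<longrightarrow> (\<forall>i. partial_deriv i (\<lambda>y. X y $ i) x = D i x)"
      using ae by eventually_elim simp
    have ae2: "AE x in lborel. x \<in> \<Omega> \<longrightarrow> u x \<noteq> 0 \<longrightarrow>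
      (\<forall>i. ((\<lambda>t. X (x + t *\<^sub>R axis i 1) $ i) has_real_derivative partial_deriv i (\<lambda>y. X y $ i) x) (at 0))"
      using ae
    proof (rule eventually_mono, intro impI allI)
      fix x i
      assume *: "x \<in> K \<longrightarrow> (\<forall>i. partial_deriv i (\<lambda>y. X y $ i) x = D i x \<and>
         ((\<lambda>t. X (x + t *\<^sub>R axis i 1) $ i) has_real_derivative D i x) (at 0))" and "u x \<noteq> 0"
      then have "x \<in> K" using K(4) test_functions_eq_0[of x u] by blast
      then show "((\<lambda>t. X (x + t *\<^sub>R axis i 1) $ i) has_real_derivative partial_deriv i (\<lambda>y. X y $ i) x) (at 0)"
        using * by simp
    qed
    note pair = distributional_pairing[OF fd K(3,4) d(1) YX ae1 u F]
    from pair(1,2) ae2 show ?thesis by blast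
  qed
  then show "set_integrable lebesgue \<Omega> (\<lambda>x. f x * field_deriv X u x)"
    "set_integrable lebesgue \<Omega> (\<lambda>x. f x * u x * divergence X x)"
    "AE x in lborel. x \<in> \<Omega> \<longrightarrow> u x \<noteq> 0 \<longrightarrow>
      (\<forall>i. ((\<lambda>t. X (x + t *\<^sub>R axis i 1) $ i) has_real_derivative partial_deriv i (\<lambda>y. X y $ i) x) (at 0))"
    by blast+
qed

text \<open>The distribution \<open>Xf\<close> tested with \<open>u\<close>. A distributional
  derivative in \<open>L1_loc\<close> is a locally integrable density of this functional.\<close>

definition weak_deriv :: "(real^'n) set \<Rightarrow> (real^'n \<Rightarrow> real^'n) \<Rightarrow> (real^'n \<Rightarrow> real) \<Rightarrow> (real^'n \<Rightarrow> real) \<Rightarrow> real" where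
  "weak_deriv \<Omega> X f u = - (LINT x:\<Omega>|lebesgue. f x * field_deriv X u x) - (LINT x:\<Omega>|lebesgue. f x * u x * divergence X x)"

lemma weak_deriv_add:
  assumes \<Omega>: "open \<Omega>" and X: "locally_Lipschitz_on \<Omega> X" and f: "f \<in> L1_loc \<Omega>"
    and u: "u \<in> test_functions \<Omega>" and v: "v \<in> test_functions \<Omega>"
  shows "weak_deriv \<Omega> X f (\<lambda>x. u x + v x) = weak_deriv \<Omega> X f u + weak_deriv \<Omega> X f v"
proof -
  have "field_deriv X (\<lambda>x. u x + v x) x = field_deriv X u x + field_deriv X v x" for x
    by (simp add: field_deriv_def partial_deriv_linear(1)[OF test_functions_differentiable[OF u] test_functions_differentiable[OF v]]
        distrib_left sum.distrib)
  then show ?thesis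
    using set_integral_add(2)[OF field_pairing_integrable(1)[OF \<Omega> X f u] field_pairing_integrable(1)[OF \<Omega> X f v]]
      set_integral_add(2)[OF field_pairing_integrable(2)[OF \<Omega> X f u] field_pairing_integrable(2)[OF \<Omega> X f v]]
    by (simp add: weak_deriv_def distrib_left distrib_right)
qed

lemma weak_deriv_cmult:
  assumes u: "u \<in> test_functions \<Omega>"
  shows "weak_deriv \<Omega> X f (\<lambda>x. c * u x) = c * weak_deriv \<Omega> X f u"
proof -
  have "field_deriv X (\<lambda>x. c * u x) x = c * field_deriv X u x" for x
    by (simp add: field_deriv_def partial_deriv_linear(2)[OF test_functions_differentiable[OF u] test_functions_differentiable[OF u]]
        sum_distrib_left mult_ac)
  moreover have "(\<lambda>x. f x * (c * field_deriv X u x)) = (\<lambda>x. c * (f x * field_deriv X u x))"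
    "(\<lambda>x. f x * (c * u x) * divergence X x) = (\<lambda>x. c * (f x * u x * divergence X x))"
    by (simp_all add: mult_ac)
  ultimately show ?thesis
    by (simp add: weak_deriv_def right_diff_distrib)
qed

lemma set_integral_lincomb:
  fixes g :: "'b \<Rightarrow> 'a \<Rightarrow> real"
  assumes g: "\<And>j. j \<in> S \<Longrightarrow> set_integrable M \<Omega> (g j)" and G: "set_integrable M \<Omega> G"
    and eq: "AE x in M. x \<in> \<Omega> \<longrightarrow> G x = (\<Sum>j\<in>S. c j * g j x)"
  shows "(LINT x:\<Omega>|M. G x) = (\<Sum>j\<in>S. c j * (LINT x:\<Omega>|M. g j x))"
proof -
  have int: "integrable M (\<lambda>x. c j * (indicator \<Omega> x *\<^sub>R g j x))" if "j \<in> S" for j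
    using g[OF that] unfolding set_integrable_def by (rule integrable_mult_right)
  have isum: "integrable M (\<lambda>x. \<Sum>j\<in>S. c j * (indicator \<Omega> x *\<^sub>R g j x))"
    by (rule Bochner_Integration.integrable_sum[OF int])
  have "(LINT x:\<Omega>|M. G x) = (\<integral>x. (\<Sum>j\<in>S. c j * (indicator \<Omega> x *\<^sub>R g j x)) \<partial>M)"
    unfolding set_lebesgue_integral_def
  proof (rule integral_cong_AE)
    show "(\<lambda>x. indicator \<Omega> x *\<^sub>R G x) \<in> borel_measurable M" using G unfolding set_integrable_def by auto
    show "(\<lambda>x. \<Sum>j\<in>S. c j * (indicator \<Omega> x *\<^sub>R g j x)) \<in> borel_measurable M"
      using isum by (rule borel_measurable_integrable)
    show "AE x in M. indicator \<Omega> x *\<^sub>R G x = (\<Sum>j\<in>S. c j * (indicator \<Omega> x *\<^sub>R g j x))"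
      using eq by eventually_elim (auto simp: indicator_def)
  qed
  also have "\<dots> = (\<Sum>j\<in>S. \<integral>x. c j * (indicator \<Omega> x *\<^sub>R g j x) \<partial>M)"
    by (rule Bochner_Integration.integral_sum[OF int])
  finally show ?thesis by (simp add: set_lebesgue_integral_def)
qed

text \<open>The term with \<open>field_deriv\<close> is linear in the field at every point. The
  divergence term is so almost everywhere: where \<open>u\<close> vanishes both sides are 0, and
  elsewhere almost every point has all the partial derivatives.\<close>

lemma weak_deriv_lincomb:
  assumes \<Omega>: "open \<Omega>" and S: "finite S" and X: "\<And>j. j \<in> S \<Longrightarrow> locally_Lipschitz_on \<Omega> (X j)" and f: "f \<in> L1_loc \<Omega>"
    and u: "u \<in> test_functions \<Omega>"
  shows "weak_deriv \<Omega> (\<lambda>x. \<Sum>j\<in>S. c j *\<^sub>R X j x) f u = (\<Sum>j\<in>S. c j * weak_deriv \<Omega> (X j) f u)"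
proof -
  let ?X = "\<lambda>x. \<Sum>j\<in>S. c j *\<^sub>R X j x"
  have Xc: "locally_Lipschitz_on \<Omega> ?X" by (rule locally_Lipschitz_on_lincomb[OF S X])
  have fd: "field_deriv ?X u x = (\<Sum>j\<in>S. c j * field_deriv (X j) u x)" for x
  proof -
    have "field_deriv ?X u x = (\<Sum>i\<in>UNIV. \<Sum>j\<in>S. c j * (X j x $ i * partial_deriv i u x))"
      by (simp add: field_deriv_def sum_distrib_right mult.assoc)
    also have "\<dots> = (\<Sum>j\<in>S. \<Sum>i\<in>UNIV. c j * (X j x $ i * partial_deriv i u x))" by (rule sum.swap)
    finally show ?thesis by (simp add: field_deriv_def sum_distrib_left)
  qed
  have "(LINT x:\<Omega>|lebesgue. f x * field_deriv ?X u x) = (\<Sum>j\<in>S. c j * (LINT x:\<Omega>|lebesgue. f x * field_deriv (X j) u x))"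
  proof (rule set_integral_lincomb)
    show "set_integrable lebesgue \<Omega> (\<lambda>x. f x * field_deriv (X j) u x)" if "j \<in> S" for j
      by (rule field_pairing_integrable(1)[OF \<Omega> X[OF that] f u])
    show "set_integrable lebesgue \<Omega> (\<lambda>x. f x * field_deriv ?X u x)"
      by (rule field_pairing_integrable(1)[OF \<Omega> Xc f u])
    show "AE x in lebesgue. x \<in> \<Omega> \<longrightarrow> f x * field_deriv ?X u x = (\<Sum>j\<in>S. c j * (f x * field_deriv (X j) u x))"
      by (intro AE_I2) (simp add: fd sum_distrib_left mult_ac)
  qed
  moreover have "(LINT x:\<Omega>|lebesgue. f x * u x * divergence ?X x) = (\<Sum>j\<in>S. c j * (LINT x:\<Omega>|lebesgue. f x * u x * divergence (X j) x))"
  proof (rule set_integral_lincomb)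
    show "set_integrable lebesgue \<Omega> (\<lambda>x. f x * u x * divergence (X j) x)" if "j \<in> S" for j
      by (rule field_pairing_integrable(2)[OF \<Omega> X[OF that] f u])
    show "set_integrable lebesgue \<Omega> (\<lambda>x. f x * u x * divergence ?X x)"
      by (rule field_pairing_integrable(2)[OF \<Omega> Xc f u])
    have "AE x in lborel. \<forall>j\<in>S. x \<in> \<Omega> \<longrightarrow> u x \<noteq> 0 \<longrightarrow>
      (\<forall>i. ((\<lambda>t. X j (x + t *\<^sub>R axis i 1) $ i) has_real_derivative partial_deriv i (\<lambda>y. X j y $ i) x) (at 0))"
      using field_pairing_integrable(3)[OF \<Omega> X f u] S by (intro AE_finite_allI) auto
    then show "AE x in lebesgue. x \<in> \<Omega> \<longrightarrow> f x * u x * divergence ?X x = (\<Sum>j\<in>S. c j * (f x * u x * divergence (X j) x))"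
      unfolding AE_lebesgue_iff
    proof (rule eventually_mono, intro impI)
      fix x
      assume *: "\<forall>j\<in>S. x \<in> \<Omega> \<longrightarrow> u x \<noteq> 0 \<longrightarrow>
        (\<forall>i. ((\<lambda>t. X j (x + t *\<^sub>R axis i 1) $ i) has_real_derivative partial_deriv i (\<lambda>y. X j y $ i) x) (at 0))"
        and x: "x \<in> \<Omega>"
      show "f x * u x * divergence ?X x = (\<Sum>j\<in>S. c j * (f x * u x * divergence (X j) x))"
      proof (cases "u x = 0")
        case False
        have pd: "partial_deriv i (\<lambda>y. ?X y $ i) x = (\<Sum>j\<in>S. c j * partial_deriv i (\<lambda>y. X j y $ i) x)" for i
        proof -
          have "((\<lambda>t. \<Sum>j\<in>S. c j * X j (x + t *\<^sub>R axis i 1) $ i) has_real_derivative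
              (\<Sum>j\<in>S. c j * partial_deriv i (\<lambda>y. X j y $ i) x)) (at 0)"
            using * x False by (intro DERIV_sum DERIV_cmult) auto
          then have "deriv (\<lambda>t. \<Sum>j\<in>S. c j * X j (x + t *\<^sub>R axis i 1) $ i) 0 = (\<Sum>j\<in>S. c j * partial_deriv i (\<lambda>y. X j y $ i) x)"
            by (rule DERIV_imp_deriv)
          then show ?thesis by (subst partial_deriv_def) simp
        qed
        have "divergence ?X x = (\<Sum>i\<in>UNIV. \<Sum>j\<in>S. c j * partial_deriv i (\<lambda>y. X j y $ i) x)"
          unfolding divergence_def pd ..
        also have "\<dots> = (\<Sum>j\<in>S. \<Sum>i\<in>UNIV. c j * partial_deriv i (\<lambda>y. X j y $ i) x)" by (rule sum.swap)
        also have "\<dots> = (\<Sum>j\<in>S. c j * divergence (X j) x)"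
          by (simp add: divergence_def sum_distrib_left)
        finally show ?thesis by (simp add: sum_distrib_left mult_ac)
      qed simp
    qed
  qed
  ultimately show ?thesis
    by (simp add: weak_deriv_def right_diff_distrib sum_subtractf sum_negf)
qed

section \<open>Conclusion\<close>

text \<open>\<open>L1_loc\<close> yields measurability only after restriction to compact sets; a
  countable cover by closed boxes extends it to \<open>\<Omega>\<close> by a limit. The result can
  serve as the density of a measure.\<close>

lemma L1_loc_nonneg_representative:
  fixes \<Omega> :: "(real^'n) set"
  assumes \<Omega>: "open \<Omega>" and h: "h \<in> L1_loc \<Omega>" and nn: "AE x in lebesgue. x \<in> \<Omega> \<longrightarrow> 0 \<le> h x"
  shows "\<exists>h'\<in>borel_measurable borel. (\<forall>x. 0 \<le> h' x) \<and> (\<forall>x. x \<notin> \<Omega> \<longrightarrow> h' x = 0) \<and> (AE x in lborel. x \<in> \<Omega> \<longrightarrow> h' x = h x)"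
proof (cases "\<Omega> = {}")
  case True
  then show ?thesis by (intro bexI[of _ "\<lambda>x. 0"]) auto
next
  case False
  obtain \<D> where \<D>: "countable \<D>" "\<D> \<subseteq> Pow \<Omega>" "\<And>X. X \<in> \<D> \<Longrightarrow> \<exists>a b. X = cbox a b" "\<Union>\<D> = \<Omega>"
    using open_countable_Union_open_cbox[OF \<Omega>] by metis
  have "\<D> \<noteq> {}" using \<D>(4) False by (metis Union_empty)
  define Q where "Q = from_nat_into \<D>"
  have Q: "range Q = \<D>" unfolding Q_def by (rule range_from_nat_into) fact+
  define A where "A = (\<lambda>n::nat. \<Union>i<n. Q i)"
  have Qi: "compact (Q i)" "Q i \<subseteq> \<Omega>" for i
  proof -
    have "Q i \<in> \<D>" using Q by (metis rangeI)
    then show "compact (Q i)" "Q i \<subseteq> \<Omega>" using \<D>(2,3) compact_cbox by (metis, blast)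
  qed
  have A: "compact (A n)" "A n \<subseteq> \<Omega>" for n
    unfolding A_def using Qi by (auto intro: compact_UN)
  have "(\<lambda>x. indicator \<Omega> x * h x) \<in> borel_measurable lebesgue"
  proof (rule borel_measurable_LIMSEQ_real)
    show "(\<lambda>x. indicator (A n) x * h x) \<in> borel_measurable lebesgue" for n
      using borel_measurable_integrable[OF L1_locD[OF h A[of n], unfolded set_integrable_def]] by simp
    show "(\<lambda>n. indicator (A n) x * h x) \<longlonglongrightarrow> indicator \<Omega> x * h x" for x
    proof (cases "x \<in> \<Omega>")
      case True
      then have "x \<in> \<Union>(range Q)" using \<D>(4) Q by simp
      then obtain i where i: "x \<in> Q i" by auto
      have "\<forall>\<^sub>F n in sequentially. indicator (A n) x * h x = indicator \<Omega> x * h x"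
        using eventually_gt_at_top[of i] by eventually_elim (use i True in \<open>auto simp: indicator_def A_def\<close>)
      then show ?thesis by (rule tendsto_eventually)
    next
      case False
      then have "x \<notin> A n" for n using A(2)[of n] by blast
      then show ?thesis using False by simp
    qed
  qed
  then obtain h0 where h0: "h0 \<in> borel_measurable lborel" "AE x in lborel. indicator \<Omega> x * h x = h0 x"
    using completion_ex_borel_measurable_real[of "\<lambda>x. indicator \<Omega> x * h x" lborel] by auto
  have [measurable]: "h0 \<in> borel_measurable borel" "\<Omega> \<in> sets borel" using h0(1) \<Omega> by auto
  show ?thesis
  proof (intro bexI[of _ "\<lambda>x. indicator \<Omega> x * max 0 (h0 x)"] conjI allI impI)
    show "AE x in lborel. x \<in> \<Omega> \<longrightarrow> indicator \<Omega> x * max 0 (h0 x) = h x"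
      using h0(2) nn[unfolded AE_lebesgue_iff] by eventually_elim auto
  qed auto
qed

text \<open>Density of the test functions extends the inequality to all integrable functions. It is
  then tested on the set where \<open>G > 1\<close>, weighted by a positive integrable
  \<open>p\<close> because that set may have infinite measure.\<close>

lemma (in locally_finite_measure_on) AE_le_1_if_functional_bound:
  assumes sf: "sigma_finite_measure \<mu>" and G: "G \<in> borel_measurable borel" "\<And>x. \<bar>G x\<bar> \<le> B"
    and bd: "\<And>u. u \<in> test_functions \<Omega> \<Longrightarrow> (\<integral>x. G x * u x \<partial>\<mu>) \<le> (\<integral>x. \<bar>u x\<bar> \<partial>\<mu>)"
  shows "AE x in \<mu>. G x \<le> 1"
proof -
  interpret sigma_finite_measure \<mu> by fact
  note [measurable] = G(1)
  have B0: "B \<ge> 0" using G(2)[of 0] by linarith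
  have Gm [measurable]: "G \<in> borel_measurable \<mu>" by measurable
  have Gi: "integrable \<mu> (\<lambda>x. G x * F x)" if "integrable \<mu> F" for F
  proof (rule Bochner_Integration.integrable_bound)
    show "integrable \<mu> (\<lambda>x. B * F x)" using that by simp
    show "AE x in \<mu>. norm (G x * F x) \<le> norm (B * F x)"
      by (rule AE_I2) (use mult_right_mono[OF G(2) abs_ge_zero] B0 in \<open>auto simp: abs_mult\<close>)
  qed (use that in auto)
  have all: "(\<integral>x. G x * F x \<partial>\<mu>) \<le> (\<integral>x. \<bar>F x\<bar> \<partial>\<mu>)" if F: "integrable \<mu> F" for F
  proof (rule field_le_epsilon)
    fix e :: real assume "e > 0"
    then have e: "e / (B + 1) > 0" using B0 by simp
    obtain u where u: "u \<in> test_functions \<Omega>" "(\<integral>x. \<bar>F x - u x\<bar> \<partial>\<mu>) < e / (B + 1)"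
      by (rule test_function_approximation[OF F e])
    have iu: "integrable \<mu> u" by (rule integrable_test_function[OF u(1)])
    have iFu: "integrable \<mu> (\<lambda>x. F x - u x)" using F iu by simp
    have "(\<integral>x. G x * F x \<partial>\<mu>) = (\<integral>x. G x * u x \<partial>\<mu>) + (\<integral>x. G x * (F x - u x) \<partial>\<mu>)"
      using Gi[OF F] Gi[OF iu] by (simp add: right_diff_distrib)
    also have "(\<integral>x. G x * (F x - u x) \<partial>\<mu>) \<le> (\<integral>x. B * \<bar>F x - u x\<bar> \<partial>\<mu>)"
    proof (rule integral_mono[OF Gi[OF iFu]])
      show "integrable \<mu> (\<lambda>x. B * \<bar>F x - u x\<bar>)" using iFu by simp
      show "G x * (F x - u x) \<le> B * \<bar>F x - u x\<bar>" for x
        using mult_right_mono[OF G(2)[of x] abs_ge_zero[of "F x - u x"]] abs_ge_self[of "G x * (F x - u x)"]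
        by (simp add: abs_mult)
    qed
    also have "(\<integral>x. G x * u x \<partial>\<mu>) \<le> (\<integral>x. \<bar>u x\<bar> \<partial>\<mu>)" by (rule bd[OF u(1)])
    also have "(\<integral>x. \<bar>u x\<bar> \<partial>\<mu>) \<le> (\<integral>x. \<bar>F x\<bar> + \<bar>F x - u x\<bar> \<partial>\<mu>)"
      using F iu by (intro integral_mono) auto
    also have "\<dots> = (\<integral>x. \<bar>F x\<bar> \<partial>\<mu>) + (\<integral>x. \<bar>F x - u x\<bar> \<partial>\<mu>)" using F iu by simp
    finally have "(\<integral>x. G x * F x \<partial>\<mu>) \<le> (\<integral>x. \<bar>F x\<bar> \<partial>\<mu>) + (B + 1) * (\<integral>x. \<bar>F x - u x\<bar> \<partial>\<mu>)"
      by (simp add: algebra_simps)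
    also have "(B + 1) * (\<integral>x. \<bar>F x - u x\<bar> \<partial>\<mu>) \<le> e" using u(2) B0 by (simp add: field_simps)
    finally show "(\<integral>x. G x * F x \<partial>\<mu>) \<le> (\<integral>x. \<bar>F x\<bar> \<partial>\<mu>) + e" by simp
  qed
  obtain p :: "real^'n \<Rightarrow> real" where pm [measurable]: "p \<in> borel_measurable \<mu>" and pi: "integrable \<mu> p" and pp: "\<And>x. p x > 0"
    using exists_positive_integrable by auto
  define A where "A = {x. G x > 1}"
  have [measurable]: "A \<in> sets borel" unfolding A_def by measurable
  have iA: "integrable \<mu> (\<lambda>x. indicator A x * p x)"
    by (rule Bochner_Integration.integrable_bound[OF pi]) (auto simp: indicator_def)
  let ?d = "\<lambda>x. G x * (indicator A x * p x) - indicator A x * p x"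
  have d0: "?d x \<ge> 0" for x using pp[of x] by (auto simp: A_def indicator_def)
  have di: "integrable \<mu> ?d" using Gi[OF iA] iA by simp
  have "(\<integral>x. ?d x \<partial>\<mu>) \<le> 0"
    using all[OF iA] Gi[OF iA] iA pp by (simp add: abs_mult less_imp_le)
  then have "(\<integral>x. ?d x \<partial>\<mu>) = 0" by (rule antisym) (rule Bochner_Integration.integral_nonneg, rule d0)
  then have "AE x in \<mu>. ?d x = 0" using integral_nonneg_eq_0_iff_AE[OF di] d0 by auto
  then show ?thesis
  proof (rule eventually_mono)
    fix x assume "?d x = 0"
    then show "G x \<le> 1" using pp[of x] by (auto simp: A_def indicator_def split: if_splits)
  qed
qed

text \<open>Duality of the Euclidean norm, tested on rational vectors so that null sets can be collected.\<close>

lemma sum_squares_le_if_rational_directions: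
  fixes g :: "nat \<Rightarrow> real"
  assumes S: "finite S" and h: "h \<ge> 0"
    and q: "\<And>q. q \<in> S \<rightarrow>\<^sub>E \<rat> \<Longrightarrow> (\<Sum>j\<in>S. q j * g j) \<le> sqrt (\<Sum>j\<in>S. (q j)\<^sup>2) * h"
  shows "(\<Sum>j\<in>S. (g j)\<^sup>2) \<le> h\<^sup>2"
proof -
  have "\<exists>r\<in>\<rat>. g j < r \<and> r < g j + 1 / real (Suc m)" for j and m :: nat
    by (rule Rats_dense_in_real) simp
  then obtain r where r: "\<And>j m. r j m \<in> \<rat>" "\<And>j m. g j < r j m" "\<And>j m. r j m < g j + 1 / real (Suc m)" by metis
  have lim: "r j \<longlonglongrightarrow> g j" for j
  proof (rule tendsto_sandwich)
    show "\<forall>\<^sub>F m in sequentially. g j \<le> r j m" "\<forall>\<^sub>F m in sequentially. r j m \<le> g j + 1 / real (Suc m)"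
      using r(2,3) by (auto intro!: always_eventually less_imp_le)
    show "(\<lambda>m. g j + 1 / real (Suc m)) \<longlonglongrightarrow> g j"
      using tendsto_add[OF tendsto_const[of "g j"] LIMSEQ_Suc[OF lim_1_over_n, where ?'a1 = real]] by simp
  qed simp
  define s where "s = (\<Sum>j\<in>S. (g j)\<^sup>2)"
  have s0: "s \<ge> 0" unfolding s_def by (rule sum_nonneg) simp
  have "(\<Sum>j\<in>S. g j * g j) \<le> sqrt (\<Sum>j\<in>S. (g j)\<^sup>2) * h"
  proof (rule LIMSEQ_le)
    show "(\<lambda>m. \<Sum>j\<in>S. r j m * g j) \<longlonglongrightarrow> (\<Sum>j\<in>S. g j * g j)" by (intro tendsto_intros lim)
    show "(\<lambda>m. sqrt (\<Sum>j\<in>S. (r j m)\<^sup>2) * h) \<longlonglongrightarrow> sqrt (\<Sum>j\<in>S. (g j)\<^sup>2) * h" by (intro tendsto_intros lim)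
    \<comment> \<open>\<open>restrict\<close> places the vector among the extensional functions on
      \<open>S\<close>, as the hypothesis asks.\<close>
    have "(\<Sum>j\<in>S. r j m * g j) \<le> sqrt (\<Sum>j\<in>S. (r j m)\<^sup>2) * h" for m
      using q[of "restrict (\<lambda>j. r j m) S"] r(1) by simp
    then show "\<exists>N. \<forall>m\<ge>N. (\<Sum>j\<in>S. r j m * g j) \<le> sqrt (\<Sum>j\<in>S. (r j m)\<^sup>2) * h" by blast
  qed
  then have "sqrt s * sqrt s \<le> sqrt s * h" using s0 by (simp add: s_def power2_eq_square)
  then have "sqrt s \<le> h" using s0 h mult_le_cancel_left_pos[of "sqrt s" "sqrt s" h] by (cases "s = 0") simp_all
  then have "(sqrt s)\<^sup>2 \<le> h\<^sup>2" using s0 by (intro power_mono) auto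
  then show ?thesis using s0 by (simp add: s_def)
qed

theorem theorem1p4:
  fixes \<Omega> :: "(real^'n) set"
    and X :: "nat \<Rightarrow> real^'n \<Rightarrow> real^'n"
    and k :: nat
    and f h :: "real^'n \<Rightarrow> real"
  assumes "open \<Omega>"
    and "\<And>j. j \<in> {1..k} \<Longrightarrow> locally_Lipschitz_on \<Omega> (X j)"
    and "h \<in> L1_loc \<Omega>"
    and "f \<in> L1_loc \<Omega>"
    and "\<And>c :: nat \<Rightarrow> real. (\<Sum>j=1..k. (c j)\<^sup>2) \<le> 1 \<Longrightarrow>
           upper_gradient \<Omega> (\<lambda>x. \<Sum>j=1..k. c j *\<^sub>R X j x) h f"
  shows "\<exists>g :: nat \<Rightarrow> real^'n \<Rightarrow> real.
           (\<forall>j\<in>{1..k}. distributional_deriv \<Omega> (X j) f (g j)) \<and>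
           (AE x in lebesgue. x \<in> \<Omega> \<longrightarrow> (\<Sum>j=1..k. (g j x)\<^sup>2) \<le> (h x)\<^sup>2)"
proof -
  note \<Omega> = assms(1) and X = assms(2) and h = assms(3) and f = assms(4) and ug = assms(5)
  \<comment> \<open>The vector \<open>c = 0\<close> is admissible for every \<open>k\<close>,
    including \<open>k = 0\<close>, and its upper gradient condition contains the nonnegativity of
    \<open>h\<close>.\<close>
  have "AE x in lebesgue. x \<in> \<Omega> \<longrightarrow> 0 \<le> h x"
    using ug[of "\<lambda>_. 0"] by (simp add: upper_gradient_def)
  from L1_loc_nonneg_representative[OF \<Omega> h this] obtain h' where h': "h' \<in> borel_measurable borel" "\<And>x. 0 \<le> h' x"
    "\<And>x. x \<notin> \<Omega> \<Longrightarrow> h' x = 0" "AE x in lborel. x \<in> \<Omega> \<longrightarrow> h' x = h x" by blast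
  note [measurable] = h'(1)
  have [measurable]: "\<Omega> \<in> sets borel" using \<Omega> by auto
  \<comment> \<open>For the measure \<open>h dx\<close> the bound on each functional is exactly the
    \<open>L^1\<close> norm of \<open>u\<close>.\<close>
  define \<mu> where "\<mu> = density lborel (\<lambda>x. ennreal (h' x))"
  have h'K: "integrable lborel (\<lambda>x. indicator K x * h' x)" if K: "compact K" "K \<subseteq> \<Omega>" for K
  proof -
    obtain F where F: "integrable lborel F" "AE x in lborel. F x = indicator K x * h x"
      by (rule L1_loc_borel_representative[OF h K])
    have [measurable]: "K \<in> sets borel" using K(1) by (simp add: borel_compact)
    have "AE x in lborel. F x = indicator K x * h' x"
      using F(2) h'(4) by eventually_elim (use K(2) in \<open>auto simp: indicator_def\<close>)
    then show ?thesis by (intro integrable_cong_AE_imp[OF F(1)]) simp_all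
  qed
  interpret locally_finite_measure_on \<Omega> \<mu>
  proof
    show "open \<Omega>" by (rule \<Omega>)
    show "sets \<mu> = sets borel" by (simp add: \<mu>_def)
    show "emeasure \<mu> K < \<infinity>" if K: "compact K" "K \<subseteq> \<Omega>" for K
    proof -
      have [measurable]: "K \<in> sets borel" using K(1) by (simp add: borel_compact)
      have "emeasure \<mu> K = (\<integral>\<^sup>+x. ennreal (indicator K x * h' x) \<partial>lborel)"
        unfolding \<mu>_def by (subst emeasure_density) (auto intro!: nn_integral_cong split: split_indicator)
      also have "\<dots> = ennreal (\<integral>x. indicator K x * h' x \<partial>lborel)"
        using h'K[OF K] h'(2) by (intro nn_integral_eq_integral) auto
      finally show ?thesis by simp
    qed
    have "emeasure \<mu> (- \<Omega>) = (\<integral>\<^sup>+x. ennreal (h' x) * indicator (- \<Omega>) x \<partial>lborel)"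
      unfolding \<mu>_def by (subst emeasure_density) auto
    also have "\<dots> = (\<integral>\<^sup>+x. 0 \<partial>(lborel :: (real^'n) measure))"
      by (intro nn_integral_cong) (auto simp: h'(3) indicator_def)
    finally show "emeasure \<mu> (- \<Omega>) = 0" by simp
  qed
  \<comment> \<open>The density \<open>h'\<close> is finite at every point, so \<open>\<mu>\<close>
    is sigma-finite even when its total mass is infinite.\<close>
  have sf: "sigma_finite_measure \<mu>"
    unfolding \<mu>_def by (subst sigma_finite_measure.sigma_finite_iff_density_finite[OF sigma_finite_lborel]) auto
  have int_\<mu>: "integrable \<mu> F \<longleftrightarrow> integrable lborel (\<lambda>x. h' x * F x)" "(\<integral>x. F x \<partial>\<mu>) = (\<integral>x. h' x * F x \<partial>lborel)"
    if "F \<in> borel_measurable borel" for F :: "real^'n \<Rightarrow> real"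
    unfolding \<mu>_def using that h'(2) by (subst integrable_density integral_density, auto)+
  have bound: "\<bar>weak_deriv \<Omega> (\<lambda>x. \<Sum>j=1..k. c j *\<^sub>R X j x) f u\<bar> \<le> (\<integral>x. \<bar>u x\<bar> \<partial>\<mu>)"
    if c: "(\<Sum>j=1..k. (c j)\<^sup>2) \<le> 1" and u: "u \<in> test_functions \<Omega>" for c u
  proof -
    note [measurable] = test_functions_borel(1)[OF u]
    have "\<bar>weak_deriv \<Omega> (\<lambda>x. \<Sum>j=1..k. c j *\<^sub>R X j x) f u\<bar> \<le> (LINT x:\<Omega>|lebesgue. h x * \<bar>u x\<bar>)"
      using upper_gradient_test_bound[OF \<Omega> locally_Lipschitz_on_lincomb[OF _ X] ug[OF c] u]
      by (simp add: weak_deriv_def)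
    also have "\<dots> = (\<integral>x. h' x * \<bar>u x\<bar> \<partial>lborel)"
    proof (rule set_integral_lebesgue_eq_lborel(2))
      show "integrable lborel (\<lambda>x. h' x * \<bar>u x\<bar>)"
        using integrable_abs[OF integrable_test_function[OF u]] by (subst (asm) int_\<mu>(1)) auto
      show "AE x in lborel. indicator \<Omega> x * (h x * \<bar>u x\<bar>) = h' x * \<bar>u x\<bar>"
        using h'(4) by eventually_elim (auto simp: indicator_def h'(3))
    qed
    also have "\<dots> = (\<integral>x. \<bar>u x\<bar> \<partial>\<mu>)" by (subst int_\<mu>(2)) auto
    finally show ?thesis .
  qed
  have ex: "\<exists>g0\<in>borel_measurable borel. (\<forall>x. \<bar>g0 x\<bar> \<le> 1) \<and> (\<forall>u\<in>test_functions \<Omega>. weak_deriv \<Omega> (X j) f u = (\<integral>x. g0 x * u x \<partial>\<mu>))"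
    if j: "j \<in> {1..k}" for j
  proof -
    \<comment> \<open>The \<open>j\<close>-th unit vector turns the linear combination into
      \<open>X j\<close>.\<close>
    define c :: "nat \<Rightarrow> real" where "c = (\<lambda>i. if i = j then 1 else 0)"
    have c: "(\<Sum>i=1..k. (c i)\<^sup>2) \<le> 1" using j by (simp add: c_def if_distrib[of "\<lambda>y. y\<^sup>2"] cong: if_cong)
    have cX: "(\<lambda>x. \<Sum>i=1..k. c i *\<^sub>R X i x) = X j"
      using j by (simp add: c_def if_distrib[of "\<lambda>y. y *\<^sub>R _"] cong: if_cong)
    show ?thesis
    proof (rule bounded_functional_extension[of "weak_deriv \<Omega> (X j) f"])
      show "weak_deriv \<Omega> (X j) f (\<lambda>x. u x + v x) = weak_deriv \<Omega> (X j) f u + weak_deriv \<Omega> (X j) f v"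
        if "u \<in> test_functions \<Omega>" "v \<in> test_functions \<Omega>" for u v
        by (rule weak_deriv_add[OF \<Omega> X[OF j] f that])
      show "weak_deriv \<Omega> (X j) f (\<lambda>x. c * u x) = c * weak_deriv \<Omega> (X j) f u" if "u \<in> test_functions \<Omega>" for c u
        by (rule weak_deriv_cmult[OF that])
      show "\<bar>weak_deriv \<Omega> (X j) f u\<bar> \<le> (\<integral>x. \<bar>u x\<bar> \<partial>\<mu>)" if "u \<in> test_functions \<Omega>" for u
        using bound[OF c that] unfolding cX .
    next
      fix S assume S: "\<And>F G. \<lbrakk>integrable \<mu> F; integrable \<mu> G\<rbrakk> \<Longrightarrow> S (\<lambda>x. F x + G x) = S F + S G"
        "\<And>c F. integrable \<mu> F \<Longrightarrow> S (\<lambda>x. c * F x) = c * S F"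
        "\<And>F. integrable \<mu> F \<Longrightarrow> \<bar>S F\<bar> \<le> (\<integral>x. \<bar>F x\<bar> \<partial>\<mu>)"
        "\<And>u. u \<in> test_functions \<Omega> \<Longrightarrow> S u = weak_deriv \<Omega> (X j) f u"
      obtain g0 where "g0 \<in> borel_measurable borel" "\<forall>x. \<bar>g0 x\<bar> \<le> 1" "\<forall>F. integrable \<mu> F \<longrightarrow> S F = (\<integral>x. g0 x * F x \<partial>\<mu>)"
        using bounded_functional_density[OF sf S(1-3)] by blast
      then show ?thesis using S(4) integrable_test_function by (intro bexI[of _ g0]) auto
    qed
  qed
  define g0 where "g0 = (\<lambda>j. SOME g0. g0 \<in> borel_measurable borel \<and> (\<forall>x. \<bar>g0 x\<bar> \<le> 1) \<and>
      (\<forall>u\<in>test_functions \<Omega>. weak_deriv \<Omega> (X j) f u = (\<integral>x. g0 x * u x \<partial>\<mu>)))"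
  have g0: "g0 j \<in> borel_measurable borel" "\<And>x. \<bar>g0 j x\<bar> \<le> 1"
    "\<And>u. u \<in> test_functions \<Omega> \<Longrightarrow> weak_deriv \<Omega> (X j) f u = (\<integral>x. g0 j x * u x \<partial>\<mu>)" if j: "j \<in> {1..k}" for j
    using someI_ex[of "\<lambda>g0. g0 \<in> borel_measurable borel \<and> (\<forall>x. \<bar>g0 x\<bar> \<le> 1) \<and>
      (\<forall>u\<in>test_functions \<Omega>. weak_deriv \<Omega> (X j) f u = (\<integral>x. g0 x * u x \<partial>\<mu>))"] ex[OF j]
    unfolding g0_def by blast+
  have g0i: "integrable \<mu> (\<lambda>x. g0 j x * u x)" if j: "j \<in> {1..k}" and u: "u \<in> test_functions \<Omega>" for j u
  proof (rule Bochner_Integration.integrable_bound[OF integrable_test_function[OF u]])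
    note [measurable] = g0(1)[OF j] test_functions_borel(1)[OF u]
    show "(\<lambda>x. g0 j x * u x) \<in> borel_measurable \<mu>" by measurable
    show "AE x in \<mu>. norm (g0 j x * u x) \<le> norm (u x)"
      by (rule AE_I2) (use mult_right_mono[OF g0(2)[OF j] abs_ge_zero] in \<open>auto simp: abs_mult\<close>)
  qed
  \<comment> \<open>Back from densities for \<open>h dx\<close> to densities for \<open>dx\<close>;
    local integrability is inherited from \<open>h'\<close> because
    \<open>\<bar>g0 j x\<bar> \<le> 1\<close>.\<close>
  define g where "g = (\<lambda>j x. h' x * g0 j x)"
  have dist: "distributional_deriv \<Omega> (X j) f (g j)" if j: "j \<in> {1..k}" for j
    unfolding distributional_deriv_def
  proof (intro conjI ballI f)
    note [measurable] = g0(1)[OF j]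
    have gb: "g j \<in> borel_measurable borel" unfolding g_def by measurable
    show "g j \<in> L1_loc \<Omega>"
      unfolding L1_loc_def
    proof (intro CollectI allI impI)
      fix K assume K: "compact K \<and> K \<subseteq> \<Omega>"
      have [measurable]: "K \<in> sets borel" using K by (simp add: borel_compact)
      have "integrable lborel (\<lambda>x. indicator K x * g j x)"
      proof (rule Bochner_Integration.integrable_bound[OF h'K])
        show "AE x in lborel. norm (indicator K x * g j x) \<le> norm (indicator K x * h' x)"
        proof (rule AE_I2)
          fix x
          show "norm (indicator K x * g j x) \<le> norm (indicator K x * h' x)"
            using mult_left_mono[OF g0(2)[OF j, of x] h'(2)[of x]] h'(2)[of x]
            by (simp add: g_def abs_mult indicator_def)
        qed
      qed (use K gb in auto)
      then show "set_integrable lebesgue K (g j)"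
        unfolding set_integrable_def using gb by (subst integrable_completion) auto
    qed
    fix u assume u: "u \<in> test_functions \<Omega>"
    note [measurable] = test_functions_borel(1)[OF u]
    have "(LINT x:\<Omega>|lebesgue. g j x * u x) = (\<integral>x. h' x * (g0 j x * u x) \<partial>lborel)"
    proof (rule set_integral_lebesgue_eq_lborel(2))
      show "integrable lborel (\<lambda>x. h' x * (g0 j x * u x))"
        using g0i[OF j u] by (subst (asm) int_\<mu>(1)) auto
      show "AE x in lborel. indicator \<Omega> x * (g j x * u x) = h' x * (g0 j x * u x)"
        by (rule AE_I2) (auto simp: g_def h'(3) indicator_def)
    qed
    also have "\<dots> = weak_deriv \<Omega> (X j) f u" unfolding g0(3)[OF j u] by (subst int_\<mu>(2)) auto
    finally show "(LINT x:\<Omega>|lebesgue. g j x * u x) =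
          - (LINT x:\<Omega>|lebesgue. f x * field_deriv (X j) u x) - (LINT x:\<Omega>|lebesgue. f x * u x * divergence (X j) x)"
      by (simp add: weak_deriv_def)
  qed
  \<comment> \<open>Stated for arbitrary \<open>q\<close>, since normalising a rational vector
    usually leaves the rationals; the hypothesis is applied to the unit vector
    \<open>c = q / N\<close>.\<close>
  have dir: "AE x in lborel. (\<Sum>j=1..k. q j * g j x) \<le> sqrt (\<Sum>j=1..k. (q j)\<^sup>2) * h' x" for q :: "nat \<Rightarrow> real"
  proof (cases "(\<Sum>j=1..k. (q j)\<^sup>2) = 0")
    case True
    then have "\<forall>j\<in>{1..k}. q j = 0" by (simp add: sum_nonneg_eq_0_iff)
    then show ?thesis by simp
  next
    case False
    define N where "N = sqrt (\<Sum>j=1..k. (q j)\<^sup>2)"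
    have "(\<Sum>j=1..k. (q j)\<^sup>2) \<ge> 0" by (rule sum_nonneg) simp
    then have N: "N > 0" "N\<^sup>2 = (\<Sum>j=1..k. (q j)\<^sup>2)" using False by (auto simp: N_def)
    define c where "c = (\<lambda>j. q j / N)"
    have c: "(\<Sum>j=1..k. (c j)\<^sup>2) \<le> 1"
      using N by (simp add: c_def power_divide sum_divide_distrib[symmetric])
    define G where "G = (\<lambda>x. \<Sum>j=1..k. c j * g0 j x)"
    have Gb: "G \<in> borel_measurable borel" unfolding G_def using g0(1) by (intro borel_measurable_sum borel_measurable_times) auto
    have "AE x in \<mu>. G x \<le> 1"
    proof (rule AE_le_1_if_functional_bound[OF sf Gb])
      show "\<bar>G x\<bar> \<le> (\<Sum>j=1..k. \<bar>c j\<bar> * 1)" for x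
        unfolding G_def
        by (rule order_trans[OF sum_abs], rule sum_mono, unfold abs_mult, intro mult_left_mono g0) auto
      fix u assume u: "u \<in> test_functions \<Omega>"
      have "(\<integral>x. G x * u x \<partial>\<mu>) = (\<integral>x. (\<Sum>j=1..k. c j * (g0 j x * u x)) \<partial>\<mu>)"
        by (simp add: G_def sum_distrib_right mult.assoc)
      also have "\<dots> = (\<Sum>j=1..k. (\<integral>x. c j * (g0 j x * u x) \<partial>\<mu>))"
        by (rule Bochner_Integration.integral_sum) (intro integrable_mult_right g0i u)
      also have "\<dots> = (\<Sum>j=1..k. c j * weak_deriv \<Omega> (X j) f u)"
        by (rule sum.cong) (simp_all add: g0(3) u)
      also have "\<dots> = weak_deriv \<Omega> (\<lambda>x. \<Sum>j=1..k. c j *\<^sub>R X j x) f u"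
        by (rule weak_deriv_lincomb[symmetric]) (use \<Omega> X f u in auto)
      also have "\<dots> \<le> (\<integral>x. \<bar>u x\<bar> \<partial>\<mu>)" using bound[OF c u] by linarith
      finally show "(\<integral>x. G x * u x \<partial>\<mu>) \<le> (\<integral>x. \<bar>u x\<bar> \<partial>\<mu>)" .
    qed
    \<comment> \<open>Almost everywhere for \<open>\<mu>\<close> says nothing where
      \<open>h' = 0\<close>, but there every \<open>g j\<close> vanishes.\<close>
    then have "AE x in lborel. 0 < ennreal (h' x) \<longrightarrow> G x \<le> 1"
      unfolding \<mu>_def by (subst (asm) AE_density) auto
    then show ?thesis
    proof (rule eventually_mono)
      fix x assume *: "0 < ennreal (h' x) \<longrightarrow> G x \<le> 1"
      have "(\<Sum>j=1..k. q j * g j x) = N * (h' x * G x)"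
        using N(1) by (simp add: G_def g_def c_def sum_distrib_left mult_ac)
      also have "h' x * G x \<le> h' x"
        using * h'(2)[of x] mult_left_mono[of "G x" 1 "h' x"] by (cases "h' x = 0") auto
      finally show "(\<Sum>j=1..k. q j * g j x) \<le> sqrt (\<Sum>j=1..k. (q j)\<^sup>2) * h' x"
        using N(1) unfolding N_def[symmetric] by simp
    qed
  qed
  \<comment> \<open>Extensional rational vectors on a finite index set are countable, so the
    exceptional null sets of \<open>dir\<close> can be united into one.\<close>
  have "countable ({1..k} \<rightarrow>\<^sub>E (\<rat> :: real set))" by (intro countable_PiE countable_rat) auto
  then have "AE x in lborel. \<forall>q\<in>{1..k} \<rightarrow>\<^sub>E \<rat>. (\<Sum>j=1..k. q j * g j x) \<le> sqrt (\<Sum>j=1..k. (q j)\<^sup>2) * h' x"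
    using dir by (subst AE_ball_countable) auto
  then have "AE x in lborel. x \<in> \<Omega> \<longrightarrow> (\<Sum>j=1..k. (g j x)\<^sup>2) \<le> (h x)\<^sup>2"
    using h'(4)
  proof eventually_elim
    case (elim x)
    have "(\<Sum>j=1..k. (g j x)\<^sup>2) \<le> (h' x)\<^sup>2"
      by (rule sum_squares_le_if_rational_directions) (use elim h'(2) in auto)
    then show ?case using elim by auto
  qed
  then show ?thesis using dist unfolding AE_lebesgue_iff by blast
qed

end
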